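(* Let $\mathcal L$ be the operator in $L_2(\mathbb R^d)$ given by $(\mathcal L u)(x)=\int_{\mathbb R^d}a(x-y)u(y)\,dy+V(x)u(x)$, where $a$ and $V$ satisfy the standing assumptions in the context. Let $V_{\min}\le a_{\min}$, let $V(x)\equiv V_{\min}$ on some cube $Q_r(x_0)$, and assume that at least one of the following two conditions holds: 1. $a_{\min}<0$ and $a_{\max}=0$; 2. for all $n\in\mathbb Z^d$ the quantities $$a_n:=(2r)^{-d}\int_{Q_{2r}(0)}a(x)e^{-\frac{\pi\mathrm i}{r}n\cdot x}\,dx$$ satisfy $a_n\le 0$, and there exists an infinite subsequence of indices in $\mathbb Z^d$ on which these inequalities are strict. Then $\mathcal L$ possesses countably (infinitely) many eigenvalues in the semi-interval $[a_{\min}+V_{\min},\mu_0)$, which accumulate to the point $\mu_0$.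
   Context: Let $d\ge 1$. Standing assumptions: $a\in L_1(\mathbb R^d)$ is complex-valued with $a(-x)=\overline{a(x)}$; $V=\mathcal F[\hat V]$ for some $\hat V\in L_1(\mathbb R^d)$ with $\hat V(-x)=\overline{\hat V(x)}$, where $\mathcal F[u](x):=\int_{\mathbb R^d}u(\xi)e^{-\mathrm i x\cdot\xi}\,d\xi$. Put $\hat a:=\mathcal F[a]$. Then $\hat a$ and $V$ are real-valued, bounded, continuous and tend to zero at infinity. Define $a_{\min}:=\inf_{\mathbb R^d}\hat a$, $a_{\max}:=\sup_{\mathbb R^d}\hat a$, $V_{\min}:=\inf_{\mathbb R^d}V$ and $\mu_0:=\min\{a_{\min},V_{\min}\}$. The operator $\mathcal L$ is bounded and self-adjoint in $L_2(\mathbb R^d)$. $Q_r(x_0)$, $r>0$, denotes the cube in $\mathbb R^d$ with side $r$ centered at $x_0$. The numbers $a_n$ are real because $a(-x)=\overline{a(x)}$. *)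

theory Defs
  imports "HOL-Analysis.Analysis"
begin

text \<open>
  Elements of the Lebesgue spaces over \<open>\<real>\<^sup>d\<close> are represented by measurable functions; equality in
  such a space is equality almost everywhere with respect to Lebesgue measure.
\<close>

definition L1 :: "((real ^ 'd) \<Rightarrow> complex) set" where
  "L1 = {u. integrable lebesgue u}"

definition L2 :: "((real ^ 'd) \<Rightarrow> complex) set" where
  "L2 = {u \<in> borel_measurable lebesgue. integrable lebesgue (\<lambda>x. (cmod (u x))\<^sup>2)}"

definition hermitian_fun :: "((real ^ 'd) \<Rightarrow> complex) \<Rightarrow> bool" where
  "hermitian_fun u \<longleftrightarrow> (AE x in lebesgue. u (- x) = cnj (u x))"

definition fourier :: "((real ^ 'd) \<Rightarrow> complex) \<Rightarrow> (real ^ 'd) \<Rightarrow> complex" where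
  "fourier u x = (LINT \<xi>|lebesgue. u \<xi> * exp (- \<i> * complex_of_real (x \<bullet> \<xi>)))"

text \<open>
  The transform of an integrable hermitian function is real-valued and bounded, so that the
  infima and suprema of its real part below are those of the function itself.
\<close>

lemma cmod_fourier_le:
  assumes "u \<in> L1"
  shows "cmod (fourier u x) \<le> (LINT \<xi>|lebesgue. cmod (u \<xi>))"
proof -
  have "cmod (fourier u x) \<le> (LINT \<xi>|lebesgue. cmod (u \<xi> * exp (- \<i> * complex_of_real (x \<bullet> \<xi>))))"
    unfolding fourier_def by (rule integral_norm_bound)
  also have "\<dots> = (LINT \<xi>|lebesgue. cmod (u \<xi>))"
    by (simp add: norm_mult)
  finally show ?thesis .
qed

lemma lebesgue_distr_minus: "distr lebesgue lebesgue uminus = (lebesgue :: (real ^ 'd) measure)"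
proof -
  have eq: "(\<lambda>x::real ^ 'd. 0 + (\<Sum>j\<in>Basis. (- 1 * (x \<bullet> j)) *\<^sub>R j)) = uminus"
    by (simp add: sum_negf euclidean_representation fun_eq_iff)
  show ?thesis
    using lebesgue_affine_euclidean[where c = "\<lambda>_::real ^ 'd. -1" and t = 0]
    unfolding eq by (simp add: density_1)
qed

lemma measurable_minus_lebesgue: "uminus \<in> lebesgue \<rightarrow>\<^sub>M (lebesgue :: (real ^ 'd) measure)"
  using lebesgue_measurable_scaling[of "-1"] by (simp add: scaleR_minus1_left[abs_def])

lemma integral_lebesgue_minus:
  fixes f :: "real ^ 'd \<Rightarrow> complex"
  assumes "f \<in> borel_measurable lebesgue"
  shows "(LINT x|lebesgue. f (- x)) = (LINT x|lebesgue. f x)"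
  using integral_distr[OF measurable_minus_lebesgue assms] by (simp add: lebesgue_distr_minus)

lemma fourier_real:
  assumes "u \<in> L1" "hermitian_fun u"
  shows "fourier u x \<in> \<real>"
proof -
  have u [measurable]: "u \<in> borel_measurable lebesgue"
    using assms(1) by (simp add: L1_def borel_measurable_integrable)
  define e where "e = (\<lambda>\<xi>. exp (- \<i> * complex_of_real (x \<bullet> \<xi>)))"
  have "e \<in> borel_measurable borel"
    unfolding e_def by (intro borel_measurable_continuous_onI continuous_intros)
  then have e: "e \<in> borel_measurable lebesgue"
    by (simp add: measurable_completion)
  have m: "(\<lambda>\<xi>. u \<xi> * e \<xi>) \<in> borel_measurable lebesgue"
    using u e by (rule borel_measurable_times)
  have m': "(\<lambda>\<xi>. u (- \<xi>) * e (- \<xi>)) \<in> borel_measurable lebesgue"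
    using measurable_compose[OF measurable_minus_lebesgue m] .
  have "cnj (fourier u x) = (LINT \<xi>|lebesgue. cnj (u \<xi> * e \<xi>))"
    unfolding fourier_def e_def by (rule Bochner_Integration.integral_cnj[symmetric])
  also have "\<dots> = (LINT \<xi>|lebesgue. u (- \<xi>) * e (- \<xi>))"
  proof (rule integral_cong_AE)
    show "(\<lambda>\<xi>. cnj (u \<xi> * e \<xi>)) \<in> borel_measurable lebesgue"
      by (rule measurable_compose[OF m]) (intro borel_measurable_continuous_onI continuous_intros)
    show "AE \<xi> in lebesgue. cnj (u \<xi> * e \<xi>) = u (- \<xi>) * e (- \<xi>)"
      using assms(2) unfolding hermitian_fun_def
      by eventually_elim (simp add: e_def exp_cnj)
  qed (rule m')
  also have "\<dots> = fourier u x"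
    using integral_lebesgue_minus[OF m] by (simp add: fourier_def e_def)
  finally show ?thesis
    by (simp add: Reals_cnj_iff)
qed

definition inf_Re :: "((real ^ 'd) \<Rightarrow> complex) \<Rightarrow> real" where
  "inf_Re f = (INF x. Re (f x))"

definition sup_Re :: "((real ^ 'd) \<Rightarrow> complex) \<Rightarrow> real" where
  "sup_Re f = (SUP x. Re (f x))"

text \<open>
  The cube is taken open. A continuous function is constant on the open cube iff it is constant on
  the closed one, and integrals over the two agree.
\<close>

definition cube :: "real \<Rightarrow> real ^ 'd \<Rightarrow> (real ^ 'd) set" where
  "cube r x\<^sub>0 = {x. \<forall>i. \<bar>x $ i - x\<^sub>0 $ i\<bar> < r / 2}"

text \<open>For hermitian \<open>a\<close> these coefficients are real numbers.\<close>

definition cube_coeff :: "((real ^ 'd) \<Rightarrow> complex) \<Rightarrow> real \<Rightarrow> int ^ 'd \<Rightarrow> complex" where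
  "cube_coeff a r n =
     complex_of_real (1 / (2 * r) ^ CARD('d)) *
     (LINT x:cube (2 * r) 0|lebesgue.
        a x * exp (- (of_real pi * \<i> / of_real r) * of_real (\<Sum>i\<in>UNIV. of_int (n $ i) * x $ i)))"

text \<open>
  For \<open>a \<in> L1\<close> and \<open>u \<in> L2\<close> the convolution integral exists for almost every \<open>x\<close> (Young); the
  value at the exceptional points is immaterial.
\<close>

definition conv_potential_op ::
    "((real ^ 'd) \<Rightarrow> complex) \<Rightarrow> ((real ^ 'd) \<Rightarrow> complex) \<Rightarrow>
     ((real ^ 'd) \<Rightarrow> complex) \<Rightarrow> (real ^ 'd) \<Rightarrow> complex" where
  "conv_potential_op a V u x = (LINT y|lebesgue. a (x - y) * u y) + V x * u x"

definition L2_eigenvalue ::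
    "(((real ^ 'd) \<Rightarrow> complex) \<Rightarrow> (real ^ 'd) \<Rightarrow> complex) \<Rightarrow> complex \<Rightarrow> bool" where
  "L2_eigenvalue T \<kappa> \<longleftrightarrow>
     (\<exists>u \<in> L2. \<not> (AE x in lebesgue. u x = 0) \<and> (AE x in lebesgue. T u x = \<kappa> * u x))"

end

theory Submission
  imports Defs "HOL-Complex_Analysis.Great_Picard" "HOL-Probability.Characteristic_Functions"
    "HOL-Library.Diagonal_Subsequence"
begin

text \<open>
  Write \<open>\<L> = A + M\<close> with the convolution \<open>A\<close> and the multiplication \<open>M\<close>, and let \<open>m = V_min < 0\<close>.
  Both \<open>A\<close> and \<open>M\<close> are bounded from below by \<open>m\<close>, and \<open>A M\<close> is compact because \<open>a\<close> is integrable and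
  \<open>V\<close> vanishes at infinity. For \<open>\<mu> < m\<close> the identity \<open>(A - \<mu>) (M - \<mu>) = A M - \<mu> (\<L> - \<mu>)\<close> then shows
  that approximate eigenvectors of \<open>\<L>\<close> at \<open>\<mu>\<close> have convergent subsequences. Hence the eigenvalues
  below \<open>m\<close> can accumulate only at \<open>m\<close>, and minimizing the form of \<open>\<L>\<close> on the orthogonal complement of
  the eigenvectors found so far yields infinitely many of them, as soon as \<open>\<L> - m\<close> is negative
  definite on subspaces of arbitrarily large dimension. Only finitely many lie below
  \<open>a_min + V_min < m\<close>.

  On functions \<open>f\<close> supported in the cube, the form of \<open>\<L> - m\<close> is that of \<open>A\<close>, the integral of \<open>a\<close>
  against the autocorrelation of \<open>f\<close>. Under the first condition it is negative by Plancherel's formula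
  on combinations of translates of a narrow tent function. Under the second one it is negative, by
  Parseval's formula on the cube of side \<open>2 r\<close>, on products of trigonometric polynomials with
  frequencies of negative coefficients and the positive part of \<open>\<Prod>\<^sub>i cos (\<pi> (x - x\<^sub>0)\<^sub>i / r)\<close>
  (factor by factor), which is a uniform limit of trigonometric polynomials supported in the cube of
  side \<open>r\<close> modulo periods. In both cases strictness follows from the linear independence of
  exponentials on balls.
\<close>

section \<open>Discrete spectrum of a sum of two bounded symmetric operators\<close>

text \<open>Neither \<open>A\<close> nor \<open>M\<close> need be compact; only the product
  \<open>A M\<close> is. This is why the bound by \<open>m\<close> is demanded of both summands:
  below \<open>m\<close> the product of the two shifted operators is still bounded from below.
  Distinctness of the infinitely many eigenvalues comes from the same compactness, which rules out
  infinite multiplicity.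

  The cube of side \<open>2 * r\<close> in the second condition is the set of differences of points
  of the cube of side \<open>r\<close>: the autocorrelation of a test function lives there, so only
  the values of \<open>a\<close> on it matter, and they may be continued with period
  \<open>2 * r\<close>. The test functions have to vanish off the smaller cube and yet be accessible
  to Fourier series of that period, whence a factor that occupies half a period in each direction.

  Limits of the regularized or approximate identities preserve only weak inequalities; each sign
  argument therefore keeps an explicit negative term that survives the limit.\<close>

locale semicompact_sum =
  fixes A M :: "'h::{real_inner, complete_space} \<Rightarrow> 'h" and m :: real
  assumes bounded_linear_A: "bounded_linear A" and bounded_linear_M: "bounded_linear M"
    and symmetric_A: "\<And>u v. inner (A u) v = inner u (A v)"
    and symmetric_M: "\<And>u v. inner (M u) v = inner u (M v)"
    and form_A_ge: "\<And>u. m * (norm u)\<^sup>2 \<le> inner (A u) u"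
    and form_M_ge: "\<And>u. m * (norm u)\<^sup>2 \<le> inner (M u) u"
    and compact_comp:
      "\<And>u::nat \<Rightarrow> 'h. bounded (range u) \<Longrightarrow> \<exists>r. strict_mono r \<and> convergent (\<lambda>k. A (M (u (r k))))"
begin

definition L :: "'h \<Rightarrow> 'h" where "L u = A u + M u"

definition eigenvalue_below :: "real \<Rightarrow> bool" where
  "eigenvalue_below \<kappa> \<longleftrightarrow> \<kappa> < m \<and> (\<exists>u. u \<noteq> 0 \<and> L u = \<kappa> *\<^sub>R u)"

sublocale A: bounded_linear A by (rule bounded_linear_A)
sublocale M: bounded_linear M by (rule bounded_linear_M)

lemma bounded_linear_L: "bounded_linear L"
  unfolding L_def using bounded_linear_A bounded_linear_M by (rule bounded_linear_add)

sublocale L: bounded_linear L by (rule bounded_linear_L)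

lemma symmetric_L: "inner (L u) v = inner u (L v)"
  by (simp add: L_def inner_add_left inner_add_right symmetric_A symmetric_M)

text \<open>Cauchy--Schwarz turns the form bound into a norm bound. It serves both factors of the
  product below.\<close>

lemma norm_ge_of_form_ge:
  fixes T :: "'h \<Rightarrow> 'h"
  assumes "m * (norm v)\<^sup>2 \<le> inner (T v) v"
  shows "(m - \<mu>) * norm v \<le> norm (T v - \<mu> *\<^sub>R v)"
proof (cases "v = 0")
  case False
  have "(m - \<mu>) * norm v * norm v \<le> inner (T v - \<mu> *\<^sub>R v) v"
    using assms by (simp add: inner_diff_left power2_eq_square algebra_simps dot_square_norm)
  also have "\<dots> \<le> norm (T v - \<mu> *\<^sub>R v) * norm v"
    by (rule norm_cauchy_schwarz)
  finally show ?thesis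
    using False by simp
qed simp

text \<open>
  The factorization \<open>(A - \<mu>) (M - \<mu>) = A M - \<mu> (L - \<mu>)\<close> exhibits \<open>L - \<mu>\<close> as a compact perturbation
  of an operator that is bounded from below, for every \<open>\<mu> < m\<close>.
\<close>

lemma convergent_subseq_of_approx_eigenvectors:
  assumes \<mu>: "\<mu> < m" and u: "bounded (range u)"
    and lim: "(\<lambda>k. L (u k) - \<mu> *\<^sub>R u k) \<longlonglongrightarrow> 0"
  shows "\<exists>r v. strict_mono (r :: nat \<Rightarrow> nat) \<and> (\<lambda>k. u (r k)) \<longlonglongrightarrow> v"
proof -
  obtain r :: "nat \<Rightarrow> nat" where r: "strict_mono r" and conv: "convergent (\<lambda>k. A (M (u (r k))))"
    using compact_comp[OF u] by blast
  define B where "B v = A (M v - \<mu> *\<^sub>R v) - \<mu> *\<^sub>R (M v - \<mu> *\<^sub>R v)" for v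
  have B_eq: "B v = A (M v) - \<mu> *\<^sub>R (L v - \<mu> *\<^sub>R v)" for v
    by (simp add: B_def L_def A.diff A.scaleR algebra_simps)
  have B_ge: "(m - \<mu>)\<^sup>2 * norm v \<le> norm (B v)" for v
  proof -
    have "(m - \<mu>) * ((m - \<mu>) * norm v) \<le> (m - \<mu>) * norm (M v - \<mu> *\<^sub>R v)"
      using norm_ge_of_form_ge[where T = M and v = v and \<mu> = \<mu>, OF form_M_ge] \<mu> by (intro mult_left_mono) auto
    also have "\<dots> \<le> norm (B v)"
      unfolding B_def by (rule norm_ge_of_form_ge[where T = A, OF form_A_ge])
    finally show ?thesis by (simp add: power2_eq_square algebra_simps)
  qed
  have B_diff: "B (v - w) = B v - B w" for v w
    by (simp add: B_def A.diff A.add M.diff A.scaleR algebra_simps)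
  have "(\<lambda>k. \<mu> *\<^sub>R (L (u (r k)) - \<mu> *\<^sub>R u (r k))) \<longlonglongrightarrow> \<mu> *\<^sub>R 0"
    using LIMSEQ_subseq_LIMSEQ[OF lim r] by (intro tendsto_intros) (simp add: o_def)
  then have "convergent (\<lambda>k. B (u (r k)))"
    unfolding B_eq using conv by (intro convergent_diff) (auto simp: convergent_def)
  then have cB: "Cauchy (\<lambda>k. B (u (r k)))"
    by (rule convergent_Cauchy)
  \<comment> \<open>\<open>B\<close> is linear and bounded from below by
    \<open>(m - \<mu>)\<^sup>2\<close>, so the Cauchy property of the images passes back to
    \<open>u\<close>.\<close>
  have "Cauchy (\<lambda>k. u (r k))"
  proof (rule CauchyI)
    fix e :: real assume "e > 0"
    then have "(m - \<mu>)\<^sup>2 * e > 0" using \<mu> by simp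
    then obtain N where N: "\<And>j k. N \<le> j \<Longrightarrow> N \<le> k \<Longrightarrow> norm (B (u (r j)) - B (u (r k))) < (m - \<mu>)\<^sup>2 * e"
      using CauchyD[OF cB] by blast
    have "norm (u (r j) - u (r k)) < e" if "N \<le> j" "N \<le> k" for j k
    proof -
      have "(m - \<mu>)\<^sup>2 * norm (u (r j) - u (r k)) < (m - \<mu>)\<^sup>2 * e"
        using B_ge[of "u (r j) - u (r k)"] N[OF that] by (simp add: B_diff)
      then show ?thesis using \<mu> by simp
    qed
    then show "\<exists>N. \<forall>j\<ge>N. \<forall>k\<ge>N. norm (u (r j) - u (r k)) < e" by blast
  qed
  then show ?thesis
    using r by (auto simp: Cauchy_convergent_iff convergent_def)
qed

text \<open>Orthonormal vectors keep the distance sqrt 2, which no convergent subsequence allows.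
  The contradiction is used twice: against eigenvalues accumulating below \<open>m\<close>, and
  against an eigenvalue of infinite multiplicity.\<close>

lemma no_orthonormal_approx_eigenvectors:
  assumes \<mu>: "\<mu> < m" and norm_u: "\<And>k. norm (u k) = 1"
    and orth: "\<And>j k. j \<noteq> k \<Longrightarrow> inner (u j) (u k) = 0"
    and lim: "(\<lambda>k::nat. L (u k) - \<mu> *\<^sub>R u k) \<longlonglongrightarrow> 0"
  shows False
proof -
  have "bounded (range u)"
    using norm_u by (auto simp: bounded_iff)
  then obtain r :: "nat \<Rightarrow> nat" and v where r: "strict_mono r" and v: "(\<lambda>k. u (r k)) \<longlonglongrightarrow> v"
    using convergent_subseq_of_approx_eigenvectors[OF \<mu> _ lim] by blast
  have dist2: "(norm (u (r (Suc k)) - u (r k)))\<^sup>2 = 2" for k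
  proof -
    have "r (Suc k) \<noteq> r k" using r by (metis less_irrefl lessI strict_mono_less)
    then show ?thesis
      using orth[of "r (Suc k)" "r k"] orth[of "r k" "r (Suc k)"] norm_u
      by (simp add: power2_norm_eq_inner inner_diff_left inner_diff_right)
         (simp add: dot_square_norm)
  qed
  have "(\<lambda>k. (norm (u (r (Suc k)) - u (r k)))\<^sup>2) \<longlonglongrightarrow> (norm (v - v))\<^sup>2"
    using LIMSEQ_Suc[OF v] v by (intro tendsto_intros)
  then show False
    unfolding dist2 by (simp add: LIMSEQ_const_iff)
qed

lemma eigenvalue_bound:
  assumes "u \<noteq> 0" "L u = \<kappa> *\<^sub>R u"
  shows "\<bar>\<kappa>\<bar> \<le> onorm L"
proof -
  have "\<bar>\<kappa>\<bar> * norm u \<le> onorm L * norm u"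
    using onorm[OF bounded_linear_L, of u] assms(2) by simp
  then show ?thesis using assms(1) by simp
qed

text \<open>Symmetry makes eigenvectors of distinct eigenvalues orthogonal, and boundedness of
  \<open>L\<close> keeps the eigenvalues in a compact interval. At a limit point
  \<open>\<mu> \<le> b\<close> the normalized eigenvectors would be orthonormal approximate
  eigenvectors.\<close>

lemma finite_eigenvalues_below:
  assumes "b < m"
  shows "finite {\<kappa>. eigenvalue_below \<kappa> \<and> \<kappa> \<le> b}"
proof (rule ccontr)
  assume inf: "\<not> finite {\<kappa>. eigenvalue_below \<kappa> \<and> \<kappa> \<le> b}" (is "\<not> finite ?S")
  then obtain f :: "nat \<Rightarrow> real" where f: "inj f" "range f \<subseteq> ?S"
    using infinite_countable_subset by blast
  have "f n \<in> {- onorm L .. b}" for n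
  proof -
    have "eigenvalue_below (f n)" "f n \<le> b" using f(2) by blast+
    then show ?thesis using eigenvalue_bound[of _ "f n"] by (force simp: eigenvalue_below_def)
  qed
  then have "range f \<subseteq> {- onorm L .. b}" by blast
  then obtain \<mu> r where \<mu>: "\<mu> \<in> {- onorm L .. b}" and r: "strict_mono (r :: nat \<Rightarrow> nat)"
    and lim: "(f \<circ> r) \<longlonglongrightarrow> \<mu>"
    using compact_Icc[of "- onorm L" b] unfolding compact_eq_seq_compact_metric seq_compact_def
    by (metis range_subsetD)
  have "\<exists>u. norm u = 1 \<and> L u = f (r k) *\<^sub>R u" for k
  proof -
    obtain u where "u \<noteq> 0" "L u = f (r k) *\<^sub>R u"
      using f(2) unfolding eigenvalue_below_def by blast
    then have "norm (u /\<^sub>R norm u) = 1 \<and> L (u /\<^sub>R norm u) = f (r k) *\<^sub>R (u /\<^sub>R norm u)"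
      by (simp add: L.scaleR)
    then show ?thesis by blast
  qed
  then obtain u where u: "\<And>k. norm (u k) = 1" "\<And>k. L (u k) = f (r k) *\<^sub>R u k" by metis
  show False
  proof (rule no_orthonormal_approx_eigenvectors[of \<mu> u])
    show "\<mu> < m" using \<mu> assms by simp
    show "inner (u j) (u k) = 0" if "j \<noteq> k" for j k
    proof -
      have "f (r j) \<noteq> f (r k)"
        using that f(1) r by (metis injD strict_mono_eq)
      moreover have "f (r j) * inner (u j) (u k) = f (r k) * inner (u j) (u k)"
        using symmetric_L[of "u j" "u k"] by (simp add: u)
      ultimately show ?thesis by simp
    qed
    have "(\<lambda>k. (f (r k) - \<mu>) *\<^sub>R u k) \<longlonglongrightarrow> 0"
    proof (rule tendsto_norm_zero_cancel)
      have "(\<lambda>k. \<bar>f (r k) - \<mu>\<bar>) \<longlonglongrightarrow> \<bar>\<mu> - \<mu>\<bar>"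
        using lim by (intro tendsto_intros) (simp add: o_def)
      then show "(\<lambda>k. norm ((f (r k) - \<mu>) *\<^sub>R u k)) \<longlonglongrightarrow> 0"
        by (simp add: u)
    qed
    then show "(\<lambda>k. L (u k) - \<mu> *\<^sub>R u k) \<longlonglongrightarrow> 0"
      by (simp add: u algebra_simps)
  qed (rule u(1))
qed

text \<open>Rayleigh--Ritz on the \<open>L\<close>-invariant closed subspace \<open>X\<close>
  orthogonal to \<open>W\<close>. The infimum of the form lies below \<open>m\<close> because of
  \<open>v\<close>, and a minimizing sequence turns out to consist of approximate eigenvectors, so
  it converges in norm along a subsequence; no weak limits enter.\<close>

lemma ex_eigenvector_orthogonal:
  assumes eig: "\<And>w. w \<in> W \<Longrightarrow> \<exists>\<kappa>. L w = \<kappa> *\<^sub>R w"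
    and v: "\<And>w. w \<in> W \<Longrightarrow> inner v w = 0" "inner (L v) v < m * (norm v)\<^sup>2"
  shows "\<exists>\<mu> u. \<mu> < m \<and> norm u = 1 \<and> L u = \<mu> *\<^sub>R u \<and> (\<forall>w\<in>W. inner u w = 0)"
proof -
  define X where "X = {u. \<forall>w\<in>W. inner u w = 0}"
  have LX: "L u \<in> X" if "u \<in> X" for u
    unfolding X_def
  proof safe
    fix w assume w: "w \<in> W"
    then obtain \<kappa> where "L w = \<kappa> *\<^sub>R w" using eig by blast
    then show "inner (L u) w = 0" using that w by (simp add: symmetric_L X_def)
  qed
  have lin: "u + t *\<^sub>R w \<in> X" if "u \<in> X" "w \<in> X" for u w t
    using that by (auto simp: X_def inner_add_left)
  have zero: "0 \<in> X" by (simp add: X_def)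
  have closed: "closed X"
  proof -
    have "X = (\<Inter>w\<in>W. {u. inner u w = 0})" by (auto simp: X_def)
    moreover have "closed {u. inner u w = (0::real)}" for w :: 'h
      by (intro closed_Collect_eq continuous_intros)
    ultimately show ?thesis by auto
  qed
  define Q where "Q = (\<lambda>u. inner (L u) u) ` {u \<in> X. norm u = 1}"
  have v0: "v \<noteq> 0" using v(2) by auto
  have vQ: "inner (L v) v / (norm v)\<^sup>2 \<in> Q"
  proof -
    have "v /\<^sub>R norm v \<in> X" using lin[OF zero, of v "inverse (norm v)"] v(1) by (simp add: X_def)
    moreover have "inner (L (v /\<^sub>R norm v)) (v /\<^sub>R norm v) = inner (L v) v / (norm v)\<^sup>2"
      by (simp add: L.scaleR power2_eq_square divide_simps)
    ultimately show ?thesis using v0 unfolding Q_def by (intro image_eqI[of _ _ "v /\<^sub>R norm v"]) auto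
  qed
  have Q_ge: "- onorm L \<le> q" if q: "q \<in> Q" for q
  proof -
    obtain u where u: "norm u = 1" "q = inner (L u) u" using q by (auto simp: Q_def)
    have "\<bar>inner (L u) u\<bar> \<le> norm (L u) * norm u" by (rule Cauchy_Schwarz_ineq2)
    also have "\<dots> \<le> onorm L * norm u * norm u"
      by (intro mult_right_mono onorm bounded_linear_L) simp
    finally show ?thesis using u by simp
  qed
  then have bdd: "bdd_below Q" by (auto simp: bdd_below_def)
  define \<mu> where "\<mu> = Inf Q"
  have "\<mu> \<le> inner (L v) v / (norm v)\<^sup>2"
    unfolding \<mu>_def using vQ bdd by (rule cInf_lower)
  also have "\<dots> < m" using v(2) v0 by (simp add: pos_divide_less_eq)
  finally have \<mu>: "\<mu> < m" .
  define T where "T u = L u - \<mu> *\<^sub>R u" for u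
  have T_bl: "bounded_linear T"
    unfolding T_def
    by (intro bounded_linear_sub bounded_linear_L bounded_linear_scaleR_right)
  interpret T: bounded_linear T by (rule T_bl)
  have T_sym: "inner (T u) w = inner u (T w)" for u w
    by (simp add: T_def inner_diff_left inner_diff_right symmetric_L)
  have T_nonneg: "0 \<le> inner (T u) u" if "u \<in> X" for u
  proof (cases "u = 0")
    case False
    have "u /\<^sub>R norm u \<in> X" using lin[OF zero that, of "inverse (norm u)"] by simp
    then have "inner (L (u /\<^sub>R norm u)) (u /\<^sub>R norm u) \<in> Q"
      using False unfolding Q_def by (intro image_eqI[of _ _ "u /\<^sub>R norm u"]) auto
    then have "\<mu> \<le> inner (L (u /\<^sub>R norm u)) (u /\<^sub>R norm u)"
      unfolding \<mu>_def using bdd by (rule cInf_lower)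
    also have "\<dots> = inner (L u) u / (norm u)\<^sup>2"
      by (simp add: L.scaleR power2_eq_square divide_simps)
    finally have "\<mu> * (norm u)\<^sup>2 \<le> inner (L u) u"
      using False by (simp add: pos_le_divide_eq)
    then show ?thesis by (simp add: T_def inner_diff_left dot_square_norm)
  qed (simp add: T.zero)
  \<comment> \<open>The summand 1 makes \<open>C\<close> positive even if \<open>T\<close> is
    zero.\<close>
  define C where "C = onorm T + 1"
  have C: "C > 0" using onorm_pos_le[OF T_bl] by (simp add: C_def)
  \<comment> \<open>A symmetric operator that is nonnegative on \<open>X\<close> and has a small
    form value at \<open>u\<close> has a small image there. This follows from testing the
    nonnegativity at the gradient step \<open>u - T u / C\<close>; the step length
    \<open>1 / C\<close> balances the linear gain against the quadratic term.\<close>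
  have T_norm: "(norm (T u))\<^sup>2 \<le> C * inner (T u) u" if u: "u \<in> X" for u
  proof -
    define w where "w = T u"
    have wX: "w \<in> X"
      using lin[OF LX[OF u] u, of "- \<mu>"] by (simp add: w_def T_def)
    have "inner (T w) w \<le> norm (T w) * norm w" by (rule norm_cauchy_schwarz)
    also have "\<dots> \<le> (onorm T * norm w) * norm w"
      by (intro mult_right_mono onorm T_bl) simp
    also have "\<dots> \<le> C * (norm w)\<^sup>2"
      by (simp add: C_def power2_eq_square algebra_simps)
    finally have Tw: "inner (T w) w \<le> C * (norm w)\<^sup>2" .
    have "0 \<le> inner (T (u + (- 1 / C) *\<^sub>R w)) (u + (- 1 / C) *\<^sub>R w)"
      by (intro T_nonneg lin u wX)
    also have "\<dots> = inner (T u) u - 2 / C * (norm w)\<^sup>2 + inner (T w) w / C\<^sup>2"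
      by (simp add: T.add T.scaleR T.diff inner_add_left inner_add_right inner_diff_left inner_diff_right
          T_sym[of w u] power2_norm_eq_inner flip: w_def)
         (simp add: field_simps diff_divide_distrib power2_eq_square inner_commute T_sym[of u u] flip: w_def)
    also have "\<dots> \<le> inner (T u) u - 2 / C * (norm w)\<^sup>2 + C * (norm w)\<^sup>2 / C\<^sup>2"
      using Tw by (intro add_left_mono divide_right_mono) auto
    also have "\<dots> = inner (T u) u - (norm w)\<^sup>2 / C"
      using C by (simp add: power2_eq_square field_simps)
    finally show ?thesis using C by (simp add: w_def field_simps)
  qed
  have "\<exists>u\<in>X. norm u = 1 \<and> inner (L u) u < \<mu> + inverse (real (Suc k))" for k
  proof -
    have "\<exists>q\<in>Q. q < \<mu> + inverse (real (Suc k))"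
      unfolding \<mu>_def using vQ by (intro cInf_lessD) auto
    then show ?thesis by (auto simp: Q_def)
  qed
  then obtain u where uX: "\<And>k. u k \<in> X" and un: "\<And>k. norm (u k) = 1"
    and uq: "\<And>k. inner (L (u k)) (u k) < \<mu> + inverse (real (Suc k))" by metis
  have Tle: "(norm (T (u k)))\<^sup>2 \<le> C * inverse (real (Suc k))" for k
  proof -
    have "(norm (T (u k)))\<^sup>2 \<le> C * inner (T (u k)) (u k)" by (rule T_norm[OF uX])
    also have "\<dots> \<le> C * inverse (real (Suc k))"
      using uq[of k] C un[of k] by (intro mult_left_mono) (auto simp: T_def inner_diff_left dot_square_norm)
    finally show ?thesis .
  qed
  have "(\<lambda>k. (norm (T (u k)))\<^sup>2) \<longlonglongrightarrow> 0"
  proof (rule tendsto_sandwich[OF _ _ tendsto_const])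
    show "(\<lambda>k. C * inverse (real (Suc k))) \<longlonglongrightarrow> 0"
      using tendsto_mult_right_zero[OF LIMSEQ_inverse_real_of_nat] by simp
  qed (use Tle in auto)
  then have "(\<lambda>k. T (u k)) \<longlonglongrightarrow> 0"
    using tendsto_norm_zero_cancel by (simp add: tendsto_norm_zero_iff) 
  then have Tlim: "(\<lambda>k. L (u k) - \<mu> *\<^sub>R u k) \<longlonglongrightarrow> 0" by (simp add: T_def)
  have "bounded (range u)" using un by (auto simp: bounded_iff)
  then obtain r :: "nat \<Rightarrow> nat" and w where r: "strict_mono r" and w: "(\<lambda>k. u (r k)) \<longlonglongrightarrow> w"
    using convergent_subseq_of_approx_eigenvectors[OF \<mu> _ Tlim] by blast
  have "w \<in> X"
    using closed_sequentially[OF closed _ w] uX by blast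
  moreover have "norm w = 1"
    using tendsto_norm[OF w] by (simp add: un LIMSEQ_const_iff)
  moreover have "T w = 0"
  proof (rule LIMSEQ_unique)
    show "(\<lambda>k. T (u (r k))) \<longlonglongrightarrow> T w" by (rule T.tendsto[OF w])
    show "(\<lambda>k. T (u (r k))) \<longlonglongrightarrow> 0"
      using LIMSEQ_subseq_LIMSEQ[OF Tlim r] by (simp add: o_def T_def)
  qed
  ultimately show ?thesis
    using \<mu> by (auto simp: T_def X_def intro!: exI[of _ \<mu>] exI[of _ w])
qed

end

text \<open>There are \<open>N\<close> linear conditions on \<open>N + 1\<close> coefficients.
  Linear dependence is a property of sets, so a coincidence among the projections of the
  \<open>h j\<close> to the span of the \<open>u i\<close> is treated separately, by the difference
  of the two vectors concerned.\<close>

lemma ex_combination_orthogonal: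
  fixes h u :: "nat \<Rightarrow> 'a::real_inner"
  assumes norm_u: "\<And>i. i < N \<Longrightarrow> norm (u i) = 1"
    and orth: "\<And>i j. i < N \<Longrightarrow> j < N \<Longrightarrow> i \<noteq> j \<Longrightarrow> inner (u i) (u j) = 0"
  shows "\<exists>c. (\<exists>j\<le>N. c j \<noteq> 0) \<and> (\<forall>i<N. inner (\<Sum>j\<le>N. c j *\<^sub>R h j) (u i) = 0)"
proof -
  define P where "P x = (\<Sum>i<N. inner x (u i) *\<^sub>R u i)" for x
  have P_u: "inner (P x) (u i) = inner x (u i)" if "i < N" for x i
  proof -
    have "inner (P x) (u i) = (\<Sum>j<N. if j = i then inner x (u i) else 0)"
      unfolding P_def inner_sum_left
      using norm_u orth that by (intro sum.cong) (auto simp: dot_square_norm)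
    then show ?thesis using that by simp
  qed
  have P_lin: "P (\<Sum>j\<le>N. c j *\<^sub>R h j) = (\<Sum>j\<le>N. c j *\<^sub>R P (h j))" for c :: "nat \<Rightarrow> real"
    unfolding P_def scaleR_right.sum inner_sum_left scaleR_sum_left
    by (subst sum.swap) simp
  have "\<exists>c. (\<exists>j\<le>N. c j \<noteq> 0) \<and> (\<Sum>j\<le>N. c j *\<^sub>R P (h j)) = 0"
  proof (cases "inj_on (\<lambda>j. P (h j)) {..N}")
    case True
    let ?S = "(\<lambda>j. P (h j)) ` {..N}"
    have "?S \<subseteq> span (u ` {..<N})"
      unfolding P_def by (auto intro: span_sum span_scale span_base)
    moreover have "card (u ` {..<N}) \<le> N"
      using card_image_le[of "{..<N}" u] by simp
    moreover have "card ?S = Suc N" using card_image[OF True] by simp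
    ultimately have "dependent ?S"
      using independent_span_bound[of "u ` {..<N}" ?S] by auto
    then obtain d where d: "\<exists>v\<in>?S. d v \<noteq> 0" "(\<Sum>v\<in>?S. d v *\<^sub>R v) = 0"
      by (auto simp: dependent_finite)
    show ?thesis
      using d by (intro exI[of _ "\<lambda>j. d (P (h j))"]) (auto simp: sum.reindex[OF True])
  next
    case False
    then obtain j k where jk: "j \<le> N" "k \<le> N" "j \<noteq> k" "P (h j) = P (h k)"
      by (auto simp: inj_on_def)
    let ?c = "\<lambda>i. (if i = j then 1 else 0) - (if i = k then 1 else (0::real))"
    have "(\<Sum>i\<le>N. ?c i *\<^sub>R P (h i)) = 0"
      using jk by (simp add: scaleR_diff_left sum_subtractf if_distrib[of "\<lambda>x. x *\<^sub>R _"] cong: if_cong)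
    then show ?thesis using jk by (intro exI[of _ ?c]) auto
  qed
  then show ?thesis using P_lin P_u by (metis inner_zero_left)
qed

context semicompact_sum
begin

text \<open>The first \<open>n + 1\<close> test vectors always have a combination orthogonal to the
  \<open>n\<close> eigenvectors found so far, so the construction never stops. With finitely many
  eigenvalues, one of them would recur infinitely often along the orthonormal sequence, which is
  impossible.\<close>

lemma infinite_eigenvalues_below:
  fixes h :: "nat \<Rightarrow> 'h"
  assumes neg: "\<And>N c. \<exists>j\<le>N. c j \<noteq> 0 \<Longrightarrow>
      inner (L (\<Sum>j\<le>N. c j *\<^sub>R h j)) (\<Sum>j\<le>N. c j *\<^sub>R h j) < m * (norm (\<Sum>j\<le>N. c j *\<^sub>R h j))\<^sup>2"
  shows "infinite {\<kappa>. eigenvalue_below \<kappa>}"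
proof
  assume fin: "finite {\<kappa>. eigenvalue_below \<kappa>}"
  \<comment> \<open>The condition looks at \<open>f\<close> below \<open>n\<close> only, as the
    recursive choice requires.\<close>
  define P where "P f n u \<longleftrightarrow> norm u = 1 \<and> (\<exists>\<kappa><m. L u = \<kappa> *\<^sub>R u) \<and> (\<forall>i<n. inner u (f i) = 0)"
    for f :: "nat \<Rightarrow> 'h" and n :: nat and u
  have "\<exists>u. \<forall>n. P u n (u n)"
  proof (rule dependent_wellorder_choice)
    fix n :: nat and f :: "nat \<Rightarrow> 'h"
    assume f: "\<And>i. i < n \<Longrightarrow> P f i (f i)"
    have "inner (f i) (f j) = 0" if "i < n" "j < n" "i \<noteq> j" for i j
      using f[OF that(1)] f[OF that(2)] that(3) unfolding P_def
      by (metis inner_commute linorder_neqE_nat)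
    then obtain c where c: "\<exists>j\<le>n. c j \<noteq> 0"
      and orth: "\<forall>i<n. inner (\<Sum>j\<le>n. c j *\<^sub>R h j) (f i) = 0"
      using ex_combination_orthogonal[of n f h] f unfolding P_def by blast
    have "\<exists>\<mu> u. \<mu> < m \<and> norm u = 1 \<and> L u = \<mu> *\<^sub>R u \<and> (\<forall>w\<in>f ` {..<n}. inner u w = 0)"
    proof (rule ex_eigenvector_orthogonal)
      show "\<exists>\<kappa>. L w = \<kappa> *\<^sub>R w" if "w \<in> f ` {..<n}" for w
        using that f by (auto simp: P_def)
    qed (use orth neg[OF c] in auto)
    then show "\<exists>u. P f n u" by (auto simp: P_def)
  qed (simp add: P_def)
  then obtain u where "\<And>n. P u n (u n)" by blast
  then have un: "\<And>n. norm (u n) = 1" and "\<And>n. \<exists>\<kappa><m. L (u n) = \<kappa> *\<^sub>R u n"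
    and uo: "\<And>i n. i < n \<Longrightarrow> inner (u n) (u i) = 0"
    by (auto simp: P_def)
  then obtain \<kappa> where \<kappa>: "\<And>n. \<kappa> n < m" "\<And>n. L (u n) = \<kappa> n *\<^sub>R u n" by metis
  have "\<kappa> n \<in> {\<kappa>. eigenvalue_below \<kappa>}" for n
    using \<kappa>[of n] un[of n] by (auto simp: eigenvalue_below_def intro!: exI[of _ "u n"])
  then have "finite (range \<kappa>)" using fin by (meson finite_subset image_subsetI)
  then obtain n0 where "infinite {n. \<kappa> n = \<kappa> n0}"
    using pigeonhole_infinite[of "UNIV :: nat set" \<kappa>] by auto
  then obtain r :: "nat \<Rightarrow> nat" where r: "strict_mono r" "\<And>k. \<kappa> (r k) = \<kappa> n0"
    using infinite_enumerate by blast
  show False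
  proof (rule no_orthonormal_approx_eigenvectors[of "\<kappa> n0" "\<lambda>k. u (r k)"])
    show "inner (u (r j)) (u (r k)) = 0" if "j \<noteq> k" for j k
      using uo[of "r j" "r k"] uo[of "r k" "r j"] that r(1)
      by (metis inner_commute linorder_neqE_nat strict_mono_eq)
  qed (auto simp: un \<kappa> r)
qed

end

section \<open>The Hilbert space of square integrable functions\<close>

text \<open>Borel functions and \<open>lborel\<close> are used instead of the Lebesgue completion,
  so that the convolution kernel is jointly measurable and Fubini's theorem applies on products of
  \<open>lborel\<close>.\<close>

definition square_integrable :: "('a::euclidean_space \<Rightarrow> complex) \<Rightarrow> bool" where
  "square_integrable f \<longleftrightarrow>
     f \<in> borel_measurable borel \<and> integrable lborel (\<lambda>x. (cmod (f x))\<^sup>2)"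

lemma square_integrable_measurable [measurable_dest]:
  "square_integrable f \<Longrightarrow> f \<in> borel_measurable borel"
  by (simp add: square_integrable_def)

lemma square_integrable_integrable: "square_integrable f \<Longrightarrow> integrable lborel (\<lambda>x. (cmod (f x))\<^sup>2)"
  by (simp add: square_integrable_def)

lemma square_integrable_bound:
  assumes [measurable]: "f \<in> borel_measurable borel"
    and "integrable lborel g" "\<And>x. (cmod (f x))\<^sup>2 \<le> g x"
  shows "square_integrable f"
  unfolding square_integrable_def
proof
  show "integrable lborel (\<lambda>x. (cmod (f x))\<^sup>2)"
    using assms(3) by (intro Bochner_Integration.integrable_bound[OF assms(2)] AE_I2)
      (auto intro: order_trans[OF _ abs_ge_self])
qed fact

lemma square_integrable_zero [simp]: "square_integrable (\<lambda>_. 0)"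
  by (simp add: square_integrable_def)

lemma cmod_add_sq: "(cmod (x + y))\<^sup>2 \<le> 2 * (cmod x)\<^sup>2 + 2 * (cmod y)\<^sup>2"
proof -
  have "(cmod (x + y))\<^sup>2 \<le> (cmod x + cmod y)\<^sup>2"
    by (intro power_mono norm_triangle_ineq) simp
  also have "\<dots> \<le> 2 * (cmod x)\<^sup>2 + 2 * (cmod y)\<^sup>2"
    using sum_squares_bound[of "cmod x" "cmod y"] by (simp add: power2_sum)
  finally show ?thesis .
qed

lemma square_integrable_add:
  assumes "square_integrable f" "square_integrable g"
  shows "square_integrable (\<lambda>x. f x + g x)"
proof (rule square_integrable_bound)
  show "integrable lborel (\<lambda>x. 2 * (cmod (f x))\<^sup>2 + 2 * (cmod (g x))\<^sup>2)"
    using assms by (simp add: square_integrable_def)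
qed (use assms in \<open>auto simp: square_integrable_def intro: cmod_add_sq\<close>)

lemma square_integrable_mult_bounded:
  assumes "square_integrable f" and [measurable]: "g \<in> borel_measurable borel"
    and "\<And>x. cmod (g x) \<le> B"
  shows "square_integrable (\<lambda>x. g x * f x)"
proof (rule square_integrable_bound)
  show "integrable lborel (\<lambda>x. B\<^sup>2 * (cmod (f x))\<^sup>2)"
    using assms by (simp add: square_integrable_def)
  show "(cmod (g x * f x))\<^sup>2 \<le> B\<^sup>2 * (cmod (f x))\<^sup>2" for x
    using assms(3)[of x] by (auto simp: norm_mult power_mult_distrib intro!: mult_right_mono power_mono)
qed (use assms in \<open>auto simp: square_integrable_def\<close>)

lemma square_integrable_cmult: "square_integrable f \<Longrightarrow> square_integrable (\<lambda>x. c * f x)"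
  using square_integrable_mult_bounded[of f "\<lambda>_. c" "cmod c"] by simp

lemma square_integrable_scaleR: "square_integrable f \<Longrightarrow> square_integrable (\<lambda>x. c *\<^sub>R f x)"
  using square_integrable_cmult[of f "complex_of_real c"] by (simp add: scaleR_conv_of_real)

lemma square_integrable_minus: "square_integrable f \<Longrightarrow> square_integrable (\<lambda>x. - f x)"
  using square_integrable_cmult[of f "-1"] by simp

lemma square_integrable_diff:
  "square_integrable f \<Longrightarrow> square_integrable g \<Longrightarrow> square_integrable (\<lambda>x. f x - g x)"
  using square_integrable_add[of f "\<lambda>x. - g x"] square_integrable_minus[of g] by simp

lemma square_integrable_cnj: "square_integrable f \<Longrightarrow> square_integrable (\<lambda>x. cnj (f x))"
proof -
  assume f: "square_integrable f"
  then have [measurable]: "f \<in> borel_measurable borel" by (simp add: square_integrable_def)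
  have "(\<lambda>x. cnj (f x)) \<in> borel_measurable borel"
    by (rule measurable_compose[OF _ borel_measurable_continuous_onI]) (auto intro: continuous_intros)
  then show ?thesis using f by (simp add: square_integrable_def)
qed

lemma square_integrable_sum:
  "(\<And>i. i \<in> I \<Longrightarrow> square_integrable (f i)) \<Longrightarrow> square_integrable (\<lambda>x. \<Sum>i\<in>I. f i x)"
  by (induction I rule: infinite_finite_induct) (auto intro: square_integrable_add)

lemma integrable_mult_square_integrable:
  assumes f: "square_integrable f" and g: "square_integrable g"
  shows "integrable lborel (\<lambda>x. f x * g x)"
proof (rule Bochner_Integration.integrable_bound)
  show "integrable lborel (\<lambda>x. (cmod (f x))\<^sup>2 + (cmod (g x))\<^sup>2)"
    using assms by (simp add: square_integrable_def)
  have "cmod (f x) * cmod (g x) \<le> (cmod (f x))\<^sup>2 + (cmod (g x))\<^sup>2" for x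
  proof -
    have "2 * (cmod (f x) * cmod (g x)) \<le> (cmod (f x))\<^sup>2 + (cmod (g x))\<^sup>2"
      using sum_squares_bound[of "cmod (f x)" "cmod (g x)"] by simp
    moreover have "0 \<le> cmod (f x) * cmod (g x)" by simp
    ultimately show ?thesis by linarith
  qed
  then show "AE x in lborel. norm (f x * g x) \<le> norm ((cmod (f x))\<^sup>2 + (cmod (g x))\<^sup>2)"
    by (simp add: norm_mult)
qed (use assms in \<open>auto simp: square_integrable_def\<close>)

\<comment> \<open>The relation is reflexive on square integrable functions only, so exactly these
  have a class.\<close>
quotient_type (overloaded) 'a l2 = "'a::euclidean_space \<Rightarrow> complex" / partial:
  "\<lambda>f g. square_integrable f \<and> square_integrable g \<and> (AE x in lborel. f x = g x)"
proof (rule part_equivpI)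
  show "\<exists>f::'a \<Rightarrow> complex. square_integrable f \<and> square_integrable f \<and> (AE x in lborel. f x = f x)"
    by (intro exI[of _ "\<lambda>_. 0"]) simp
  show "symp (\<lambda>f g::'a \<Rightarrow> complex. square_integrable f \<and> square_integrable g \<and> (AE x in lborel. f x = g x))"
    by (auto simp: symp_def elim: eventually_mono)
  show "transp (\<lambda>f g::'a \<Rightarrow> complex. square_integrable f \<and> square_integrable g \<and> (AE x in lborel. f x = g x))"
    unfolding transp_def by (auto elim: AE_mp)
qed

instantiation l2 :: (euclidean_space) real_inner
begin

lift_definition zero_l2 :: "'a l2" is "\<lambda>_. 0" by simp

lift_definition plus_l2 :: "'a l2 \<Rightarrow> 'a l2 \<Rightarrow> 'a l2" is "\<lambda>f g x. f x + g x"
  by (auto intro: square_integrable_add elim!: AE_mp)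

lift_definition minus_l2 :: "'a l2 \<Rightarrow> 'a l2 \<Rightarrow> 'a l2" is "\<lambda>f g x. f x - g x"
  by (auto intro: square_integrable_diff elim!: AE_mp)

lift_definition uminus_l2 :: "'a l2 \<Rightarrow> 'a l2" is "\<lambda>f x. - f x"
  by (auto intro: square_integrable_minus elim!: AE_mp)

lift_definition scaleR_l2 :: "real \<Rightarrow> 'a l2 \<Rightarrow> 'a l2" is "\<lambda>c f x. c *\<^sub>R f x"
  by (auto intro: square_integrable_scaleR elim!: AE_mp)

lift_definition inner_l2 :: "'a l2 \<Rightarrow> 'a l2 \<Rightarrow> real" is "\<lambda>f g. Re (LINT x|lborel. f x * cnj (g x))"
proof -
  fix f f' g g' :: "'a \<Rightarrow> complex"
  assume f: "square_integrable f \<and> square_integrable f' \<and> (AE x in lborel. f x = f' x)"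
    and g: "square_integrable g \<and> square_integrable g' \<and> (AE x in lborel. g x = g' x)"
  have "(LINT x|lborel. f x * cnj (g x)) = (LINT x|lborel. f' x * cnj (g' x))"
  proof (rule integral_cong_AE)
    show "AE x in lborel. f x * cnj (g x) = f' x * cnj (g' x)"
      using f g by (auto elim!: AE_mp)
  qed (use f g square_integrable_cnj[of g] square_integrable_cnj[of g'] in
      \<open>simp_all add: square_integrable_def borel_measurable_times\<close>)
  then show "Re (LINT x|lborel. f x * cnj (g x)) = Re (LINT x|lborel. f' x * cnj (g' x))" by simp
qed

definition norm_l2 :: "'a l2 \<Rightarrow> real" where "norm_l2 u = sqrt (inner u u)"
definition sgn_l2 :: "'a l2 \<Rightarrow> 'a l2" where "sgn_l2 u = scaleR (inverse (norm u)) u"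
definition dist_l2 :: "'a l2 \<Rightarrow> 'a l2 \<Rightarrow> real" where "dist_l2 u v = norm (u - v)"
definition uniformity_l2 :: "('a l2 \<times> 'a l2) filter" where
  "uniformity_l2 = (INF e\<in>{0 <..}. principal {(u, v). dist u v < e})"
definition open_l2 :: "'a l2 set \<Rightarrow> bool" where
  "open_l2 U \<longleftrightarrow> (\<forall>u\<in>U. eventually (\<lambda>(u', v). u' = u \<longrightarrow> v \<in> U) uniformity)"

instance
proof
  fix a b :: real and u v w :: "'a l2" and U :: "'a l2 set"
  show "u + v + w = u + (v + w)" by transfer (auto intro: square_integrable_add simp: algebra_simps)
  show "u + v = v + u" by transfer (auto intro: square_integrable_add simp: algebra_simps)
  show "0 + u = u" by transfer auto
  show "- u + u = 0" by transfer auto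
  show "u - v = u + - v" by transfer (auto intro: square_integrable_diff simp: algebra_simps)
  show "a *\<^sub>R (u + v) = a *\<^sub>R u + a *\<^sub>R v"
    by transfer (auto intro!: square_integrable_add square_integrable_scaleR simp: algebra_simps)
  show "(a + b) *\<^sub>R u = a *\<^sub>R u + b *\<^sub>R u"
    by transfer (auto intro!: square_integrable_add square_integrable_scaleR simp: algebra_simps)
  show "a *\<^sub>R b *\<^sub>R u = (a * b) *\<^sub>R u"
    by transfer (auto intro!: square_integrable_add square_integrable_scaleR simp: algebra_simps)
  show "1 *\<^sub>R u = u" by transfer auto
  show "dist u v = norm (u - v)" by (rule dist_l2_def)
  show "sgn u = inverse (norm u) *\<^sub>R u" by (rule sgn_l2_def)
  show "uniformity = (INF e\<in>{0 <..}. principal {(u, v :: 'a l2). dist u v < e})" by (rule uniformity_l2_def)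
  show "open U \<longleftrightarrow> (\<forall>u\<in>U. eventually (\<lambda>(u', v). u' = u \<longrightarrow> v \<in> U) uniformity)" by (rule open_l2_def)
  show "inner u v = inner v u"
  proof transfer
    fix f g :: "'a \<Rightarrow> complex"
    have "Re (LINT x|lborel. f x * cnj (g x)) = Re (cnj (LINT x|lborel. f x * cnj (g x)))" by simp
    also have "cnj (LINT x|lborel. f x * cnj (g x)) = (LINT x|lborel. cnj (f x * cnj (g x)))"
      by (rule Bochner_Integration.integral_cnj[symmetric])
    finally show "Re (LINT x|lborel. f x * cnj (g x)) = Re (LINT x|lborel. g x * cnj (f x))"
      by (simp add: mult.commute)
  qed
  show "inner (u + v) w = inner u w + inner v w"
  proof transfer
    fix f g h :: "'a \<Rightarrow> complex"
    assume "square_integrable f \<and> square_integrable f \<and> (AE x in lborel. f x = f x)"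
      "square_integrable g \<and> square_integrable g \<and> (AE x in lborel. g x = g x)"
      "square_integrable h \<and> square_integrable h \<and> (AE x in lborel. h x = h x)"
    then have "(LINT x|lborel. f x * cnj (h x) + g x * cnj (h x))
        = (LINT x|lborel. f x * cnj (h x)) + (LINT x|lborel. g x * cnj (h x))"
      by (intro Bochner_Integration.integral_add integrable_mult_square_integrable square_integrable_cnj) auto
    then show "Re (LINT x|lborel. (f x + g x) * cnj (h x))
        = Re (LINT x|lborel. f x * cnj (h x)) + Re (LINT x|lborel. g x * cnj (h x))"
      by (simp add: distrib_right)
  qed
  show "inner (a *\<^sub>R u) v = a * inner u v"
    by transfer simp
  have sq: "Re (LINT x|lborel. f x * cnj (f x)) = (LINT x|lborel. (cmod (f x))\<^sup>2)"
    for f :: "'a \<Rightarrow> complex"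
    by (simp only: complex_norm_square[symmetric] integral_complex_of_real Re_complex_of_real)
  show "0 \<le> inner u u" by transfer (simp only: sq, simp)
  show "inner u u = 0 \<longleftrightarrow> u = 0"
  proof transfer
    fix f :: "'a \<Rightarrow> complex"
    assume "square_integrable f \<and> square_integrable f \<and> (AE x in lborel. f x = f x)"
    then have f: "square_integrable f" by simp
    have "Re (LINT x|lborel. f x * cnj (f x)) = 0 \<longleftrightarrow> (AE x in lborel. (cmod (f x))\<^sup>2 = 0)"
      unfolding sq by (rule integral_nonneg_eq_0_iff_AE[OF square_integrable_integrable[OF f]]) simp
    then show "Re (LINT x|lborel. f x * cnj (f x)) = 0 \<longleftrightarrow>
        square_integrable f \<and> square_integrable (\<lambda>_::'a. 0) \<and> (AE x in lborel. f x = 0)"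
      using f by simp
  qed
  show "norm u = sqrt (inner u u)" by (rule norm_l2_def)
qed

end

section \<open>Representatives and computation with classes\<close>

definition rep :: "'a::euclidean_space l2 \<Rightarrow> 'a \<Rightarrow> complex" where
  "rep u = (SOME f. square_integrable f \<and> abs_l2 f = u)"

lemma rep: "square_integrable (rep u)" "abs_l2 (rep u) = u"
proof -
  have "square_integrable (rep_l2 u) \<and> abs_l2 (rep_l2 u) = u"
    using Quotient_rep_reflp[OF Quotient_l2, of u] Quotient_abs_rep[OF Quotient_l2, of u] by simp
  then show "square_integrable (rep u)" "abs_l2 (rep u) = u"
    unfolding rep_def by (metis (mono_tags, lifting) someI_ex)+
qed

lemma abs_l2_eq_iff:
  "square_integrable f \<Longrightarrow> square_integrable g \<Longrightarrow> abs_l2 f = abs_l2 g \<longleftrightarrow> (AE x in lborel. f x = g x)"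
  using Quotient_rel[OF Quotient_l2, of f g] by simp

lemma rep_abs_l2: "square_integrable f \<Longrightarrow> AE x in lborel. rep (abs_l2 f) x = f x"
  using abs_l2_eq_iff[of "rep (abs_l2 f)" f] rep[of "abs_l2 f"] by simp

lemma abs_l2_add:
  "square_integrable f \<Longrightarrow> square_integrable g \<Longrightarrow> abs_l2 f + abs_l2 g = abs_l2 (\<lambda>x. f x + g x)"
  by (simp add: plus_l2.abs_eq)

lemma abs_l2_diff:
  "square_integrable f \<Longrightarrow> square_integrable g \<Longrightarrow> abs_l2 f - abs_l2 g = abs_l2 (\<lambda>x. f x - g x)"
  by (simp add: minus_l2.abs_eq)

lemma abs_l2_scaleR: "square_integrable f \<Longrightarrow> c *\<^sub>R abs_l2 f = abs_l2 (\<lambda>x. c *\<^sub>R f x)"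
  by (simp add: scaleR_l2.abs_eq)

lemma abs_l2_zero: "abs_l2 (\<lambda>_. 0) = 0"
  by (simp add: zero_l2_def)

lemma abs_l2_sum:
  "(\<And>i. i \<in> I \<Longrightarrow> square_integrable (f i)) \<Longrightarrow> (\<Sum>i\<in>I. abs_l2 (f i)) = abs_l2 (\<lambda>x. \<Sum>i\<in>I. f i x)"
  by (induction I rule: infinite_finite_induct)
     (simp_all add: abs_l2_zero abs_l2_add square_integrable_sum)

lemma inner_abs_l2:
  "square_integrable f \<Longrightarrow> square_integrable g \<Longrightarrow>
    inner (abs_l2 f) (abs_l2 g) = Re (LINT x|lborel. f x * cnj (g x))"
  by (simp add: inner_l2.abs_eq)

lemma norm_abs_l2:
  "square_integrable f \<Longrightarrow> (norm (abs_l2 f))\<^sup>2 = (LINT x|lborel. (cmod (f x))\<^sup>2)"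
  by (simp only: power2_norm_eq_inner inner_abs_l2 complex_norm_square[symmetric] integral_complex_of_real Re_complex_of_real)

lemma norm_abs_l2_nn:
  "square_integrable f \<Longrightarrow> ennreal ((norm (abs_l2 f))\<^sup>2) = (\<integral>\<^sup>+x. ennreal ((cmod (f x))\<^sup>2) \<partial>lborel)"
  by (simp add: norm_abs_l2 nn_integral_eq_integral square_integrable_integrable)

text \<open>Riesz--Fischer. Along a subsequence with steps below \<open>(1/2)^k\<close>, the
  integrals of the squared increments, weighted by \<open>2^k\<close>, still have a finite sum.
  Almost everywhere the increments are then bounded by a multiple of \<open>(1 / sqrt 2)^k\<close>,
  so the subsequence converges pointwise, and Fatou's lemma shows that the pointwise limit is the
  limit in norm.\<close>

instance l2 :: (euclidean_space) complete_space
proof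
  fix X :: "nat \<Rightarrow> 'a l2"
  assume X: "Cauchy X"
  have "\<exists>n. \<forall>i\<ge>n. \<forall>j\<ge>n. norm (X i - X j) < (1/2) ^ k" for k
    using CauchyD[OF X, of "(1/2)^k"] by auto
  then obtain N where N: "\<And>k i j. N k \<le> i \<Longrightarrow> N k \<le> j \<Longrightarrow> norm (X i - X j) < (1/2) ^ k" by metis
  \<comment> \<open>Summing the thresholds gives an index that is at least \<open>N i\<close> for
    every \<open>i\<close> up to \<open>k\<close>.\<close>
  define r where "r k = (\<Sum>i\<le>k. N i)" for k
  have rN: "N k \<le> r j" if "k \<le> j" for k j
    unfolding r_def using that by (intro member_le_sum) auto
  have r_close: "norm (X (r i) - X (r j)) < (1/2)^k" if "k \<le> i" "k \<le> j" for i j k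
    using N rN that by blast
  define f where "f k = rep (X (r k))" for k
  have f: "square_integrable (f k)" and absf: "abs_l2 (f k) = X (r k)" for k
    by (simp_all add: f_def rep)
  have [measurable]: "f k \<in> borel_measurable borel" for k
    using f by (simp add: square_integrable_def)
  have fd: "square_integrable (\<lambda>x. f i x - f j x)" for i j
    by (intro square_integrable_diff f)
  have nn: "(\<integral>\<^sup>+x. ennreal ((cmod (f i x - f j x))\<^sup>2) \<partial>lborel) = ennreal ((norm (X (r i) - X (r j)))\<^sup>2)" for i j
    using norm_abs_l2_nn[OF fd[of i j]] by (simp add: absf[symmetric] abs_l2_diff f)
  have "(\<integral>\<^sup>+x. (\<Sum>k. ennreal (2^k * (cmod (f (Suc k) x - f k x))\<^sup>2)) \<partial>lborel)
      = (\<Sum>k. \<integral>\<^sup>+x. ennreal (2^k * (cmod (f (Suc k) x - f k x))\<^sup>2) \<partial>lborel)"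
    by (rule nn_integral_suminf) simp
  also have "\<dots> = (\<Sum>k. ennreal (2^k * (norm (X (r (Suc k)) - X (r k)))\<^sup>2))"
    by (simp add: ennreal_mult nn_integral_cmult nn)
  also have "\<dots> \<le> (\<Sum>k. ennreal ((1/2)^k))"
  proof (intro suminf_le allI summableI ennreal_leI)
    fix k
    have "(norm (X (r (Suc k)) - X (r k)))\<^sup>2 \<le> ((1/2)^k)\<^sup>2"
      using r_close[of k "Suc k" k] by (intro power_mono) auto
    then show "2^k * (norm (X (r (Suc k)) - X (r k)))\<^sup>2 \<le> (1/2)^k"
      by (simp add: power_divide power2_eq_square field_simps)
  qed
  also have "\<dots> = ennreal 2"
    by (subst suminf_ennreal2) (simp_all add: suminf_geometric)
  also have "\<dots> < \<infinity>" by simp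
  finally have "AE x in lborel. (\<Sum>k. ennreal (2^k * (cmod (f (Suc k) x - f k x))\<^sup>2)) \<noteq> \<infinity>"
    by (intro nn_integral_PInf_AE) (simp_all add: less_top)
  then have AE_conv: "AE x in lborel. convergent (\<lambda>k. f k x)"
  proof eventually_elim
    case (elim x)
    have "summable (\<lambda>k. 2^k * (cmod (f (Suc k) x - f k x))\<^sup>2)"
      using elim by (intro summable_suminf_not_top) (auto simp: top_ennreal_def)
    then have "(\<lambda>k. 2^k * (cmod (f (Suc k) x - f k x))\<^sup>2) \<longlonglongrightarrow> 0" by (rule summable_LIMSEQ_zero)
    then have "Bseq (\<lambda>k. 2^k * (cmod (f (Suc k) x - f k x))\<^sup>2)"
      by (intro convergent_imp_Bseq) (auto simp: convergent_def)
    then obtain K where K: "K > 0" "\<And>k. 2^k * (cmod (f (Suc k) x - f k x))\<^sup>2 \<le> K"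
      by (auto simp: Bseq_def)
    have "norm (f (Suc k) x - f k x) \<le> sqrt K * (1 / sqrt 2)^k" for k
    proof (rule power2_le_imp_le)
      show "(norm (f (Suc k) x - f k x))\<^sup>2 \<le> (sqrt K * (1 / sqrt 2)^k)\<^sup>2"
        using K(2)[of k] K(1)
        by (simp add: power_mult_distrib power_divide field_simps flip: real_sqrt_power)
    qed (use K(1) in auto)
    moreover have "summable (\<lambda>k. sqrt K * (1 / sqrt 2)^k)"
      by (rule summable_mult, rule summable_geometric) simp
    ultimately have "summable (\<lambda>k. f (Suc k) x - f k x)"
      by (rule summable_comparison_test'[rotated])
    then have "convergent (\<lambda>n. \<Sum>k<n. f (Suc k) x - f k x)"
      by (simp add: summable_iff_convergent)
    then obtain l where "(\<lambda>n. f n x - f 0 x) \<longlonglongrightarrow> l"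
      using sum_lessThan_telescope[of "\<lambda>k. f k x"] by (auto simp: convergent_def)
    from tendsto_add[OF this tendsto_const[of "f 0 x"]] show ?case
      by (auto simp: convergent_def)
  qed
  define g where "g x = lim (\<lambda>k. f k x)" for x
  have [measurable]: "g \<in> borel_measurable borel"
    unfolding g_def by measurable
  have lim_g: "AE x in lborel. (\<lambda>k. f k x) \<longlonglongrightarrow> g x"
    using AE_conv by eventually_elim (simp add: g_def convergent_LIMSEQ_iff)
  have fatou: "(\<integral>\<^sup>+x. ennreal ((cmod (g x - f k x))\<^sup>2) \<partial>lborel) \<le> ennreal (((1/2)^k)\<^sup>2)" for k
  proof -
    have "(\<integral>\<^sup>+x. ennreal ((cmod (g x - f k x))\<^sup>2) \<partial>lborel)
        = (\<integral>\<^sup>+x. liminf (\<lambda>i. ennreal ((cmod (f i x - f k x))\<^sup>2)) \<partial>lborel)"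
    proof (rule nn_integral_cong_AE, use lim_g in eventually_elim)
      case (elim x)
      have "(\<lambda>i. ennreal ((cmod (f i x - f k x))\<^sup>2)) \<longlonglongrightarrow> ennreal ((cmod (g x - f k x))\<^sup>2)"
        by (intro tendsto_intros tendsto_ennrealI elim)
      then show ?case by (rule lim_imp_Liminf[OF sequentially_bot, symmetric])
    qed
    also have "\<dots> \<le> liminf (\<lambda>i. \<integral>\<^sup>+x. ennreal ((cmod (f i x - f k x))\<^sup>2) \<partial>lborel)"
      by (rule nn_integral_liminf) simp
    also have "\<dots> \<le> liminf (\<lambda>i. ennreal (((1/2)^k)\<^sup>2))"
    proof (rule Liminf_mono)
      show "\<forall>\<^sub>F i in sequentially. (\<integral>\<^sup>+x. ennreal ((cmod (f i x - f k x))\<^sup>2) \<partial>lborel) \<le> ennreal (((1/2)^k)\<^sup>2)"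
        using eventually_ge_at_top[of k]
      proof eventually_elim
        case (elim i)
        then have "(norm (X (r i) - X (r k)))\<^sup>2 \<le> ((1/2)^k)\<^sup>2"
          using r_close[of k i k] by (intro power_mono) auto
        then show ?case unfolding nn by (rule ennreal_leI)
      qed
    qed
    finally show ?thesis by (simp add: Liminf_const)
  qed
  have gf: "square_integrable (\<lambda>x. g x - f k x)" for k
    unfolding square_integrable_def
  proof (intro conjI integrableI_bounded)
    show "(\<integral>\<^sup>+x. ennreal (norm ((cmod (g x - f k x))\<^sup>2)) \<partial>lborel) < \<infinity>"
      using le_less_trans[OF fatou[of k] ennreal_less_top] by simp
  qed auto
  have g: "square_integrable g"
    using square_integrable_add[OF gf[of 0] f[of 0]] by simp
  have close: "norm (abs_l2 g - X (r k)) \<le> (1/2)^k" for k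
  proof (rule power2_le_imp_le)
    have "abs_l2 g - X (r k) = abs_l2 (\<lambda>x. g x - f k x)"
      by (simp add: absf[symmetric] abs_l2_diff f g)
    then have "ennreal ((norm (abs_l2 g - X (r k)))\<^sup>2) \<le> ennreal (((1/2)^k)\<^sup>2)"
      using norm_abs_l2_nn[OF gf[of k]] fatou[of k] by simp
    then show "(norm (abs_l2 g - X (r k)))\<^sup>2 \<le> ((1/2)^k)\<^sup>2" by (subst (asm) ennreal_le_iff) auto
  qed simp
  have "X \<longlonglongrightarrow> abs_l2 g"
  proof (rule LIMSEQ_I)
    fix e :: real assume "0 < e"
    then obtain k where k: "(1/2)^k < e / 2" using real_arch_pow_inv[of "e/2" "1/2"] by auto
    have "norm (X n - abs_l2 g) < e" if "r k \<le> n" for n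
    proof -
      have "norm (X n - abs_l2 g) \<le> norm (X n - X (r k)) + norm (X (r k) - abs_l2 g)"
        by (rule norm_diff_triangle_le[OF order_refl order_refl]) 
      also have "\<dots> < (1/2)^k + (1/2)^k"
        using N[of k n "r k"] rN[of k k] that close[of k] by (simp add: norm_minus_commute)
      finally show ?thesis using k by simp
    qed
    then show "\<exists>n0. \<forall>n\<ge>n0. norm (X n - abs_l2 g) < e" by blast
  qed
  then show "convergent X" by (auto simp: convergent_def)
qed

section \<open>Convolution and multiplication operators\<close>

lemma borel_measurable_cnj_compose [measurable]:
  "f \<in> borel_measurable M \<Longrightarrow> (\<lambda>x. cnj (f x)) \<in> borel_measurable M"
  by (rule measurable_compose[OF _ borel_measurable_continuous_onI]) (auto intro: continuous_intros)

section \<open>Invariance of Lebesgue measure under translations and reflections\<close>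

lemma distr_lborel_reflect: "distr lborel borel (\<lambda>x. c - x) = (lborel :: 'a::euclidean_space measure)"
  using lborel_affine[of "-1" c] by (simp add: density_1)

lemma distr_lborel_translate: "distr lborel borel (\<lambda>x. x + c) = (lborel :: 'a::euclidean_space measure)"
  using lborel_distr_plus[of c] by (simp add: add.commute[of _ c])

lemma nn_integral_reflect:
  fixes f :: "'a::euclidean_space \<Rightarrow> ennreal"
  assumes [measurable]: "f \<in> borel_measurable borel"
  shows "(\<integral>\<^sup>+x. f (c - x) \<partial>lborel) = (\<integral>\<^sup>+x. f x \<partial>lborel)"
  by (subst (2) distr_lborel_reflect[of c, symmetric]) (simp add: nn_integral_distr)

lemma nn_integral_translate:
  fixes f :: "'a::euclidean_space \<Rightarrow> ennreal"
  assumes [measurable]: "f \<in> borel_measurable borel"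
  shows "(\<integral>\<^sup>+x. f (x + c) \<partial>lborel) = (\<integral>\<^sup>+x. f x \<partial>lborel)"
  by (subst (2) distr_lborel_translate[of c, symmetric]) (simp add: nn_integral_distr)

lemma integral_translate:
  fixes f :: "'a::euclidean_space \<Rightarrow> 'b::{banach, second_countable_topology}"
  assumes [measurable]: "f \<in> borel_measurable borel"
  shows "(LINT x|lborel. f (x + c)) = (LINT x|lborel. f x)"
  by (subst (2) distr_lborel_translate[of c, symmetric]) (simp add: integral_distr)

lemma integrable_translate:
  fixes f :: "'a::euclidean_space \<Rightarrow> 'b::{banach, second_countable_topology}"
  assumes "integrable lborel f"
  shows "integrable lborel (\<lambda>x. f (x + c))"
proof -
  have "integrable (distr lborel borel (\<lambda>x. x + c)) f"
    using assms by (simp add: distr_lborel_translate)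
  then show ?thesis by (rule integrable_distr[rotated]) simp
qed

lemma AE_lborel_reflect:
  fixes c :: "'a::euclidean_space"
  assumes "AE x in lborel. P x"
  shows "AE x in lborel. P (c - x)"
proof -
  obtain N where N: "{x. \<not> P x} \<subseteq> N" "emeasure lborel N = 0" "N \<in> sets lborel"
    using AE_E[OF assms] by auto
  show ?thesis
  proof (rule AE_I)
    show "{x \<in> space lborel. \<not> P (c - x)} \<subseteq> (\<lambda>x. c - x) -` N \<inter> space lborel" using N by auto
    have "emeasure lborel ((\<lambda>x. c - x) -` N \<inter> space lborel) = emeasure (distr lborel borel (\<lambda>x. c - x)) N"
      using N by (subst emeasure_distr) auto
    then show "emeasure lborel ((\<lambda>x. c - x) -` N \<inter> space lborel) = 0"
      using N by (simp add: distr_lborel_reflect)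
    show "(\<lambda>x. c - x) -` N \<inter> space lborel \<in> sets lborel"
      using N by (intro measurable_sets[of _ _ borel]) auto
  qed
qed

text \<open>Tonelli's criterion in iterated form; every interchange of Bochner integrals below goes
  through it.\<close>

lemma integrable_lborel_pairI:
  fixes f :: "'a::euclidean_space \<times> 'b::euclidean_space \<Rightarrow> 'c::{banach, second_countable_topology}"
  assumes [measurable]: "f \<in> borel_measurable (lborel \<Otimes>\<^sub>M lborel)"
    and "(\<integral>\<^sup>+x. \<integral>\<^sup>+y. ennreal (norm (f (x, y))) \<partial>lborel \<partial>lborel) < \<infinity>"
  shows "integrable (lborel \<Otimes>\<^sub>M lborel) f"
proof (rule integrableI_bounded)
  show "(\<integral>\<^sup>+p. ennreal (norm (f p)) \<partial>(lborel \<Otimes>\<^sub>M lborel)) < \<infinity>"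
    using assms(2) by (subst lborel.nn_integral_fst[symmetric]) auto
qed fact

definition conv :: "('a::euclidean_space \<Rightarrow> complex) \<Rightarrow> ('a \<Rightarrow> complex) \<Rightarrow> 'a \<Rightarrow> complex" where
  "conv a u x = (LINT y|lborel. a (x - y) * u y)"

text \<open>The extended-valued majorant exists at every point, so Young's inequality can be proved
  for it before the integral in \<open>conv\<close> is known to converge.\<close>

definition abs_conv :: "('a::euclidean_space \<Rightarrow> complex) \<Rightarrow> ('a \<Rightarrow> complex) \<Rightarrow> 'a \<Rightarrow> ennreal" where
  "abs_conv a u x = (\<integral>\<^sup>+y. ennreal (cmod (a (x - y) * u y)) \<partial>lborel)"

lemma borel_measurable_conv [measurable]:
  assumes [measurable]: "a \<in> borel_measurable borel" "u \<in> borel_measurable borel"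
  shows "conv a u \<in> borel_measurable borel" "abs_conv a u \<in> borel_measurable borel"
  unfolding conv_def abs_conv_def by measurable

context
  fixes a u :: "'a::euclidean_space \<Rightarrow> complex"
  assumes a: "integrable lborel a" and u: "square_integrable u"
begin

private lemma meas [measurable]: "a \<in> borel_measurable borel" "u \<in> borel_measurable borel"
  using a u borel_measurable_integrable[OF a] by (auto simp: square_integrable_def)

text \<open>Young's inequality: the integrand is split into sqrt |a| and sqrt |a| |u|,
  Cauchy--Schwarz is applied in \<open>y\<close>, and the integral over \<open>x\<close> is
  evaluated by Tonelli and translation invariance.\<close>

lemma abs_conv_sq_bound:
  "(\<integral>\<^sup>+x. (abs_conv a u x)\<^sup>2 \<partial>lborel) \<le> ennreal ((LINT x|lborel. cmod (a x))\<^sup>2 * (LINT x|lborel. (cmod (u x))\<^sup>2))"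
proof -
  let ?A = "\<integral>\<^sup>+x. ennreal (cmod (a x)) \<partial>lborel"
  have A: "?A = ennreal (LINT x|lborel. cmod (a x))"
    using a by (intro nn_integral_eq_integral) auto
  have U: "(\<integral>\<^sup>+x. ennreal ((cmod (u x))\<^sup>2) \<partial>lborel) = ennreal (LINT x|lborel. (cmod (u x))\<^sup>2)"
    using u by (intro nn_integral_eq_integral) (auto simp: square_integrable_def)
  have pw: "(abs_conv a u x)\<^sup>2 \<le> ?A * (\<integral>\<^sup>+y. ennreal (cmod (a (x - y)) * (cmod (u y))\<^sup>2) \<partial>lborel)" for x
  proof -
    have "abs_conv a u x = (\<integral>\<^sup>+y. ennreal (sqrt (cmod (a (x - y)))) * ennreal (sqrt (cmod (a (x - y))) * cmod (u y)) \<partial>lborel)"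
      unfolding abs_conv_def
      by (intro nn_integral_cong) (simp add: norm_mult flip: ennreal_mult mult.assoc)
    also have "\<dots>\<^sup>2 \<le> (\<integral>\<^sup>+y. (ennreal (sqrt (cmod (a (x - y)))))\<^sup>2 \<partial>lborel)
        * (\<integral>\<^sup>+y. (ennreal (sqrt (cmod (a (x - y))) * cmod (u y)))\<^sup>2 \<partial>lborel)"
      by (rule Cauchy_Schwarz_nn_integral) measurable
    also have "\<dots> = (\<integral>\<^sup>+y. ennreal (cmod (a (x - y))) \<partial>lborel)
        * (\<integral>\<^sup>+y. ennreal (cmod (a (x - y)) * (cmod (u y))\<^sup>2) \<partial>lborel)"
      by (simp add: ennreal_power power_mult_distrib)
    also have "(\<integral>\<^sup>+y. ennreal (cmod (a (x - y))) \<partial>lborel) = ?A"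
      by (rule nn_integral_reflect[of "\<lambda>y. ennreal (cmod (a y))"]) simp
    finally show ?thesis .
  qed
  have "(\<integral>\<^sup>+x. (abs_conv a u x)\<^sup>2 \<partial>lborel)
      \<le> (\<integral>\<^sup>+x. ?A * (\<integral>\<^sup>+y. ennreal (cmod (a (x - y)) * (cmod (u y))\<^sup>2) \<partial>lborel) \<partial>lborel)"
    by (intro nn_integral_mono pw)
  also have "\<dots> = ?A * (\<integral>\<^sup>+x. \<integral>\<^sup>+y. ennreal (cmod (a (x - y)) * (cmod (u y))\<^sup>2) \<partial>lborel \<partial>lborel)"
    by (rule nn_integral_cmult) measurable
  also have "(\<integral>\<^sup>+x. \<integral>\<^sup>+y. ennreal (cmod (a (x - y)) * (cmod (u y))\<^sup>2) \<partial>lborel \<partial>lborel)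
      = (\<integral>\<^sup>+y. \<integral>\<^sup>+x. ennreal (cmod (a (x - y)) * (cmod (u y))\<^sup>2) \<partial>lborel \<partial>lborel)"
    by (rule lborel_pair.Fubini') measurable
  also have "\<dots> = (\<integral>\<^sup>+y. ?A * ennreal ((cmod (u y))\<^sup>2) \<partial>lborel)"
  proof (rule nn_integral_cong)
    fix y
    have "(\<integral>\<^sup>+x. ennreal (cmod (a (x - y)) * (cmod (u y))\<^sup>2) \<partial>lborel)
        = (\<integral>\<^sup>+x. ennreal (cmod (a (x + - y))) \<partial>lborel) * ennreal ((cmod (u y))\<^sup>2)"
      by (simp add: ennreal_mult nn_integral_multc)
    also have "(\<integral>\<^sup>+x. ennreal (cmod (a (x + - y))) \<partial>lborel) = ?A"
      by (rule nn_integral_translate[of "\<lambda>y. ennreal (cmod (a y))"]) simp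
    finally show "(\<integral>\<^sup>+x. ennreal (cmod (a (x - y)) * (cmod (u y))\<^sup>2) \<partial>lborel) = ?A * ennreal ((cmod (u y))\<^sup>2)" .
  qed
  also have "\<dots> = ?A * (\<integral>\<^sup>+y. ennreal ((cmod (u y))\<^sup>2) \<partial>lborel)"
    by (rule nn_integral_cmult) measurable
  also have "?A * \<dots> = ennreal ((LINT x|lborel. cmod (a x))\<^sup>2 * (LINT x|lborel. (cmod (u x))\<^sup>2))"
    unfolding A U by (simp add: power2_eq_square ennreal_mult mult.assoc)
  finally show ?thesis .
qed

lemma AE_conv_integrable: "AE x in lborel. integrable lborel (\<lambda>y. a (x - y) * u y)"
proof -
  have "(\<integral>\<^sup>+x. (abs_conv a u x)\<^sup>2 \<partial>lborel) \<noteq> \<infinity>"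
    using le_less_trans[OF abs_conv_sq_bound ennreal_less_top] by auto
  then have "AE x in lborel. (abs_conv a u x)\<^sup>2 \<noteq> \<infinity>"
    by (intro nn_integral_PInf_AE) auto
  then show ?thesis
  proof eventually_elim
    case (elim x)
    have "abs_conv a u x < \<infinity>"
      using elim by (auto simp: power2_eq_square ennreal_mult_eq_top_iff less_top)
    then show ?case
      by (intro integrableI_bounded) (auto simp: abs_conv_def)
  qed
qed

text \<open>Where the convolution integral diverges, \<open>conv\<close> has the default value 0 and
  the bound is trivial.\<close>

lemma cmod_conv_le: "ennreal (cmod (conv a u x)) \<le> abs_conv a u x"
proof (cases "integrable lborel (\<lambda>y. a (x - y) * u y)")
  case True
  then show ?thesis unfolding conv_def abs_conv_def by (rule integral_norm_bound_ennreal)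
qed (simp add: conv_def not_integrable_integral_eq)

lemma square_integrable_conv: "square_integrable (conv a u)"
  and integral_conv_sq_le:
    "(LINT x|lborel. (cmod (conv a u x))\<^sup>2) \<le> (LINT x|lborel. cmod (a x))\<^sup>2 * (LINT x|lborel. (cmod (u x))\<^sup>2)"
proof -
  have "(\<integral>\<^sup>+x. ennreal ((cmod (conv a u x))\<^sup>2) \<partial>lborel) \<le> (\<integral>\<^sup>+x. (abs_conv a u x)\<^sup>2 \<partial>lborel)"
  proof (rule nn_integral_mono)
    show "ennreal ((cmod (conv a u x))\<^sup>2) \<le> (abs_conv a u x)\<^sup>2" for x
      using power_mono[OF cmod_conv_le[of x], of 2] by (simp add: ennreal_power)
  qed
  also note abs_conv_sq_bound
  finally have le: "(\<integral>\<^sup>+x. ennreal ((cmod (conv a u x))\<^sup>2) \<partial>lborel)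
      \<le> ennreal ((LINT x|lborel. cmod (a x))\<^sup>2 * (LINT x|lborel. (cmod (u x))\<^sup>2))" .
  show sq: "square_integrable (conv a u)"
    unfolding square_integrable_def
  proof (intro conjI integrableI_bounded)
    show "(\<integral>\<^sup>+x. ennreal (norm ((cmod (conv a u x))\<^sup>2)) \<partial>lborel) < \<infinity>"
      using le_less_trans[OF le ennreal_less_top] by simp
  qed measurable
  have "ennreal (LINT x|lborel. (cmod (conv a u x))\<^sup>2)
      \<le> ennreal ((LINT x|lborel. cmod (a x))\<^sup>2 * (LINT x|lborel. (cmod (u x))\<^sup>2))"
    using le sq by (simp add: nn_integral_eq_integral square_integrable_def)
  then show "(LINT x|lborel. (cmod (conv a u x))\<^sup>2)
      \<le> (LINT x|lborel. cmod (a x))\<^sup>2 * (LINT x|lborel. (cmod (u x))\<^sup>2)"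
    by (subst (asm) ennreal_le_iff) auto
qed

text \<open>Cauchy--Schwarz in the outer variable pairs the majorant \<open>abs_conv\<close>, which
  is controlled by Young's inequality, with \<open>v\<close>.\<close>

lemma integrable_conv_pair:
  assumes v: "square_integrable v"
  shows "integrable (lborel \<Otimes>\<^sub>M lborel) (\<lambda>(x, y). a (x - y) * u y * v x)"
proof (rule integrable_lborel_pairI)
  have [measurable]: "v \<in> borel_measurable borel" using v by (simp add: square_integrable_def)
  show "(\<lambda>(x, y). a (x - y) * u y * v x) \<in> borel_measurable (lborel \<Otimes>\<^sub>M lborel)" by measurable
  have "(\<integral>\<^sup>+x. \<integral>\<^sup>+y. ennreal (norm (case (x, y) of (x, y) \<Rightarrow> a (x - y) * u y * v x)) \<partial>lborel \<partial>lborel)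
      = (\<integral>\<^sup>+x. abs_conv a u x * ennreal (cmod (v x)) \<partial>lborel)" (is "?I = _")
    by (intro nn_integral_cong) (simp add: abs_conv_def norm_mult ennreal_mult nn_integral_multc)
  then have "?I\<^sup>2 = (\<integral>\<^sup>+x. abs_conv a u x * ennreal (cmod (v x)) \<partial>lborel)\<^sup>2" by simp
  also have "\<dots> \<le> (\<integral>\<^sup>+x. (abs_conv a u x)\<^sup>2 \<partial>lborel) * (\<integral>\<^sup>+x. (ennreal (cmod (v x)))\<^sup>2 \<partial>lborel)"
    by (rule Cauchy_Schwarz_nn_integral) measurable
  also have "(\<integral>\<^sup>+x. (ennreal (cmod (v x)))\<^sup>2 \<partial>lborel) = ennreal (LINT x|lborel. (cmod (v x))\<^sup>2)"
    using v by (simp add: ennreal_power nn_integral_eq_integral square_integrable_def)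
  also have "(\<integral>\<^sup>+x. (abs_conv a u x)\<^sup>2 \<partial>lborel) * \<dots> < \<infinity>"
    using le_less_trans[OF abs_conv_sq_bound ennreal_less_top] by (simp add: ennreal_mult_less_top)
  finally show "?I < \<infinity>" by (simp add: power_less_top_ennreal)
qed

lemma integral_conv_mult:
  assumes v: "square_integrable v"
  shows "(LINT x|lborel. conv a u x * v x) = (LINT y|lborel. u y * (LINT x|lborel. a (x - y) * v x))"
proof -
  have "(LINT x|lborel. conv a u x * v x) = (LINT x|lborel. LINT y|lborel. a (x - y) * u y * v x)"
    by (simp add: conv_def)
  also have "\<dots> = (LINT y|lborel. LINT x|lborel. a (x - y) * u y * v x)"
    by (rule lborel_pair.Fubini_integral[symmetric]) (rule integrable_conv_pair[OF v])
  also have "\<dots> = (LINT y|lborel. u y * (LINT x|lborel. a (x - y) * v x))"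
    by (simp add: mult.commute mult.left_commute flip: integral_mult_right_zero)
  finally show ?thesis .
qed

end

section \<open>The convolution and multiplication operators on classes\<close>

definition conv_op :: "('a::euclidean_space \<Rightarrow> complex) \<Rightarrow> 'a l2 \<Rightarrow> 'a l2" where
  "conv_op a u = abs_l2 (conv a (rep u))"

definition mult_op :: "('a::euclidean_space \<Rightarrow> complex) \<Rightarrow> 'a l2 \<Rightarrow> 'a l2" where
  "mult_op w u = abs_l2 (\<lambda>x. w x * rep u x)"

text \<open>The conclusion is equality at every point, since an integral ignores null sets; hence
  \<open>conv_op\<close> does not depend on the chosen representative.\<close>

lemma conv_cong_AE:
  assumes "AE x in lborel. u x = v x"
    and [measurable]: "a \<in> borel_measurable borel" "u \<in> borel_measurable borel" "v \<in> borel_measurable borel"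
  shows "conv a u = conv a v"
proof
  show "conv a u x = conv a v x" for x
    unfolding conv_def using assms(1) by (intro integral_cong_AE) auto
qed

lemma conv_op_abs_l2:
  assumes a: "integrable lborel a" and u: "square_integrable u"
  shows "conv_op a (abs_l2 u) = abs_l2 (conv a u)"
proof -
  have [measurable]: "a \<in> borel_measurable borel" using borel_measurable_integrable[OF a] by simp
  show ?thesis
    unfolding conv_op_def using conv_cong_AE[OF rep_abs_l2[OF u]] u rep(1)[of "abs_l2 u"]
    by (simp add: square_integrable_measurable)
qed

lemma mult_op_abs_l2:
  assumes [measurable]: "w \<in> borel_measurable borel" and w: "\<And>x. cmod (w x) \<le> B"
    and u: "square_integrable u"
  shows "mult_op w (abs_l2 u) = abs_l2 (\<lambda>x. w x * u x)"
  unfolding mult_op_def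
proof (subst abs_l2_eq_iff)
  show "AE x in lborel. w x * rep (abs_l2 u) x = w x * u x"
    using rep_abs_l2[OF u] by eventually_elim simp
qed (use square_integrable_mult_bounded[OF _ assms(1) w] u rep(1) in auto)

lemma l2_cases [cases type: l2]:
  obtains f where "u = abs_l2 f" "square_integrable f"
  using rep[of u] by metis

lemma norm_conv_op_le:
  assumes a: "integrable lborel a"
  shows "norm (conv_op a u) \<le> (LINT x|lborel. cmod (a x)) * norm u"
proof (cases u)
  case (1 f)
  show ?thesis
  proof (rule power2_le_imp_le)
    show "(norm (conv_op a u))\<^sup>2 \<le> ((LINT x|lborel. cmod (a x)) * norm u)\<^sup>2"
      using integral_conv_sq_le[OF a 1(2)]
      by (simp add: 1 conv_op_abs_l2[OF a] norm_abs_l2 square_integrable_conv[OF a] power_mult_distrib)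
  qed simp
qed

lemma norm_mult_op_le:
  assumes w: "w \<in> borel_measurable borel" "\<And>x. cmod (w x) \<le> B"
  shows "norm (mult_op w u) \<le> B * norm u"
proof (cases u)
  case (1 f)
  have B: "0 \<le> B" using w(2)[of 0] norm_ge_zero order_trans by blast
  have wf: "square_integrable (\<lambda>x. w x * f x)"
    by (rule square_integrable_mult_bounded[OF 1(2) w])
  show ?thesis
  proof (rule power2_le_imp_le)
    have "(norm (mult_op w u))\<^sup>2 = (LINT x|lborel. (cmod (w x * f x))\<^sup>2)"
      using norm_abs_l2[OF wf] by (simp add: 1 mult_op_abs_l2[OF w])
    also have "\<dots> \<le> (LINT x|lborel. B\<^sup>2 * (cmod (f x))\<^sup>2)"
    proof (rule integral_mono)
      show "(cmod (w x * f x))\<^sup>2 \<le> B\<^sup>2 * (cmod (f x))\<^sup>2" for x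
        using w(2)[of x] by (auto simp: norm_mult power_mult_distrib intro!: mult_right_mono power_mono)
    qed (use wf 1 in \<open>auto simp: square_integrable_integrable\<close>)
    also have "\<dots> = (B * norm u)\<^sup>2" by (simp add: 1 norm_abs_l2 power_mult_distrib)
    finally show "(norm (mult_op w u))\<^sup>2 \<le> (B * norm u)\<^sup>2" .
  qed (use B in simp)
qed

lemma bounded_linear_conv_op:
  assumes a: "integrable lborel a"
  shows "bounded_linear (conv_op a)"
proof (rule bounded_linear_intro)
  fix u v :: "'a l2" and c :: real
  obtain f where f: "u = abs_l2 f" "square_integrable f" by (cases u)
  obtain g where g: "v = abs_l2 g" "square_integrable g" by (cases v)
  \<comment> \<open>Additivity may fail where an integral diverges and has the default value 0, but
    only on a null set.\<close>
  have "AE x in lborel. conv a (\<lambda>x. f x + g x) x = conv a f x + conv a g x"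
    using AE_conv_integrable[OF a f(2)] AE_conv_integrable[OF a g(2)]
    by eventually_elim (simp add: conv_def distrib_left)
  then show "conv_op a (u + v) = conv_op a u + conv_op a v"
    by (simp add: f g abs_l2_add square_integrable_add square_integrable_conv[OF a] conv_op_abs_l2[OF a]
        abs_l2_eq_iff)
  have "conv a (\<lambda>x. c *\<^sub>R f x) = (\<lambda>x. c *\<^sub>R conv a f x)"
    by (rule ext) (simp add: conv_def)
  then show "conv_op a (c *\<^sub>R u) = c *\<^sub>R conv_op a u"
    by (simp add: f abs_l2_scaleR square_integrable_scaleR square_integrable_conv[OF a] conv_op_abs_l2[OF a])
  show "norm (conv_op a u) \<le> norm u * (LINT x|lborel. cmod (a x))"
    using norm_conv_op_le[OF a] by (simp add: mult.commute)
qed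

lemma bounded_linear_mult_op:
  assumes w: "w \<in> borel_measurable borel" "\<And>x. cmod (w x) \<le> B"
  shows "bounded_linear (mult_op w)"
proof (rule bounded_linear_intro)
  fix u v :: "'a l2" and c :: real
  obtain f where f: "u = abs_l2 f" "square_integrable f" by (cases u)
  obtain g where g: "v = abs_l2 g" "square_integrable g" by (cases v)
  have wf: "square_integrable (\<lambda>x. w x * f x)" "square_integrable (\<lambda>x. w x * g x)"
    by (intro square_integrable_mult_bounded[OF _ w] f g)+
  show "mult_op w (u + v) = mult_op w u + mult_op w v"
    by (simp add: f g abs_l2_add square_integrable_add mult_op_abs_l2[OF w] wf distrib_left)
  show "mult_op w (c *\<^sub>R u) = c *\<^sub>R mult_op w u"
    by (simp add: f abs_l2_scaleR square_integrable_scaleR mult_op_abs_l2[OF w] wf)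
  show "norm (mult_op w u) \<le> norm u * B"
    using norm_mult_op_le[OF w] by (simp add: mult.commute)
qed

lemma conv_op_diff:
  assumes a: "integrable lborel a" and b: "integrable lborel b"
  shows "conv_op (\<lambda>x. a x - b x) u = conv_op a u - conv_op b u"
proof (cases u)
  case (1 f)
  have ab: "integrable lborel (\<lambda>x. a x - b x)" using a b by simp
  have "AE x in lborel. conv (\<lambda>x. a x - b x) f x = conv a f x - conv b f x"
    using AE_conv_integrable[OF a 1(2)] AE_conv_integrable[OF b 1(2)]
    by eventually_elim (simp add: conv_def left_diff_distrib)
  then show ?thesis
    using 1 a b ab
    by (simp add: conv_op_abs_l2 abs_l2_diff square_integrable_conv square_integrable_diff abs_l2_eq_iff)
qed

lemma mult_op_diff:
  assumes v: "v \<in> borel_measurable borel" "\<And>x. cmod (v x) \<le> B"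
    and w: "w \<in> borel_measurable borel" "\<And>x. cmod (w x) \<le> C"
  shows "mult_op (\<lambda>x. v x - w x) u = mult_op v u - mult_op w u"
proof (cases u)
  case (1 f)
  have vw: "(\<lambda>x. v x - w x) \<in> borel_measurable borel" "\<And>x. cmod (v x - w x) \<le> B + C"
    using v w by (auto intro: order_trans[OF norm_triangle_ineq4] add_mono)
  show ?thesis
    using 1 by (simp add: mult_op_abs_l2[OF v] mult_op_abs_l2[OF w] mult_op_abs_l2[OF vw] abs_l2_diff
        square_integrable_mult_bounded[OF _ v] square_integrable_mult_bounded[OF _ w] left_diff_distrib)
qed

lemma inner_conv_op:
  assumes a: "integrable lborel a" and herm: "AE x in lborel. a (- x) = cnj (a x)"
  shows "inner (conv_op a u) v = inner u (conv_op a v)"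
proof -
  obtain f where f: "u = abs_l2 f" "square_integrable f" by (cases u)
  obtain g where g: "v = abs_l2 g" "square_integrable g" by (cases v)
  have [measurable]: "a \<in> borel_measurable borel" "f \<in> borel_measurable borel" "g \<in> borel_measurable borel"
    using borel_measurable_integrable[OF a] f g by (auto simp: square_integrable_def)
  \<comment> \<open>The hermitian symmetry of \<open>a\<close> identifies the transposed kernel with
    the conjugate one, for each fixed \<open>y\<close> at almost every \<open>x\<close>.\<close>
  have "(LINT x|lborel. a (x - y) * cnj (g x)) = cnj (conv a g y)" for y
  proof -
    have "AE x in lborel. a (- (y - x)) = cnj (a (y - x))" by (rule AE_lborel_reflect[OF herm])
    then have "(LINT x|lborel. a (x - y) * cnj (g x)) = (LINT x|lborel. cnj (a (y - x) * g x))"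
      by (intro integral_cong_AE) auto
    then show ?thesis by (simp only: Bochner_Integration.integral_cnj conv_def)
  qed
  then have "(LINT x|lborel. conv a f x * cnj (g x)) = (LINT y|lborel. f y * cnj (conv a g y))"
    by (simp add: integral_conv_mult[OF a f(2) square_integrable_cnj[OF g(2)]])
  then show ?thesis
    using f g a by (simp add: conv_op_abs_l2 inner_abs_l2 square_integrable_conv)
qed

lemma inner_mult_op:
  assumes w: "w \<in> borel_measurable borel" "\<And>x. cmod (w x) \<le> B" and real: "\<And>x. w x \<in> \<real>"
  shows "inner (mult_op w u) v = inner u (mult_op w v)"
proof -
  obtain f where f: "u = abs_l2 f" "square_integrable f" by (cases u)
  obtain g where g: "v = abs_l2 g" "square_integrable g" by (cases v)
  have "cnj (w x) = w x" for x using real by (simp add: Reals_cnj_iff)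
  then show ?thesis
    using f g by (simp add: mult_op_abs_l2[OF w] inner_abs_l2 square_integrable_mult_bounded[OF _ w])
       (simp add: ac_simps)
qed

lemma inner_mult_op_ge:
  assumes w: "w \<in> borel_measurable borel" "\<And>x. cmod (w x) \<le> B" and m: "\<And>x. m \<le> Re (w x)"
  shows "m * (norm u)\<^sup>2 \<le> inner (mult_op w u) u"
proof (cases u)
  case (1 f)
  have wf: "square_integrable (\<lambda>x. w x * f x)"
    by (rule square_integrable_mult_bounded[OF 1(2) w])
  have int: "integrable lborel (\<lambda>x. w x * f x * cnj (f x))"
    by (intro integrable_mult_square_integrable wf square_integrable_cnj 1)
  have Re_eq: "Re (w x * f x * cnj (f x)) = Re (w x) * (cmod (f x))\<^sup>2" for x
    by (simp add: mult.assoc complex_norm_square[symmetric] del: of_real_power)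
  have "m * (norm u)\<^sup>2 = (LINT x|lborel. m * (cmod (f x))\<^sup>2)"
    by (simp add: 1 norm_abs_l2)
  also have "\<dots> \<le> (LINT x|lborel. Re (w x * f x * cnj (f x)))"
  proof (rule integral_mono)
    show "m * (cmod (f x))\<^sup>2 \<le> Re (w x * f x * cnj (f x))" for x
      unfolding Re_eq by (intro mult_right_mono m) simp
    show "integrable lborel (\<lambda>x. Re (w x * f x * cnj (f x)))" by (rule integrable_Re[OF int])
  qed (use 1 in \<open>simp add: square_integrable_integrable\<close>)
  also have "\<dots> = Re (LINT x|lborel. w x * f x * cnj (f x))" by (rule integral_Re[OF int])
  also have "\<dots> = inner (mult_op w u) u"
    by (simp only: 1 mult_op_abs_l2[OF w] inner_abs_l2 wf)
  finally show ?thesis .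
qed

section \<open>Approximation by continuous functions with compact support\<close>

definition C_c :: "('a::euclidean_space \<Rightarrow> complex) \<Rightarrow> bool" where
  "C_c g \<longleftrightarrow> continuous_on UNIV g \<and> (\<exists>R. \<forall>x. R \<le> norm x \<longrightarrow> g x = 0)"

lemma C_c_measurable: "C_c g \<Longrightarrow> g \<in> borel_measurable borel"
  by (auto simp: C_c_def intro: borel_measurable_continuous_onI)

lemma C_c_bounded:
  assumes "C_c g"
  obtains M where "M > 0" "\<And>x. cmod (g x) \<le> M"
proof -
  obtain R where R: "\<And>x. R \<le> norm x \<Longrightarrow> g x = 0" and g: "continuous_on UNIV g"
    using assms by (auto simp: C_c_def)
  have "compact (g ` cball 0 R)"
    by (intro compact_continuous_image continuous_on_subset[OF g]) auto
  then obtain M where M: "M > 0" "\<And>y. y \<in> g ` cball 0 R \<Longrightarrow> norm y \<le> M"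
    using compact_imp_bounded bounded_pos by metis
  show thesis
  proof (rule that[OF M(1)])
    show "cmod (g x) \<le> M" for x
      using M(2)[of "g x"] R[of x] M(1) by (cases "R \<le> norm x") auto
  qed
qed

lemma C_c_uniformly_continuous:
  assumes "C_c g" "e > 0"
  obtains d where "d > 0" "\<And>x y. norm (x - y) < d \<Longrightarrow> cmod (g x - g y) < e"
proof -
  obtain R where R: "\<And>x. R \<le> norm x \<Longrightarrow> g x = 0" and g: "continuous_on UNIV g"
    using assms by (auto simp: C_c_def)
  \<comment> \<open>With the margin 1, two points at distance below 1 either both lie in this ball
    or both lie where \<open>g\<close> vanishes.\<close>
  have "uniformly_continuous_on (cball 0 (R + 1)) g"
    by (intro compact_uniformly_continuous continuous_on_subset[OF g]) auto
  then obtain d where d: "d > 0"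
    "\<And>x y. x \<in> cball 0 (R + 1) \<Longrightarrow> y \<in> cball 0 (R + 1) \<Longrightarrow> dist y x < d \<Longrightarrow> dist (g y) (g x) < e"
    unfolding uniformly_continuous_on_def using assms(2) by metis
  show thesis
  proof (rule that[of "min d 1"])
    fix x y :: 'a assume xy: "norm (x - y) < min d 1"
    show "cmod (g x - g y) < e"
    proof (cases "R \<le> norm x \<and> R \<le> norm y")
      case False
      then have "norm x \<le> R + 1" "norm y \<le> R + 1"
        using xy norm_triangle_ineq2[of x y] norm_triangle_ineq3[of x y] by linarith+
      then show ?thesis using d(2)[of y x] xy by (simp add: dist_norm)
    qed (use R assms(2) in simp)
  qed (use d in simp)
qed

lemma integrable_indicator_cball:
  "integrable lborel (\<lambda>x::'a::euclidean_space. c * indicator (cball z R) x :: real)"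
  by (intro integrable_mult_right integrable_real_indicator emeasure_lborel_cball_finite) simp

lemma C_c_power_integrable:
  assumes "C_c g" "p > 0"
  shows "integrable lborel (\<lambda>x. cmod (g x) ^ p)"
proof -
  obtain R where R: "\<And>x. R \<le> norm x \<Longrightarrow> g x = 0" using assms by (auto simp: C_c_def)
  obtain M where M: "M > 0" "\<And>x. cmod (g x) \<le> M" using C_c_bounded[OF assms(1)] by blast
  show ?thesis
  proof (rule Bochner_Integration.integrable_bound)
    show "integrable lborel (\<lambda>x. M ^ p * indicator (cball 0 R) x)"
      by (rule integrable_indicator_cball)
    have "cmod (g x) ^ p \<le> M ^ p * indicator (cball 0 R) x" for x
      using M R[of x] assms(2) by (auto simp: indicator_def zero_power intro!: power_mono)
    then show "AE x in lborel. norm (cmod (g x) ^ p) \<le> norm (M ^ p * indicator (cball 0 R) x)"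
      by (auto intro: order_trans[OF _ abs_ge_self])
    show "(\<lambda>x. cmod (g x) ^ p) \<in> borel_measurable lborel"
      using C_c_measurable[OF assms(1)] by measurable
  qed
qed

lemma C_c_integrable: "C_c g \<Longrightarrow> integrable lborel g"
  using C_c_power_integrable[of g 1] C_c_measurable[of g]
  by (simp add: integrable_norm_iff)

lemma C_c_square_integrable: "C_c g \<Longrightarrow> square_integrable g"
  using C_c_power_integrable[of g 2] C_c_measurable[of g] by (simp add: square_integrable_def)

text \<open>A measurable function is an almost everywhere limit of continuous ones. Projecting their
  values to the disc of radius \<open>M\<close> and cutting them off between the radii
  \<open>R\<close> and \<open>R + 1\<close> does not change the limit, and it supplies a common
  majorant for dominated convergence.\<close>

lemma C_c_approx_AE:
  fixes f :: "'a::euclidean_space \<Rightarrow> complex"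
  assumes f: "f \<in> borel_measurable borel" and M: "\<And>x. cmod (f x) \<le> M"
    and R: "\<And>x. R < norm x \<Longrightarrow> f x = 0"
  obtains g where "\<And>n. C_c (g n)" "\<And>n x. cmod (g n x) \<le> M" "\<And>n x. R + 1 \<le> norm x \<Longrightarrow> g n x = 0"
    "AE x in lborel. (\<lambda>n. g n x) \<longlonglongrightarrow> f x"
proof -
  have M0: "0 \<le> M" using M[of 0] norm_ge_zero order_trans by blast
  have "f measurable_on UNIV"
    using f by (intro lebesgue_measurable_imp_measurable_on measurable_completion) auto
  then obtain N h where N: "negligible N" and h: "\<And>n::nat. continuous_on UNIV (h n)"
    and lim: "\<And>x. x \<notin> N \<Longrightarrow> (\<lambda>n. h n x) \<longlonglongrightarrow> f x"
    unfolding measurable_on_def by auto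
  define clip :: "complex \<Rightarrow> complex" where "clip = closest_point (cball 0 M)"
  have clip_cont: "continuous_on S clip" for S
    unfolding clip_def using M0 by (intro continuous_on_closest_point) auto
  have clip_le: "cmod (clip z) \<le> M" for z
    using closest_point_in_set[of "cball 0 M" z] M0 by (auto simp: clip_def)
  have clip_id: "clip z = z" if "cmod z \<le> M" for z
    unfolding clip_def using that by (intro closest_point_self) auto
  define cutoff where "cutoff x = max 0 (min 1 (R + 1 - norm x))" for x :: 'a
  define g where "g n x = cutoff x *\<^sub>R clip (h n x)" for n x
  have supp: "g n x = 0" if "R + 1 \<le> norm x" for n x
    using that by (simp add: g_def cutoff_def)
  have bound: "cmod (g n x) \<le> M" for n x
  proof -
    have "\<bar>cutoff x\<bar> * cmod (clip (h n x)) \<le> 1 * M"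
      by (intro mult_mono clip_le) (auto simp: cutoff_def)
    then show ?thesis by (simp add: g_def)
  qed
  have cc: "C_c (g n)" for n
    unfolding C_c_def
  proof
    have "continuous_on UNIV (\<lambda>x. clip (h n x))"
      by (rule continuous_on_compose2[OF clip_cont h]) auto
    then show "continuous_on UNIV (g n)"
      unfolding g_def cutoff_def by (intro continuous_intros)
  qed (use supp in blast)
  have "(\<lambda>n. g n x) \<longlonglongrightarrow> f x" if "x \<notin> N" for x
  proof -
    have "(\<lambda>n. clip (h n x)) \<longlonglongrightarrow> clip (f x)"
      using clip_cont[of UNIV] lim[OF that] by (rule continuous_on_tendsto_compose) auto
    then have "(\<lambda>n. g n x) \<longlonglongrightarrow> cutoff x *\<^sub>R f x"
      unfolding g_def using clip_id[OF M] by (intro tendsto_intros) simp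
    moreover have "cutoff x *\<^sub>R f x = f x"
      using R[of x] by (cases "R < norm x") (auto simp: cutoff_def)
    ultimately show ?thesis by simp
  qed
  moreover have "AE x in lborel. x \<notin> N"
  proof -
    have "AE x in lebesgue. x \<notin> N"
      using N AE_not_in negligible_iff_null_sets by blast
    then show ?thesis by (simp add: AE_completion_iff)
  qed
  ultimately have "AE x in lborel. (\<lambda>n. g n x) \<longlonglongrightarrow> f x" by auto
  with cc bound supp that show thesis by blast
qed

text \<open>A crude substitute for Minkowski's inequality, sufficient for density.\<close>

lemma add_power_le:
  fixes a b :: real
  assumes "0 \<le> a" "0 \<le> b"
  shows "(a + b) ^ p \<le> 2 ^ p * (a ^ p + b ^ p)"
proof -
  have "(a + b) ^ p \<le> (2 * max a b) ^ p" using assms by (intro power_mono) auto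
  also have "\<dots> = 2 ^ p * (max a b) ^ p" by (simp add: power_mult_distrib)
  also have "\<dots> \<le> 2 ^ p * (a ^ p + b ^ p)" using assms by (intro mult_left_mono) (auto simp: max_def)
  finally show ?thesis .
qed

lemma ex_bounded_approx:
  fixes f :: "'a::euclidean_space \<Rightarrow> complex"
  assumes [measurable]: "f \<in> borel_measurable borel" and int: "integrable lborel (\<lambda>x. cmod (f x) ^ p)"
    and p: "p > 0" and e: "e > 0"
  obtains h and k :: nat where "h \<in> borel_measurable borel" "\<And>x. cmod (h x) \<le> k" "\<And>x. k < norm x \<Longrightarrow> h x = 0"
    "integrable lborel (\<lambda>x. cmod (f x - h x) ^ p)" "(LINT x|lborel. cmod (f x - h x) ^ p) < e"
proof -
  define h where "h k x = (if norm x \<le> real k \<and> cmod (f x) \<le> real k then f x else 0)" for k x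
  have [measurable]: "h k \<in> borel_measurable borel" for k unfolding h_def by measurable
  have le: "cmod (f x - h k x) ^ p \<le> cmod (f x) ^ p" for k x
    using p by (auto simp: h_def)
  have int_h: "integrable lborel (\<lambda>x. cmod (f x - h k x) ^ p)" for k
    using le by (intro Bochner_Integration.integrable_bound[OF int]) auto
  have "(\<lambda>k. LINT x|lborel. cmod (f x - h k x) ^ p) \<longlonglongrightarrow> (LINT x|(lborel :: 'a measure). 0)"
  proof (rule integral_dominated_convergence[OF _ _ int])
    show "AE x in lborel. (\<lambda>k. cmod (f x - h k x) ^ p) \<longlonglongrightarrow> 0"
    proof (rule AE_I2)
      fix x
      obtain K :: nat where K: "max (norm x) (cmod (f x)) \<le> K" using real_arch_simple by blast
      have "\<forall>\<^sub>F k in sequentially. cmod (f x - h k x) ^ p = 0"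
        using eventually_ge_at_top[of K]
      proof eventually_elim
        case (elim k)
        then have "norm x \<le> real k" "cmod (f x) \<le> real k" using K by auto
        then show ?case using p by (simp add: h_def)
      qed
      then show "(\<lambda>k. cmod (f x - h k x) ^ p) \<longlonglongrightarrow> 0" by (rule tendsto_eventually)
    qed
  qed (use le in auto)
  then have "\<forall>\<^sub>F k in sequentially. (LINT x|lborel. cmod (f x - h k x) ^ p) < e"
    using e by (intro order_tendstoD(2)[of _ 0]) auto
  then obtain k where "(LINT x|lborel. cmod (f x - h k x) ^ p) < e"
    by (auto simp: eventually_sequentially)
  then show thesis
    using int_h by (intro that[of "h k" k]) (auto simp: h_def[abs_def])
qed

text \<open>The exponent is kept general because the kernel is approximated with
  \<open>p = 1\<close> and the vectors with \<open>p = 2\<close>. Truncation reduces the claim to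
  bounded functions of bounded support, where almost everywhere convergence suffices.\<close>

lemma C_c_dense:
  fixes f :: "'a::euclidean_space \<Rightarrow> complex"
  assumes f [measurable]: "f \<in> borel_measurable borel" and int: "integrable lborel (\<lambda>x. cmod (f x) ^ p)"
    and p: "p > 0" and e: "e > 0"
  obtains g where "C_c g" "(LINT x|lborel. cmod (f x - g x) ^ p) < e"
proof -
  \<comment> \<open>The factor \<open>2 ^ p\<close> is lost in \<open>add_power_le\<close>, and
    there are two error terms.\<close>
  define e' where "e' = e / (2 * 2 ^ p)"
  have e': "e' > 0" using e by (simp add: e'_def)
  obtain h and k :: nat where h [measurable]: "h \<in> borel_measurable borel" and hk: "\<And>x. cmod (h x) \<le> k"
    and hR: "\<And>x. k < norm x \<Longrightarrow> h x = 0" and int_h: "integrable lborel (\<lambda>x. cmod (f x - h x) ^ p)"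
    and close_h: "(LINT x|lborel. cmod (f x - h x) ^ p) < e'"
    by (rule ex_bounded_approx[OF f int p e']) (rule that)
  obtain g where g: "\<And>n. C_c (g n)" "\<And>n x. cmod (g n x) \<le> k" "\<And>n x. real k + 1 \<le> norm x \<Longrightarrow> g n x = 0"
    and lim: "AE x in lborel. (\<lambda>n. g n x) \<longlonglongrightarrow> h x"
    by (rule C_c_approx_AE[OF h hk hR]) (assumption, rule that)
  have [measurable]: "g n \<in> borel_measurable borel" for n using g(1) by (rule C_c_measurable)
  have le: "cmod (h x - g n x) ^ p \<le> (2 * real k) ^ p * indicator (cball 0 (real k + 1)) x" for n x
  proof (cases "real k + 1 \<le> norm x")
    case True
    then show ?thesis using g(3)[OF True] hR[of x] p by (simp add: zero_power)
  next
    case False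
    have "cmod (h x - g n x) \<le> 2 * real k"
      using norm_triangle_ineq4[of "h x" "g n x"] hk[of x] g(2)[of n x] by simp
    then show ?thesis using False power_mono[of _ "2 * real k" p] by (simp add: indicator_def)
  qed
  have bnd: "integrable lborel (\<lambda>x. (2 * real k) ^ p * indicator (cball 0 (real k + 1)) (x::'a))"
    by (rule integrable_indicator_cball)
  have int_g: "integrable lborel (\<lambda>x. cmod (h x - g n x) ^ p)" for n
    using le by (intro Bochner_Integration.integrable_bound[OF bnd]) auto
  have "(\<lambda>n. LINT x|lborel. cmod (h x - g n x) ^ p) \<longlonglongrightarrow> (LINT x|(lborel :: 'a measure). 0)"
  proof (rule integral_dominated_convergence[OF _ _ bnd])
    show "AE x in lborel. (\<lambda>n. cmod (h x - g n x) ^ p) \<longlonglongrightarrow> 0"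
      using lim
    proof eventually_elim
      case (elim x)
      have "(\<lambda>n. cmod (h x - g n x) ^ p) \<longlonglongrightarrow> cmod (h x - h x) ^ p"
        by (intro tendsto_intros elim)
      then show ?case using p by (simp add: zero_power)
    qed
  qed (use le in auto)
  then have "\<forall>\<^sub>F n in sequentially. (LINT x|lborel. cmod (h x - g n x) ^ p) < e'"
    using e' by (intro order_tendstoD(2)[of _ 0]) auto
  then obtain n where close_g: "(LINT x|lborel. cmod (h x - g n x) ^ p) < e'"
    by (auto simp: eventually_sequentially)
  have "(LINT x|lborel. cmod (f x - g n x) ^ p)
      \<le> (LINT x|lborel. 2 ^ p * (cmod (f x - h x) ^ p + cmod (h x - g n x) ^ p))"
  proof (rule integral_mono')
    fix x
    have "cmod (f x - g n x) ^ p \<le> (cmod (f x - h x) + cmod (h x - g n x)) ^ p"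
      by (intro power_mono norm_diff_triangle_le[OF order_refl order_refl]) simp
    also have "\<dots> \<le> 2 ^ p * (cmod (f x - h x) ^ p + cmod (h x - g n x) ^ p)"
      by (rule add_power_le) auto
    finally show "cmod (f x - g n x) ^ p \<le> 2 ^ p * (cmod (f x - h x) ^ p + cmod (h x - g n x) ^ p)" .
  qed (use int_h int_g in auto)
  also have "\<dots> = 2 ^ p * ((LINT x|lborel. cmod (f x - h x) ^ p) + (LINT x|lborel. cmod (h x - g n x) ^ p))"
    using int_h int_g by simp
  also have "\<dots> < 2 ^ p * (e' + e')"
    using close_h close_g by (intro mult_strict_left_mono add_strict_mono) auto
  also have "\<dots> = e" by (simp add: e'_def)
  finally show thesis using g(1) that by blast
qed

section \<open>The Riemann--Lebesgue lemma\<close>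

definition ft :: "('a::euclidean_space \<Rightarrow> complex) \<Rightarrow> 'a \<Rightarrow> complex" where
  "ft u x = (LINT y|lborel. u y * cis (- (x \<bullet> y)))"

lemma borel_measurable_cis [measurable]:
  "f \<in> borel_measurable M \<Longrightarrow> (\<lambda>x. cis (f x)) \<in> borel_measurable M"
  by (rule measurable_compose[OF _ borel_measurable_continuous_onI]) (auto intro: continuous_intros)

lemma integrable_mult_cis:
  assumes "integrable lborel u" and [measurable]: "f \<in> borel_measurable borel"
  shows "integrable lborel (\<lambda>y. u y * cis (f y))"
  using borel_measurable_integrable[OF assms(1)]
  by (intro Bochner_Integration.integrable_bound[OF assms(1)]) (auto simp: norm_mult)

lemma cmod_ft_le: "cmod (ft u x) \<le> (LINT y|lborel. cmod (u y))"
  unfolding ft_def using integral_norm_bound[of lborel "\<lambda>y. u y * cis (- (x \<bullet> y))"]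
  by (simp add: norm_mult)

lemma continuous_on_ft:
  assumes u: "integrable lborel u"
  shows "continuous_on UNIV (ft u)"
  unfolding continuous_on_sequentially
proof (intro ballI allI impI, elim conjE)
  fix f :: "nat \<Rightarrow> 'a" and x assume f: "f \<longlonglongrightarrow> x"
  have [measurable]: "u \<in> borel_measurable borel" using borel_measurable_integrable[OF u] by simp
  have "(\<lambda>n. LINT y|lborel. u y * cis (- (f n \<bullet> y))) \<longlonglongrightarrow> (LINT y|lborel. u y * cis (- (x \<bullet> y)))"
  proof (rule integral_dominated_convergence[where w = "\<lambda>y. cmod (u y)"])
    show "AE y in lborel. (\<lambda>n. u y * cis (- (f n \<bullet> y))) \<longlonglongrightarrow> u y * cis (- (x \<bullet> y))"
      using f by (intro AE_I2 tendsto_intros)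
  qed (use u in \<open>auto simp: norm_mult\<close>)
  then show "(ft u \<circ> f) \<longlonglongrightarrow> ft u x" by (simp add: ft_def o_def)
qed

lemma ft_diff:
  assumes "integrable lborel u" "integrable lborel v"
  shows "ft (\<lambda>x. u x - v x) x = ft u x - ft v x"
  using integrable_mult_cis[OF assms(1), of "\<lambda>y. - (x \<bullet> y)"] integrable_mult_cis[OF assms(2), of "\<lambda>y. - (x \<bullet> y)"]
  by (simp add: ft_def left_diff_distrib)

text \<open>Translating by a vector \<open>h\<close> with \<open>x \<bullet> h = pi\<close> reverses
  the sign of the exponential, so the transform is half that of \<open>u\<close> minus its
  translate. The translation has length \<open>pi / norm x\<close>, hence is short for large
  \<open>x\<close>.\<close>

lemma ft_half_shift:
  assumes u: "integrable lborel u" and x: "x \<noteq> 0"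
  shows "cmod (ft u x) \<le> (LINT y|lborel. cmod (u y - u (y + (pi / (norm x)\<^sup>2) *\<^sub>R x))) / 2"
proof -
  have [measurable]: "u \<in> borel_measurable borel" using borel_measurable_integrable[OF u] by simp
  define h where "h = (pi / (norm x)\<^sup>2) *\<^sub>R x"
  have xh: "x \<bullet> h = pi" using x by (simp add: h_def power2_norm_eq_inner)
  have "ft u x = (LINT y|lborel. u (y + h) * cis (- (x \<bullet> (y + h))))"
    unfolding ft_def by (rule integral_translate[symmetric, of "\<lambda>y. u y * cis (- (x \<bullet> y))"]) measurable
  also have "\<dots> = - (LINT y|lborel. u (y + h) * cis (- (x \<bullet> y)))"
    by (simp add: inner_add_right xh cis_divide[symmetric] flip: integral_minus)
  finally have eq: "ft u x = - ft (\<lambda>y. u (y + h)) x" by (simp add: ft_def)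
  have "2 * cmod (ft u x) = cmod (ft u x + ft u x)" by (simp flip: mult_2 add: norm_mult)
  also have "\<dots> = cmod (ft u x - ft (\<lambda>y. u (y + h)) x)" by (subst (2) eq) simp
  also have "\<dots> = cmod (ft (\<lambda>y. u y - u (y + h)) x)"
    by (subst ft_diff[OF u integrable_translate[OF u]]) simp
  also have "\<dots> \<le> (LINT y|lborel. cmod (u y - u (y + h)))" by (rule cmod_ft_le)
  finally show ?thesis by (simp add: h_def)
qed

text \<open>For a continuous compactly supported approximant, short translations change little in L1
  by uniform continuity. This is the source of the decay of the potential.\<close>

lemma riemann_lebesgue:
  fixes u :: "'a::euclidean_space \<Rightarrow> complex"
  assumes u: "integrable lborel u" and e: "e > 0"
  obtains R where "\<And>x. R \<le> norm x \<Longrightarrow> cmod (ft u x) < e"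
proof -
  have [measurable]: "u \<in> borel_measurable borel" using borel_measurable_integrable[OF u] by simp
  obtain g where g: "C_c g" and close: "(LINT x|lborel. cmod (u x - g x)) < e / 2"
    using C_c_dense[of u 1 "e / 2"] u e by auto
  have int_g: "integrable lborel g" by (rule C_c_integrable[OF g])
  obtain R where R: "\<And>x. R \<le> norm x \<Longrightarrow> g x = 0" using g by (auto simp: C_c_def)
  \<comment> \<open>The denominators below contain \<open>vol + 1\<close>, since
    \<open>R + 1\<close> may be negative and the ball empty.\<close>
  define vol where "vol = measure lborel (cball (0::'a) (R + 1))"
  have vol: "0 \<le> vol" by (simp add: vol_def)
  have "e / 2 / (vol + 1) > 0" using e vol by simp
  then obtain d where d: "d > 0" "\<And>x y. norm (x - y) < d \<Longrightarrow> cmod (g x - g y) < e / 2 / (vol + 1)"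
    using C_c_uniformly_continuous[OF g] by metis
  \<comment> \<open>Beyond this radius the translation is shorter than \<open>d\<close>, for uniform
    continuity, and shorter than 1, so that the difference of \<open>g\<close> and its translate
    vanishes off the ball of radius \<open>R + 1\<close>.\<close>
  define R' where "R' = pi / min d 1 + 1"
  have R': "R' > 0" unfolding R'_def using d(1) by (intro add_nonneg_pos) auto
  have "cmod (ft u x) < e" if x: "R' \<le> norm x" for x
  proof -
    have x0: "x \<noteq> 0" using x R' by auto
    define h where "h = (pi / (norm x)\<^sup>2) *\<^sub>R x"
    have "norm h = pi / norm x" using x0 by (simp add: h_def power2_eq_square)
    also have "\<dots> < min d 1"
    proof -
      have "pi < norm x * min d 1"
        using x d(1) by (simp add: R'_def field_simps split: if_splits)
      then show ?thesis using x0 by (metis mult.commute pos_divide_less_eq zero_less_norm_iff)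
    qed
    finally have h: "norm h < d" "norm h < 1" by auto
    have "cmod (ft g x) \<le> (LINT y|lborel. cmod (g y - g (y + h))) / 2"
      unfolding h_def by (rule ft_half_shift[OF int_g x0])
    also have "(LINT y|lborel. cmod (g y - g (y + h)))
        \<le> (LINT y|lborel. e / 2 / (vol + 1) * indicator (cball 0 (R + 1)) (y::'a))"
    proof (rule integral_mono')
      show "integrable lborel (\<lambda>y. e / 2 / (vol + 1) * indicator (cball 0 (R + 1)) (y::'a))"
        by (rule integrable_indicator_cball)
      fix y
      show "cmod (g y - g (y + h)) \<le> e / 2 / (vol + 1) * indicator (cball 0 (R + 1)) y"
      proof (cases "norm y \<le> R + 1")
        case True
        then show ?thesis using d(2)[of y "y + h"] h by simp
      next
        case False
        moreover have "norm y \<le> norm (y + h) + norm h" using norm_triangle_ineq4[of "y + h" h] by simp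
        ultimately have "R \<le> norm y" "R \<le> norm (y + h)" using h by auto
        then show ?thesis using R e vol by simp
      qed
    qed (use e vol in auto)
    also have "(LINT y|lborel. e / 2 / (vol + 1) * indicator (cball 0 (R + 1)) (y::'a)) = e / 2 / (vol + 1) * vol"
      by (simp add: vol_def)
    also have "\<dots> \<le> e / 2" using e vol by (simp add: field_simps)
    finally have "cmod (ft g x) < e / 2" using e by simp
    moreover have "cmod (ft u x - ft g x) < e / 2"
      using cmod_ft_le[of "\<lambda>y. u y - g y" x] close by (simp add: ft_diff[OF u int_g])
    ultimately show ?thesis using norm_triangle_sub[of "ft u x" "ft g x"] by simp
  qed
  then show thesis by (rule that)
qed

section \<open>Compactness of the product of the two operators\<close>

definition seq_compact_op :: "('a::real_normed_vector \<Rightarrow> 'b::real_normed_vector) \<Rightarrow> bool" where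
  "seq_compact_op T \<longleftrightarrow> (\<forall>u::nat \<Rightarrow> 'a. bounded (range u) \<longrightarrow>
     (\<exists>r. strict_mono r \<and> convergent (\<lambda>k. T (u (r k)))))"

text \<open>A diagonal argument over the accuracies \<open>inverse (real (Suc n))\<close>: at each
  stage a compact approximation of \<open>T\<close> supplies a subsequence along which the images
  oscillate by less than the accuracy. Completeness of the target makes the diagonal images
  converge.\<close>

lemma seq_compact_op_limit:
  fixes T :: "'a::real_normed_vector \<Rightarrow> 'b::{real_normed_vector, complete_space}"
  assumes approx: "\<And>e. e > 0 \<Longrightarrow> \<exists>T'. seq_compact_op T' \<and> (\<forall>u. norm (T u - T' u) \<le> e * norm u)"
  shows "seq_compact_op T"
  unfolding seq_compact_op_def
proof (intro allI impI)
  fix u :: "nat \<Rightarrow> 'a"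
  assume bdd: "bounded (range u)"
  then obtain C where C: "C > 0" "\<And>k. norm (u k) \<le> C" unfolding bounded_pos by auto
  \<comment> \<open>An eventual bound on the oscillation is inherited by subsequences, as the
    diagonal construction demands.\<close>
  define P where "P n s \<longleftrightarrow> (\<exists>N. \<forall>i\<ge>N. \<forall>j\<ge>N. norm (T (u (s i)) - T (u (s j))) < inverse (real (Suc n)))"
    for n and s :: "nat \<Rightarrow> nat"
  interpret subseqs P
  proof
    fix n and s :: "nat \<Rightarrow> nat"
    assume s: "strict_mono s"
    \<comment> \<open>Two thirds of the accuracy pay for replacing \<open>T\<close> by
      \<open>T'\<close> at both points, one third for the oscillation of \<open>T'\<close>; the
      division by \<open>C\<close> compensates the norms of the \<open>u k\<close>.\<close>
    define e where "e = inverse (real (Suc n)) / 3 / C"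
    have e: "e > 0" using C by (simp add: e_def)
    obtain T' where T': "seq_compact_op T'" "\<And>v. norm (T v - T' v) \<le> e * norm v"
      using approx[OF e] by blast
    have "bounded (range (\<lambda>k. u (s k)))"
      using C by (auto simp: bounded_iff)
    then obtain r where r: "strict_mono r" "convergent (\<lambda>k. T' (u (s (r k))))"
      using T'(1) unfolding seq_compact_op_def by blast
    then obtain N where N: "\<And>i j. N \<le> i \<Longrightarrow> N \<le> j \<Longrightarrow>
        norm (T' (u (s (r i))) - T' (u (s (r j)))) < inverse (real (Suc n)) / 3"
      using CauchyD[OF convergent_Cauchy, of _ "inverse (real (Suc n)) / 3"] by fastforce
    have near: "norm (T (u k) - T' (u k)) \<le> inverse (real (Suc n)) / 3" for k
    proof -
      have "norm (T (u k) - T' (u k)) \<le> e * norm (u k)" by (rule T')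
      also have "\<dots> \<le> e * C" using C e by (intro mult_left_mono) auto
      finally show ?thesis using C by (simp add: e_def)
    qed
    have "norm (T (u ((s \<circ> r) i)) - T (u ((s \<circ> r) j))) < inverse (real (Suc n))" if "N \<le> i" "N \<le> j" for i j
    proof -
      let ?x = "u (s (r i))" and ?y = "u (s (r j))"
      have "T ?x - T ?y = (T ?x - T' ?x) + (T' ?x - T' ?y) - (T ?y - T' ?y)" by simp
      also have "norm \<dots> \<le> norm (T ?x - T' ?x) + norm (T' ?x - T' ?y) + norm (T ?y - T' ?y)"
        by (intro order_trans[OF norm_triangle_ineq4] add_right_mono norm_triangle_ineq)
      also have "\<dots> < inverse (real (Suc n))"
        using near[of "s (r i)"] near[of "s (r j)"] N[OF that] by linarith
      finally show ?thesis by simp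
    qed
    then show "\<exists>r'. strict_mono r' \<and> P n (s \<circ> r')"
      using r(1) unfolding P_def by blast
  qed
  have P_sub: "P n (s \<circ> r)" if r: "strict_mono r" and P: "P n s" for r s n
  proof -
    obtain N where N: "\<forall>i\<ge>N. \<forall>j\<ge>N. norm (T (u (s i)) - T (u (s j))) < inverse (real (Suc n))"
      using P by (auto simp: P_def)
    have "N \<le> r i" if "N \<le> i" for i using seq_suble[OF r, of i] that by simp
    then show ?thesis using N unfolding P_def by (intro exI[of _ N]) simp
  qed
  have "Cauchy (\<lambda>k. T (u (diagseq k)))"
  proof (rule CauchyI)
    fix e :: real assume "e > 0"
    then obtain n where n: "inverse (real (Suc n)) < e" using reals_Archimedean by blast
    have "P n (diagseq \<circ> (+) (Suc n))" by (rule diagseq_holds) (rule P_sub)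
    then obtain N where N: "\<And>i j. N \<le> i \<Longrightarrow> N \<le> j \<Longrightarrow>
        norm (T (u (diagseq (Suc n + i))) - T (u (diagseq (Suc n + j)))) < inverse (real (Suc n))"
      by (auto simp: P_def)
    have "norm (T (u (diagseq i)) - T (u (diagseq j))) < e" if "Suc n + N \<le> i" "Suc n + N \<le> j" for i j
    proof -
      have "N \<le> i - Suc n" "N \<le> j - Suc n" "Suc n + (i - Suc n) = i" "Suc n + (j - Suc n) = j"
        using that by auto
      then show ?thesis using N[of "i - Suc n" "j - Suc n"] n by simp
    qed
    then show "\<exists>M. \<forall>i\<ge>M. \<forall>j\<ge>M. norm (T (u (diagseq i)) - T (u (diagseq j))) < e" by blast
  qed
  then show "\<exists>r. strict_mono r \<and> convergent (\<lambda>k. T (u (r k)))"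
    using subseq_diagseq by (auto simp: Cauchy_convergent_iff)
qed

text \<open>On bounded sets L2 functions are integrable; the elementary bound
  \<open>t \<le> 1 + t\<^sup>2\<close> takes the place of Cauchy--Schwarz. The estimate sees
  \<open>f\<close> only through its norm, hence is uniform along bounded sequences.\<close>

lemma integral_bounded_support_le:
  fixes f w :: "'a::euclidean_space \<Rightarrow> complex"
  assumes f: "square_integrable f" and [measurable]: "w \<in> borel_measurable borel" and B: "\<And>x. cmod (w x) \<le> B"
    and R: "\<And>x. R < norm x \<Longrightarrow> w x = 0"
  shows "integrable lborel (\<lambda>x. w x * f x)"
    and "(LINT x|lborel. cmod (w x * f x)) \<le> B * (measure lborel (cball (0::'a) R) + (norm (abs_l2 f))\<^sup>2)"
proof -
  have [measurable]: "f \<in> borel_measurable borel" using f by (simp add: square_integrable_def)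
  have B0: "0 \<le> B" using B[of 0] norm_ge_zero order_trans by blast
  have le: "cmod (w x * f x) \<le> B * (indicator (cball 0 R) x + (cmod (f x))\<^sup>2)" for x
  proof (cases "R < norm x")
    case False
    have "cmod (f x) \<le> 1 + (cmod (f x))\<^sup>2"
    proof -
      have "2 * cmod (f x) \<le> (cmod (f x))\<^sup>2 + 1" using sum_squares_bound[of "cmod (f x)" 1] by simp
      moreover have "0 \<le> cmod (f x)" by simp
      ultimately show ?thesis by linarith
    qed
    then show ?thesis using False B[of x] B0 by (auto simp: norm_mult intro!: mult_mono)
  qed (use R B0 in simp)
  have int: "integrable lborel (\<lambda>x. B * (indicator (cball 0 R) x + (cmod (f x))\<^sup>2))"
    using integrable_indicator_cball[of 1 0 R] f
    by (intro integrable_mult_right Bochner_Integration.integrable_add) (auto simp: square_integrable_def)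
  show wf: "integrable lborel (\<lambda>x. w x * f x)"
    using le by (intro Bochner_Integration.integrable_bound[OF int] AE_I2) (auto intro: order_trans[OF _ abs_ge_self])
  have "(LINT x|lborel. cmod (w x * f x)) \<le> (LINT x|lborel. B * (indicator (cball 0 R) x + (cmod (f x))\<^sup>2))"
    using wf int le by (intro integral_mono) auto
  also have "\<dots> = B * (measure lborel (cball (0::'a) R) + (norm (abs_l2 f))\<^sup>2)"
  proof -
    have "(LINT x|lborel. indicator (cball 0 R) x + (cmod (f x))\<^sup>2)
        = (LINT x|lborel. indicator (cball (0::'a) R) x) + (LINT x|lborel. (cmod (f x))\<^sup>2)"
      using integrable_indicator_cball[of 1 0 R] f
      by (intro Bochner_Integration.integral_add) (auto simp: square_integrable_def)
    then show ?thesis by (simp add: norm_abs_l2[OF f])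
  qed
  finally show "(LINT x|lborel. cmod (w x * f x)) \<le> B * (measure lborel (cball (0::'a) R) + (norm (abs_l2 f))\<^sup>2)" .
qed

text \<open>With such a kernel and such a multiplier, the images of a bounded sequence have a common
  compact support and are uniformly bounded and equicontinuous. Arzela--Ascoli gives a subsequence
  that converges uniformly on \<open>S\<close>, and on a set of finite measure this implies
  convergence in L2.\<close>

lemma seq_compact_op_conv_mult_C_c:
  fixes g w :: "'a::euclidean_space \<Rightarrow> complex"
  assumes g: "C_c g" and w [measurable]: "w \<in> borel_measurable borel" and B: "\<And>x. cmod (w x) \<le> B"
    and R: "\<And>x. R < norm x \<Longrightarrow> w x = 0"
  shows "seq_compact_op (\<lambda>u. conv_op g (mult_op w u))"
  unfolding seq_compact_op_def
proof (intro allI impI)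
  fix u :: "nat \<Rightarrow> 'a l2"
  assume bdd: "bounded (range u)"
  then obtain C where C: "C > 0" "\<And>k. norm (u k) \<le> C" unfolding bounded_pos by auto
  have B0: "0 \<le> B" using B[of 0] norm_ge_zero order_trans by blast
  have int_g: "integrable lborel g" by (rule C_c_integrable[OF g])
  have [measurable]: "g \<in> borel_measurable borel" by (rule C_c_measurable[OF g])
  obtain M where M: "M > 0" "\<And>x. cmod (g x) \<le> M" using C_c_bounded[OF g] by blast
  obtain Rg where Rg: "\<And>x. Rg \<le> norm x \<Longrightarrow> g x = 0" using g by (auto simp: C_c_def)
  define f where "f k = rep (u k)" for k
  have f: "square_integrable (f k)" and absf: "abs_l2 (f k) = u k" for k
    by (simp_all add: f_def rep)
  have [measurable]: "f k \<in> borel_measurable borel" for k using f by (simp add: square_integrable_def)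
  \<comment> \<open>A common bound for the L1 norms of the functions \<open>w * f k\<close>, from
    which both the size and the modulus of continuity of their convolutions are estimated.\<close>
  define D where "D = B * (measure lborel (cball (0::'a) R) + C\<^sup>2)"
  have wf_int: "integrable lborel (\<lambda>y. w y * f k y)" for k
    by (rule integral_bounded_support_le[OF f w B R])
  have D: "(LINT y|lborel. cmod (w y * f k y)) \<le> D" for k
  proof -
    have "(norm (u k))\<^sup>2 \<le> C\<^sup>2" using C by (intro power_mono) auto
    then have "B * (measure lborel (cball (0::'a) R) + (norm (u k))\<^sup>2) \<le> D"
      unfolding D_def using B0 by (intro mult_left_mono) auto
    then show ?thesis using integral_bounded_support_le(2)[where R = R, OF f[of k] w B R] by (simp add: absf)
  qed
  have D0: "0 \<le> D" by (rule order_trans[OF _ D[of 0]]) simp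
  define F where "F k = conv g (\<lambda>y. w y * f k y)" for k
  have wf: "square_integrable (\<lambda>y. w y * f k y)" for k
    by (rule square_integrable_mult_bounded[OF f w B])
  have F_eq: "conv_op g (mult_op w (u k)) = abs_l2 (F k)" for k
    by (simp add: F_def absf[symmetric] mult_op_abs_l2[OF w B f] conv_op_abs_l2[OF int_g wf])
  have sF: "square_integrable (F k)" for k
    unfolding F_def by (rule square_integrable_conv[OF int_g wf])
  have gwf_int: "integrable lborel (\<lambda>y. g (x - y) * (w y * f k y))" for x k
  proof (rule Bochner_Integration.integrable_bound)
    show "integrable lborel (\<lambda>y. M * cmod (w y * f k y))" using wf_int by simp
  qed (use M in \<open>auto simp: norm_mult intro!: mult_right_mono\<close>)
  define S where "S = cball (0::'a) (R + Rg)"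
  have F_supp: "F k x = 0" if "x \<notin> S" for k x
  proof -
    have "g (x - y) * (w y * f k y) = 0" for y
    proof (cases "R < norm y")
      case False
      then have "Rg \<le> norm (x - y)"
        using that norm_triangle_ineq2[of x y] by (simp add: S_def)
      then show ?thesis using Rg by simp
    qed (use R in simp)
    then have "(\<lambda>y. g (x - y) * (w y * f k y)) = (\<lambda>_. 0)" by blast
    then show ?thesis by (simp only: F_def conv_def integral_zero)
  qed
  have F_bound: "cmod (F k x) \<le> M * D" for k x
  proof -
    have "cmod (F k x) \<le> (LINT y|lborel. cmod (g (x - y) * (w y * f k y)))"
      unfolding F_def conv_def by (rule integral_norm_bound)
    also have "\<dots> \<le> (LINT y|lborel. M * cmod (w y * f k y))"
    proof (rule integral_mono)
      show "integrable lborel (\<lambda>y. cmod (g (x - y) * (w y * f k y)))" by (rule integrable_norm[OF gwf_int])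
      show "integrable lborel (\<lambda>y. M * cmod (w y * f k y))"
        by (rule integrable_mult_right[OF integrable_norm[OF wf_int]])
      show "cmod (g (x - y) * (w y * f k y)) \<le> M * cmod (w y * f k y)" for y
        by (subst norm_mult) (intro mult_right_mono M, simp)
    qed
    also have "\<dots> \<le> M * D" using D M by simp
    finally show ?thesis .
  qed
  have F_equi: "\<exists>d>0. \<forall>n y. y \<in> S \<and> norm (x - y) < d \<longrightarrow> cmod (F n x - F n y) < e" if "e > 0" for x e
  proof -
    have "e / (D + 1) > 0" using that D0 by simp
    then obtain d where d: "d > 0" "\<And>x y. norm (x - y) < d \<Longrightarrow> cmod (g x - g y) < e / (D + 1)"
      using C_c_uniformly_continuous[OF g] by metis
    have "cmod (F n x - F n y) < e" if xy: "norm (x - y) < d" for n y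
    proof -
      have le: "cmod (g (x - z) - g (y - z)) \<le> e / (D + 1)" for z
        using d(2)[of "x - z" "y - z"] xy by simp
      have "F n x - F n y = (LINT z|lborel. (g (x - z) - g (y - z)) * (w z * f n z))"
        unfolding F_def conv_def using gwf_int by (simp add: left_diff_distrib)
      also have "cmod \<dots> \<le> (LINT z|lborel. cmod ((g (x - z) - g (y - z)) * (w z * f n z)))"
        by (rule integral_norm_bound)
      also have "\<dots> \<le> (LINT z|lborel. e / (D + 1) * cmod (w z * f n z))"
      proof (rule integral_mono)
        show "integrable lborel (\<lambda>z. cmod ((g (x - z) - g (y - z)) * (w z * f n z)))"
          unfolding left_diff_distrib by (intro integrable_norm Bochner_Integration.integrable_diff gwf_int)
        show "cmod ((g (x - z) - g (y - z)) * (w z * f n z)) \<le> e / (D + 1) * cmod (w z * f n z)" for z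
          using le[of z] by (subst norm_mult) (intro mult_right_mono, auto)
      qed (rule integrable_mult_right[OF integrable_norm[OF wf_int]])
      also have "\<dots> = e / (D + 1) * (LINT z|lborel. cmod (w z * f n z))" by simp
      also have "\<dots> \<le> e / (D + 1) * D" using D D0 \<open>e > 0\<close> by (intro mult_left_mono) auto
      also have "\<dots> < e" using D0 \<open>e > 0\<close> by (simp add: field_simps)
      finally show ?thesis .
    qed
    then show ?thesis using d(1) by blast
  qed
  have compact_S: "compact S" by (simp add: S_def)
  obtain G r where r: "strict_mono (r :: nat \<Rightarrow> nat)"
    and lim: "\<And>e. 0 < e \<Longrightarrow> \<exists>N. \<forall>n x. n \<ge> N \<and> x \<in> S \<longrightarrow> cmod (F (r n) x - G x) < e"
    using Arzela_Ascoli[OF compact_S, of F "M * D"] F_bound F_equi by metis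
  have "Cauchy (\<lambda>k. abs_l2 (F (r k)))"
  proof (rule CauchyI)
    fix e :: real assume e: "e > 0"
    define vol where "vol = measure lborel S"
    have vol: "0 \<le> vol" by (simp add: vol_def)
    \<comment> \<open>A uniform distance of at most \<open>2 * d\<close> on \<open>S\<close> bounds
      the norm by \<open>2 * d * sqrt vol\<close>, which is less than
      \<open>2 * d * (vol + 1) = e\<close>.\<close>
    define d where "d = e / (2 * (vol + 1))"
    have d: "d > 0" using e vol by (simp add: d_def)
    obtain N where N: "\<And>n x. N \<le> n \<Longrightarrow> x \<in> S \<Longrightarrow> cmod (F (r n) x - G x) < d"
      using lim[OF d] by blast
    have "norm (abs_l2 (F (r i)) - abs_l2 (F (r j))) < e" if "N \<le> i" "N \<le> j" for i j
    proof (rule power_less_imp_less_base)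
      have le: "(cmod (F (r i) x - F (r j) x))\<^sup>2 \<le> (2 * d)\<^sup>2 * indicator S x" for x
      proof (cases "x \<in> S")
        case True
        have "cmod (F (r i) x - F (r j) x) \<le> cmod (F (r i) x - G x) + cmod (F (r j) x - G x)"
          by (metis dist_norm dist_triangle2)
        then have "cmod (F (r i) x - F (r j) x) \<le> 2 * d"
          using N[OF that(1) True] N[OF that(2) True] by simp
        then have "(cmod (F (r i) x - F (r j) x))\<^sup>2 \<le> (2 * d)\<^sup>2" by (rule power_mono) simp
        then show ?thesis using True by simp
      qed (simp add: F_supp)
      have sd: "square_integrable (\<lambda>x. F (r i) x - F (r j) x)" by (intro square_integrable_diff sF)
      have "(norm (abs_l2 (F (r i)) - abs_l2 (F (r j))))\<^sup>2 = (LINT x|lborel. (cmod (F (r i) x - F (r j) x))\<^sup>2)"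
        by (simp add: abs_l2_diff sF norm_abs_l2[OF sd])
      also have "\<dots> \<le> (LINT x|lborel. (2 * d)\<^sup>2 * indicator S x)"
        using integrable_indicator_cball[of "(2 * d)\<^sup>2" 0 "R + Rg"] sd le
        by (intro integral_mono) (auto simp: S_def square_integrable_def)
      also have "\<dots> = (2 * d)\<^sup>2 * vol" by (simp add: vol_def)
      also have "\<dots> < (2 * d)\<^sup>2 * (vol + 1)\<^sup>2"
        using d vol by (intro mult_strict_left_mono) (auto simp: power2_eq_square field_simps add_pos_nonneg)
      also have "\<dots> = (2 * d * (vol + 1))\<^sup>2" by (simp add: power_mult_distrib)
      also have "2 * d * (vol + 1) = e" using vol by (simp add: d_def field_simps)
      finally show "(norm (abs_l2 (F (r i)) - abs_l2 (F (r j))))\<^sup>2 < e\<^sup>2" .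
    qed (use e in simp)
    then show "\<exists>N. \<forall>i\<ge>N. \<forall>j\<ge>N. norm (abs_l2 (F (r i)) - abs_l2 (F (r j))) < e" by blast
  qed
  then show "\<exists>r. strict_mono r \<and> convergent (\<lambda>k. conv_op g (mult_op w (u (r k))))"
    using r unfolding F_eq by (auto simp: Cauchy_convergent_iff)
qed

text \<open>Compactness survives limits in operator norm, so the kernel may be approximated in L1,
  with the error controlled by Young's inequality, and the multiplier uniformly, by truncation to a
  ball. The latter is where decay at infinity enters.\<close>

proposition seq_compact_op_conv_mult:
  fixes a w :: "'a::euclidean_space \<Rightarrow> complex"
  assumes a: "integrable lborel a" and w [measurable]: "w \<in> borel_measurable borel" and B: "\<And>x. cmod (w x) \<le> B"
    and vanish: "\<And>e. e > 0 \<Longrightarrow> \<exists>R. \<forall>x. R \<le> norm x \<longrightarrow> cmod (w x) < e"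
  shows "seq_compact_op (\<lambda>u. conv_op a (mult_op w u))"
proof (rule seq_compact_op_limit)
  fix e :: real assume e: "e > 0"
  have B0: "0 \<le> B" using B[of 0] norm_ge_zero order_trans by blast
  have [measurable]: "a \<in> borel_measurable borel" using borel_measurable_integrable[OF a] by simp
  \<comment> \<open>Here \<open>B + 1\<close>, and below \<open>G + 1\<close>, avoid a division by
    zero.\<close>
  have e1: "e / (2 * (B + 1)) > 0" using e B0 by simp
  obtain g where g: "C_c g" and ag: "(LINT x|lborel. cmod (a x - g x)) < e / (2 * (B + 1))"
    using C_c_dense[of a 1, OF _ _ _ e1] a by auto
  have int_g: "integrable lborel g" by (rule C_c_integrable[OF g])
  define G where "G = (LINT x|lborel. cmod (g x))"
  have G0: "0 \<le> G" by (simp add: G_def)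
  have e2: "e / (2 * (G + 1)) > 0" using e G0 by simp
  obtain R where R: "\<And>x. R \<le> norm x \<Longrightarrow> cmod (w x) < e / (2 * (G + 1))" using vanish[OF e2] by blast
  define v where "v x = (if norm x \<le> R then w x else 0)" for x
  have v [measurable]: "v \<in> borel_measurable borel" unfolding v_def by measurable
  have vB: "cmod (v x) \<le> B" for x using B B0 by (simp add: v_def)
  have wv: "(\<lambda>x. w x - v x) \<in> borel_measurable borel" "\<And>x. cmod (w x - v x) \<le> e / (2 * (G + 1))"
    using R e2 by (auto simp: v_def less_imp_le)
  have "seq_compact_op (\<lambda>u. conv_op g (mult_op v u))"
    by (rule seq_compact_op_conv_mult_C_c[OF g v vB, of R]) (simp add: v_def)
  moreover have "norm (conv_op a (mult_op w u) - conv_op g (mult_op v u)) \<le> e * norm u" for u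
  proof -
    interpret g: bounded_linear "conv_op g" by (rule bounded_linear_conv_op[OF int_g])
    have ag_int: "integrable lborel (\<lambda>x. a x - g x)" using a int_g by simp
    have "conv_op a (mult_op w u) - conv_op g (mult_op v u)
        = conv_op (\<lambda>x. a x - g x) (mult_op w u) + conv_op g (mult_op (\<lambda>x. w x - v x) u)"
      by (simp add: conv_op_diff[OF a int_g] mult_op_diff[OF w B v vB] g.diff)
    also have "norm \<dots> \<le> norm (conv_op (\<lambda>x. a x - g x) (mult_op w u)) + norm (conv_op g (mult_op (\<lambda>x. w x - v x) u))"
      by (rule norm_triangle_ineq)
    also have "norm (conv_op (\<lambda>x. a x - g x) (mult_op w u)) \<le> e / (2 * (B + 1)) * (B * norm u)"
    proof -
      have "norm (conv_op (\<lambda>x. a x - g x) (mult_op w u)) \<le> (LINT x|lborel. cmod (a x - g x)) * norm (mult_op w u)"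
        by (rule norm_conv_op_le[OF ag_int])
      also have "\<dots> \<le> e / (2 * (B + 1)) * (B * norm u)"
        by (intro mult_mono less_imp_le[OF ag] norm_mult_op_le[OF w B] less_imp_le[OF e1]) simp
      finally show ?thesis .
    qed
    also have "norm (conv_op g (mult_op (\<lambda>x. w x - v x) u)) \<le> G * (e / (2 * (G + 1)) * norm u)"
      unfolding G_def[symmetric]
      by (rule order_trans[OF norm_conv_op_le[OF int_g]], fold G_def)
         (intro mult_left_mono norm_mult_op_le[OF wv] G0)
    also have "e / (2 * (B + 1)) * (B * norm u) \<le> e / 2 * norm u"
      using e B0 by (simp add: field_simps mult_right_mono)
    also have "G * (e / (2 * (G + 1)) * norm u) \<le> e / 2 * norm u"
      using e G0 by (simp add: field_simps mult_right_mono)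
    finally show ?thesis by simp
  qed
  ultimately show "\<exists>T'. seq_compact_op T' \<and> (\<forall>u. norm (conv_op a (mult_op w u) - T' u) \<le> e * norm u)"
    by blast
qed

section \<open>Gaussian regularization of the quadratic form\<close>

lemma
  fixes f :: "'a::euclidean_space \<Rightarrow> real \<Rightarrow> 'b::{real_normed_field, banach, second_countable_topology}"
  assumes f: "\<And>b. b \<in> Basis \<Longrightarrow> integrable lborel (f b)"
  shows integrable_lborel_prod: "integrable lborel (\<lambda>x::'a. \<Prod>b\<in>Basis. f b (x \<bullet> b))"
    and integral_lborel_prod: "(LINT x|lborel. (\<Prod>b\<in>Basis. f b (x \<bullet> b))) = (\<Prod>b\<in>Basis. LINT t|lborel. f b t)"
proof -
  interpret product_sigma_finite "\<lambda>_::'a. lborel :: real measure" ..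
  have [measurable]: "f b \<in> borel_measurable borel" if "b \<in> Basis" for b
    using borel_measurable_integrable[OF f[OF that]] by simp
  have [measurable]: "(\<lambda>x::'a. \<Prod>b\<in>Basis. f b (x \<bullet> b)) \<in> borel_measurable borel"
    by measurable
  have int: "integrable (\<Pi>\<^sub>M b\<in>(Basis::'a set). lborel) (\<lambda>x. \<Prod>b\<in>Basis. f b (x b))"
    by (rule product_integrable_prod) (auto intro: f)
  have eq: "(\<Prod>b\<in>Basis. f b ((\<Sum>c\<in>Basis. x c *\<^sub>R c) \<bullet> b)) = (\<Prod>b\<in>Basis. f b (x b))" for x
    by (intro prod.cong) (auto simp: inner_sum_left_Basis)
  show "integrable lborel (\<lambda>x::'a. \<Prod>b\<in>Basis. f b (x \<bullet> b))"
    by (subst lborel_eq, subst integrable_distr_eq) (auto simp: eq int)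
  show "(LINT x|lborel. (\<Prod>b\<in>Basis. f b (x \<bullet> b))) = (\<Prod>b\<in>Basis. LINT t|lborel. f b t)"
    by (subst lborel_eq, subst integral_distr) (auto simp: eq product_integral_prod f)
qed

lemma integral_lborel_affine:
  fixes f :: "'a::euclidean_space \<Rightarrow> 'b::{banach, second_countable_topology}"
  assumes [measurable]: "f \<in> borel_measurable borel" and c: "c \<noteq> 0"
  shows "(LINT x|lborel. f (t + c *\<^sub>R x)) = (1 / \<bar>c\<bar> ^ DIM('a)) *\<^sub>R (LINT x|lborel. f x)"
proof -
  have "(LINT x|lborel. f x) = (LINT x|density (distr lborel borel (\<lambda>x. t + c *\<^sub>R x)) (\<lambda>_. \<bar>c\<bar> ^ DIM('a)). f x)"
    by (subst lborel_affine[OF c, of t]) (rule refl)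
  also have "\<dots> = (LINT x|distr lborel borel (\<lambda>x. t + c *\<^sub>R x). \<bar>c\<bar> ^ DIM('a) *\<^sub>R f x)"
    by (subst integral_density) auto
  also have "\<dots> = \<bar>c\<bar> ^ DIM('a) *\<^sub>R (LINT x|lborel. f (t + c *\<^sub>R x))"
    by (subst integral_distr) auto
  finally show ?thesis using c by simp
qed

lemma norm_sq_eq_sum: "(norm (x::'a::euclidean_space))\<^sup>2 = (\<Sum>b\<in>Basis. (x \<bullet> b)\<^sup>2)"
  unfolding power2_norm_eq_inner by (subst euclidean_inner) (simp add: power2_eq_square)

definition gauss :: "'a::euclidean_space \<Rightarrow> real" where
  "gauss x = (\<Prod>b\<in>Basis. std_normal_density (x \<bullet> b))"

definition gauss_const :: "'a::euclidean_space itself \<Rightarrow> real" where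
  "gauss_const _ = (1 / sqrt (2 * pi)) ^ DIM('a)"

lemma gauss_const_pos: "gauss_const TYPE('a::euclidean_space) > 0"
  by (simp add: gauss_const_def)

lemma gauss_eq: "gauss (x::'a::euclidean_space) = gauss_const TYPE('a) * exp (- (norm x)\<^sup>2 / 2)"
proof -
  have "(\<Sum>b\<in>Basis. - (x \<bullet> b)\<^sup>2 / 2) = - (norm x)\<^sup>2 / 2"
    by (subst norm_sq_eq_sum) (simp add: sum_negf sum_divide_distrib)
  then have "(\<Prod>b\<in>Basis. exp (- (x \<bullet> b)\<^sup>2 / 2)) = exp (- (norm x)\<^sup>2 / 2)"
    by (simp only: exp_sum[symmetric] finite_Basis)
  then show ?thesis
    by (simp only: gauss_def std_normal_density_def gauss_const_def prod.distrib prod_constant)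
qed

lemma gauss_pos: "gauss x > 0"
  by (simp add: gauss_eq gauss_const_pos)

lemma borel_measurable_gauss [measurable]: "gauss \<in> borel_measurable borel"
  unfolding gauss_eq[abs_def] by measurable

lemma integrable_gauss: "integrable lborel (gauss :: 'a::euclidean_space \<Rightarrow> real)"
  unfolding gauss_def[abs_def] by (rule integrable_lborel_prod) simp

lemma integral_gauss: "(LINT x|lborel. gauss (x::'a::euclidean_space)) = 1"
  unfolding gauss_def by (subst integral_lborel_prod) simp_all

text \<open>In each coordinate this is the characteristic function of the standard normal
  distribution.\<close>

lemma ft_gauss:
  fixes x :: "'a::euclidean_space"
  shows "(LINT y|lborel. complex_of_real (gauss y) * cis (x \<bullet> y)) = exp (- (norm x)\<^sup>2 / 2)"
proof -
  have 1: "(LINT s|lborel. complex_of_real (std_normal_density s) * cis (t * s)) = exp (- t\<^sup>2 / 2)" for t :: real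
  proof -
    have "complex_of_real (exp (- t\<^sup>2 / 2)) = char std_normal_distribution t"
      by (simp add: char_std_normal_distribution)
    also have "\<dots> = (LINT s|lborel. complex_of_real (std_normal_density s) * cis (t * s))"
      unfolding char_def by (subst integral_density) (auto simp: scaleR_conv_of_real cis_conv_exp)
    finally show ?thesis by simp
  qed
  have int: "integrable lborel (\<lambda>s. complex_of_real (std_normal_density s) * cis (t * s))" for t
    by (rule Bochner_Integration.integrable_bound[of _ "\<lambda>s. std_normal_density s"]) (auto simp: norm_mult)
  have "complex_of_real (gauss y) * cis (x \<bullet> y)
      = (\<Prod>b\<in>Basis. complex_of_real (std_normal_density (y \<bullet> b)) * cis ((x \<bullet> b) * (y \<bullet> b)))" for y
    unfolding prod.distrib gauss_def of_real_prod
    by (simp add: euclidean_inner[of x y] cis_conv_exp sum_distrib_left exp_sum)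
  then have "(LINT y|lborel. complex_of_real (gauss y) * cis (x \<bullet> y))
      = (\<Prod>b\<in>Basis. LINT s|lborel. complex_of_real (std_normal_density s) * cis ((x \<bullet> b) * s))"
    by (simp add: integral_lborel_prod[OF int])
  also have "\<dots> = complex_of_real (\<Prod>b\<in>Basis. exp (- (x \<bullet> b)\<^sup>2 / 2))"
    by (simp only: 1 of_real_prod)
  also have "(\<Prod>b\<in>Basis. exp (- (x \<bullet> b)\<^sup>2 / 2)) = exp (- (norm x)\<^sup>2 / 2)"
    by (subst norm_sq_eq_sum) (simp add: sum_negf sum_divide_distrib flip: exp_sum)
  finally show ?thesis .
qed

lemma integrable_gauss_scaled: "s > 0 \<Longrightarrow> integrable lborel (\<lambda>x::'a::euclidean_space. gauss (x /\<^sub>R s))"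
proof -
  assume s: "s > 0"
  have "(\<integral>\<^sup>+x. ennreal (gauss (x::'a)) \<partial>lborel) = (\<integral>\<^sup>+x. ennreal (gauss (x::'a)) \<partial>density (distr lborel borel (\<lambda>x. 0 + (1/s) *\<^sub>R x)) (\<lambda>_. \<bar>1/s\<bar> ^ DIM('a)))"
    by (rule arg_cong[where f = "\<lambda>M. \<integral>\<^sup>+x. ennreal (gauss (x::'a)) \<partial>M", OF lborel_affine[of "1/s" 0]])
      (use s in simp)
  also have "\<dots> = ennreal (\<bar>1/s\<bar> ^ DIM('a)) * (\<integral>\<^sup>+x. ennreal (gauss ((1/s) *\<^sub>R x)) \<partial>(lborel :: 'a measure))"
    by (simp add: nn_integral_density nn_integral_distr nn_integral_cmult)
  finally have eq: "(\<integral>\<^sup>+x. ennreal (gauss (x::'a)) \<partial>lborel)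
      = ennreal (\<bar>1/s\<bar> ^ DIM('a)) * (\<integral>\<^sup>+x. ennreal (gauss ((1/s) *\<^sub>R x)) \<partial>(lborel :: 'a measure))" .
  have "(\<integral>\<^sup>+x. ennreal (gauss (x::'a)) \<partial>lborel) < \<infinity>"
    using integrable_gauss[where 'a = 'a] by (simp add: nn_integral_eq_integral gauss_pos less_imp_le)
  then have "(\<integral>\<^sup>+x. ennreal (gauss ((1/s) *\<^sub>R x)) \<partial>(lborel :: 'a measure)) < \<infinity>"
    unfolding eq using s by (auto simp: ennreal_mult_less_top)
  then show ?thesis
    by (intro integrableI_bounded) (auto simp: gauss_pos less_imp_le divide_inverse_commute)
qed

text \<open>Fourier inversion with a Gaussian weight. Integrating over \<xi> first turns the weight
  of width \<open>s\<close> into a mollifier of width \<open>1 / s\<close>; the factor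
  \<open>gauss_const\<close> makes the unnormalized exponential of \<open>ft_gauss\<close> a
  probability density again.\<close>

lemma gauss_inversion:
  fixes g :: "'a::euclidean_space \<Rightarrow> complex"
  assumes g: "integrable lborel g" and s: "s > 0"
  shows "gauss_const TYPE('a) * (LINT \<xi>|lborel. gauss (\<xi> /\<^sub>R s) * (cis (- (\<xi> \<bullet> z)) * ft g (- \<xi>)))
    = (LINT w|lborel. gauss w * g (z + w /\<^sub>R s))"
proof -
  let ?c = "complex_of_real (gauss_const TYPE('a))"
  have [measurable]: "g \<in> borel_measurable borel" using borel_measurable_integrable[OF g] by simp
  have pair: "integrable (lborel \<Otimes>\<^sub>M lborel) (\<lambda>(\<xi>, v). complex_of_real (gauss (\<xi> /\<^sub>R s)) * g v * cis (\<xi> \<bullet> (v - z)))"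
  proof (rule integrable_lborel_pairI)
    have "(\<integral>\<^sup>+\<xi>. \<integral>\<^sup>+v. ennreal (norm (case (\<xi>, v) of (\<xi>, v) \<Rightarrow>
        complex_of_real (gauss (\<xi> /\<^sub>R s)) * g v * cis (\<xi> \<bullet> (v - z)))) \<partial>lborel \<partial>lborel)
      = (\<integral>\<^sup>+\<xi>. ennreal (gauss (\<xi> /\<^sub>R s)) * (\<integral>\<^sup>+v. ennreal (cmod (g v)) \<partial>lborel) \<partial>(lborel::'a measure))"
      by (intro nn_integral_cong) (simp add: norm_mult ennreal_mult nn_integral_cmult gauss_pos less_imp_le)
    also have "\<dots> = (\<integral>\<^sup>+\<xi>. ennreal (gauss (\<xi> /\<^sub>R s)) \<partial>(lborel::'a measure)) * (\<integral>\<^sup>+v. ennreal (cmod (g v)) \<partial>lborel)"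
      by (rule nn_integral_multc) measurable
    also have "\<dots> < \<infinity>"
      using integrable_gauss_scaled[OF s, where 'a = 'a] g
      by (simp add: nn_integral_eq_integral gauss_pos less_imp_le ennreal_mult_less_top)
    finally show "(\<integral>\<^sup>+\<xi>. \<integral>\<^sup>+v. ennreal (norm (case (\<xi>, v) of (\<xi>, v) \<Rightarrow>
        complex_of_real (gauss (\<xi> /\<^sub>R s)) * g v * cis (\<xi> \<bullet> (v - z)))) \<partial>lborel \<partial>lborel) < \<infinity>" .
  qed measurable
  have inner_eq: "(LINT \<xi>|lborel. complex_of_real (gauss (\<xi> /\<^sub>R s)) * g v * cis (\<xi> \<bullet> (v - z)))
      = g v * (s ^ DIM('a) * exp (- (norm (s *\<^sub>R (v - z)))\<^sup>2 / 2))" for v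
  proof -
    have scaled: "(s *\<^sub>R (v - z)) \<bullet> (\<xi> /\<^sub>R s) = \<xi> \<bullet> (v - z)" for \<xi>
      using s by (simp add: inner_commute flip: mult.assoc)
    have "(LINT \<xi>|lborel. complex_of_real (gauss (\<xi> /\<^sub>R s)) * cis ((s *\<^sub>R (v - z)) \<bullet> (\<xi> /\<^sub>R s)))
        = (s ^ DIM('a)) *\<^sub>R (LINT \<xi>|lborel. complex_of_real (gauss \<xi>) * cis ((s *\<^sub>R (v - z)) \<bullet> \<xi>))"
      using integral_lborel_affine[of "\<lambda>\<xi>. complex_of_real (gauss \<xi>) * cis ((s *\<^sub>R (v - z)) \<bullet> \<xi>)" "inverse s" 0] s
      by (simp add: power_inverse divide_inverse)
    also have "\<dots> = s ^ DIM('a) * exp (- (norm (s *\<^sub>R (v - z)))\<^sup>2 / 2)"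
      by (simp only: ft_gauss scaleR_conv_of_real of_real_power of_real_mult)
    finally show ?thesis
      by (simp only: scaled mult.assoc mult.left_commute[of _ "g v"] integral_mult_right_zero)
  qed
  have "gauss (\<xi> /\<^sub>R s) * (cis (- (\<xi> \<bullet> z)) * ft g (- \<xi>))
      = (LINT v|lborel. complex_of_real (gauss (\<xi> /\<^sub>R s)) * g v * cis (\<xi> \<bullet> (v - z)))" for \<xi>
  proof -
    have eq: "complex_of_real (gauss (\<xi> /\<^sub>R s)) * g v * cis (\<xi> \<bullet> (v - z))
        = (gauss (\<xi> /\<^sub>R s) * cis (- (\<xi> \<bullet> z))) * (g v * cis (\<xi> \<bullet> v))" for v
      by (simp add: inner_diff_right cis_mult[of "\<xi> \<bullet> v" "- (\<xi> \<bullet> z)", simplified, symmetric])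
    then show ?thesis
      by (simp only: ft_def eq integral_mult_right_zero inner_minus_left minus_minus mult.assoc)
  qed
  then have "?c * (LINT \<xi>|lborel. gauss (\<xi> /\<^sub>R s) * (cis (- (\<xi> \<bullet> z)) * ft g (- \<xi>)))
      = ?c * (LINT \<xi>|lborel. LINT v|lborel. complex_of_real (gauss (\<xi> /\<^sub>R s)) * g v * cis (\<xi> \<bullet> (v - z)))"
    by simp
  also have "(LINT \<xi>|lborel. LINT v|lborel. complex_of_real (gauss (\<xi> /\<^sub>R s)) * g v * cis (\<xi> \<bullet> (v - z)))
      = (LINT v|lborel. LINT \<xi>|lborel. complex_of_real (gauss (\<xi> /\<^sub>R s)) * g v * cis (\<xi> \<bullet> (v - z)))"
    by (rule lborel_pair.Fubini_integral[symmetric]) (rule pair)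
  also have "?c * \<dots> = (LINT v|lborel. s ^ DIM('a) *\<^sub>R (gauss (s *\<^sub>R (v - z)) * g v))"
    unfolding inner_eq integral_mult_right_zero[symmetric]
    by (intro Bochner_Integration.integral_cong refl)
       (simp add: gauss_eq scaleR_conv_of_real mult_ac del: norm_scaleR)
  also have "\<dots> = s ^ DIM('a) *\<^sub>R (LINT v|lborel. gauss (s *\<^sub>R (v - z)) * g v)"
    by (rule integral_scaleR_right)
  also have "\<dots> = (LINT w|lborel. gauss w * g (z + w /\<^sub>R s))"
    using integral_lborel_affine[of "\<lambda>v. complex_of_real (gauss (s *\<^sub>R (v - z))) * g v" "inverse s" z] s
    by (simp add: power_inverse divide_inverse)
  finally show ?thesis .
qed

section \<open>Autocorrelation and a regularized Plancherel formula\<close>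

definition autocorr :: "('a::euclidean_space \<Rightarrow> complex) \<Rightarrow> 'a \<Rightarrow> complex" where
  "autocorr f z = (LINT y|lborel. f y * cnj (f (y + z)))"

text \<open>The substitution \<open>x = z + y\<close> makes the form depend on \<open>f\<close> only
  through its autocorrelation. Both conditions of the theorem act through this: the transform of the
  autocorrelation is nonnegative, and its support is confined to differences of points of the
  support of \<open>f\<close>.\<close>

lemma inner_conv_op_autocorr:
  fixes a f :: "'a::euclidean_space \<Rightarrow> complex"
  assumes a: "integrable lborel a" and f: "integrable lborel f" "square_integrable f"
    and M: "\<And>x. cmod (f x) \<le> M"
  shows "inner (conv_op a (abs_l2 f)) (abs_l2 f) = Re (LINT z|lborel. a z * autocorr f z)"
proof -
  have [measurable]: "a \<in> borel_measurable borel" "f \<in> borel_measurable borel"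
    using borel_measurable_integrable[OF a] square_integrable_measurable[OF f(2)] by simp_all
  have pair: "integrable (lborel \<Otimes>\<^sub>M lborel) (\<lambda>(y, z). f y * (a z * cnj (f (z + y))))"
  proof (rule integrable_lborel_pairI)
    have "(\<integral>\<^sup>+y. \<integral>\<^sup>+z. ennreal (norm (case (y, z) of (y, z) \<Rightarrow> f y * (a z * cnj (f (z + y))))) \<partial>lborel \<partial>lborel)
        \<le> (\<integral>\<^sup>+y. \<integral>\<^sup>+z. ennreal (cmod (f y)) * (ennreal (cmod (a z)) * ennreal M) \<partial>lborel \<partial>lborel)"
      by (intro nn_integral_mono)
         (auto simp: norm_mult ennreal_mult[symmetric] M order_trans[OF norm_ge_zero M] intro!: ennreal_leI mult_left_mono)
    also have "\<dots> = (\<integral>\<^sup>+y. ennreal (cmod (f y)) * ((\<integral>\<^sup>+z. ennreal (cmod (a z)) \<partial>lborel) * ennreal M) \<partial>lborel)"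
      by (simp add: nn_integral_cmult nn_integral_multc)
    also have "\<dots> = (\<integral>\<^sup>+y. ennreal (cmod (f y)) \<partial>lborel) * ((\<integral>\<^sup>+z. ennreal (cmod (a z)) \<partial>lborel) * ennreal M)"
      by (rule nn_integral_multc) measurable
    also have "\<dots> < \<infinity>"
      using a f by (simp add: nn_integral_eq_integral ennreal_mult_less_top)
    finally show "(\<integral>\<^sup>+y. \<integral>\<^sup>+z. ennreal (norm (case (y, z) of (y, z) \<Rightarrow> f y * (a z * cnj (f (z + y))))) \<partial>lborel \<partial>lborel) < \<infinity>" .
  qed measurable
  have "(LINT x|lborel. conv a f x * cnj (f x)) = (LINT y|lborel. f y * (LINT x|lborel. a (x - y) * cnj (f x)))"
    by (rule integral_conv_mult[OF a f(2) square_integrable_cnj[OF f(2)]])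
  also have "\<dots> = (LINT y|lborel. f y * (LINT z|lborel. a z * cnj (f (z + y))))"
  proof -
    have "(LINT x|lborel. a (x - y) * cnj (f x)) = (LINT z|lborel. a z * cnj (f (z + y)))" for y
      by (subst integral_translate[symmetric, of _ y]) simp_all
    then show ?thesis by simp
  qed
  also have "\<dots> = (LINT y|lborel. LINT z|lborel. f y * (a z * cnj (f (z + y))))" by simp
  also have "\<dots> = (LINT z|lborel. LINT y|lborel. f y * (a z * cnj (f (z + y))))"
    by (rule lborel_pair.Fubini_integral[symmetric]) (rule pair)
  also have "\<dots> = (LINT z|lborel. a z * autocorr f z)"
    unfolding autocorr_def by (simp add: add.commute mult.left_commute[of _ "a _"])
  finally show ?thesis
    by (simp add: conv_op_abs_l2[OF a f(2)] inner_abs_l2 square_integrable_conv[OF a f(2)] f(2))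
qed

text \<open>The Wiener--Khinchin relation. The argument \<open>- \<xi>\<close> is reflected because
  the conjugate sits on the translated factor.\<close>

lemma
  fixes f :: "'a::euclidean_space \<Rightarrow> complex"
  assumes f: "integrable lborel f"
  shows integrable_autocorr: "integrable lborel (autocorr f)"
    and ft_autocorr: "ft (autocorr f) (- \<xi>) = complex_of_real ((cmod (ft f \<xi>))\<^sup>2)"
proof -
  have [measurable]: "f \<in> borel_measurable borel" using borel_measurable_integrable[OF f] by simp
  have pair: "integrable (lborel \<Otimes>\<^sub>M lborel) (\<lambda>(y, z). f y * cnj (f (y + z)) * cis (t z))"
    if [measurable]: "t \<in> borel_measurable borel" for t :: "'a \<Rightarrow> real"
  proof (rule integrable_lborel_pairI)
    have "(\<integral>\<^sup>+y. \<integral>\<^sup>+z. ennreal (norm (case (y, z) of (y, z) \<Rightarrow> f y * cnj (f (y + z)) * cis (t z))) \<partial>lborel \<partial>lborel)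
        = (\<integral>\<^sup>+y. ennreal (cmod (f y)) * (\<integral>\<^sup>+z. ennreal (cmod (f (z + y))) \<partial>lborel) \<partial>lborel)"
      by (intro nn_integral_cong) (simp add: norm_mult ennreal_mult nn_integral_cmult add.commute)
    also have "\<dots> = (\<integral>\<^sup>+y. ennreal (cmod (f y)) * (\<integral>\<^sup>+z. ennreal (cmod (f z)) \<partial>lborel) \<partial>lborel)"
      by (subst nn_integral_translate[of "\<lambda>z. ennreal (cmod (f z))"]) simp_all
    also have "\<dots> = (\<integral>\<^sup>+y. ennreal (cmod (f y)) \<partial>lborel) * (\<integral>\<^sup>+z. ennreal (cmod (f z)) \<partial>lborel)"
      by (rule nn_integral_multc) measurable
    also have "\<dots> < \<infinity>"
      using f by (simp add: nn_integral_eq_integral ennreal_mult_less_top)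
    finally show "(\<integral>\<^sup>+y. \<integral>\<^sup>+z. ennreal (norm (case (y, z) of (y, z) \<Rightarrow> f y * cnj (f (y + z)) * cis (t z))) \<partial>lborel \<partial>lborel) < \<infinity>" .
  qed measurable
  have "integrable (lborel \<Otimes>\<^sub>M lborel) (\<lambda>(y, z). f y * cnj (f (y + z)))"
    using pair[of "\<lambda>_. 0"] by simp
  from lborel_pair.integrable_product_swap[OF this] show "integrable lborel (autocorr f)"
    unfolding autocorr_def[abs_def] by (intro lborel_pair.integrable_fst) (simp add: case_prod_unfold)
  have "ft (autocorr f) (- \<xi>) = (LINT z|lborel. LINT y|lborel. f y * cnj (f (y + z)) * cis (\<xi> \<bullet> z))"
    by (simp add: ft_def autocorr_def)
  also have "\<dots> = (LINT y|lborel. LINT z|lborel. f y * cnj (f (y + z)) * cis (\<xi> \<bullet> z))"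
    by (rule lborel_pair.Fubini_integral) (rule pair, measurable)
  also have "\<dots> = (LINT y|lborel. f y * cis (- (\<xi> \<bullet> y)) * cnj (ft f \<xi>))"
  proof (rule Bochner_Integration.integral_cong[OF refl])
    fix y
    have "f y * cnj (f (y + z)) * cis (\<xi> \<bullet> z) = f y * cis (- (\<xi> \<bullet> y)) * cnj (f (z + y) * cis (- (\<xi> \<bullet> (z + y))))" for z
      by (simp add: inner_add_right cis_cnj cis_mult mult_ac add.commute)
    then have "(LINT z|lborel. f y * cnj (f (y + z)) * cis (\<xi> \<bullet> z))
        = f y * cis (- (\<xi> \<bullet> y)) * cnj (LINT z|lborel. f (z + y) * cis (- (\<xi> \<bullet> (z + y))))"
      by (simp only: integral_mult_right_zero Bochner_Integration.integral_cnj)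
    also have "(LINT z|lborel. f (z + y) * cis (- (\<xi> \<bullet> (z + y)))) = ft f \<xi>"
      unfolding ft_def by (rule integral_translate[of "\<lambda>z. f z * cis (- (\<xi> \<bullet> z))"]) measurable
    finally show "(LINT z|lborel. f y * cnj (f (y + z)) * cis (\<xi> \<bullet> z)) = f y * cis (- (\<xi> \<bullet> y)) * cnj (ft f \<xi>)" .
  qed
  also have "\<dots> = ft f \<xi> * cnj (ft f \<xi>)"
    by (simp add: ft_def)
  finally show "ft (autocorr f) (- \<xi>) = complex_of_real ((cmod (ft f \<xi>))\<^sup>2)"
    by (simp only: complex_norm_square)
qed

lemma
  assumes f: "C_c f"
  shows continuous_autocorr: "continuous_on UNIV (autocorr f)"
    and bounded_autocorr: "\<exists>M. \<forall>z. cmod (autocorr f z) \<le> M"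
proof -
  have [measurable]: "f \<in> borel_measurable borel" by (rule C_c_measurable[OF f])
  have int: "integrable lborel f" by (rule C_c_integrable[OF f])
  obtain M where M: "M > 0" "\<And>x. cmod (f x) \<le> M" using C_c_bounded[OF f] by blast
  define D where "D = (LINT y|lborel. cmod (f y))"
  have D: "0 \<le> D" by (simp add: D_def)
  have int_mult: "integrable lborel (\<lambda>y. f y * cnj (f (y + z)))" for z
  proof (rule Bochner_Integration.integrable_bound)
    show "integrable lborel (\<lambda>y. M * cmod (f y))" using int by simp
    show "AE y in lborel. norm (f y * cnj (f (y + z))) \<le> norm (M * cmod (f y))"
      using M by (auto simp: norm_mult mult.commute[of M] abs_mult intro!: mult_left_mono)
  qed measurable
  show "\<exists>M. \<forall>z. cmod (autocorr f z) \<le> M"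
  proof (intro exI allI)
    fix z
    have "cmod (autocorr f z) \<le> (LINT y|lborel. cmod (f y * cnj (f (y + z))))"
      unfolding autocorr_def by (rule integral_norm_bound)
    also have "\<dots> \<le> (LINT y|lborel. M * cmod (f y))"
      using int_mult int M
      by (intro integral_mono integrable_norm) (auto simp: norm_mult mult.commute[of M] intro!: mult_left_mono)
    finally show "cmod (autocorr f z) \<le> (LINT y|lborel. M * cmod (f y))" .
  qed
  show "continuous_on UNIV (autocorr f)"
    unfolding continuous_on_iff
  proof (intro ballI allI impI)
    fix z :: 'a and e :: real assume e: "e > 0"
    have "e / (D + 1) > 0" using e D by simp
    then obtain d where d: "d > 0" "\<And>x y. norm (x - y) < d \<Longrightarrow> cmod (f x - f y) < e / (D + 1)"
      using C_c_uniformly_continuous[OF f] by metis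
    have "cmod (autocorr f z' - autocorr f z) < e" if z': "norm (z' - z) < d" for z'
    proof -
      have le: "cmod (f (y + z') - f (y + z)) \<le> e / (D + 1)" for y
        using d(2)[of "y + z'" "y + z"] z' by simp
      have int_diff: "integrable lborel (\<lambda>y. f y * cnj (f (y + z') - f (y + z)))"
        using Bochner_Integration.integrable_diff[OF int_mult[of z'] int_mult[of z]] by (simp add: right_diff_distrib)
      have "autocorr f z' - autocorr f z = (LINT y|lborel. f y * cnj (f (y + z') - f (y + z)))"
        unfolding autocorr_def
        using Bochner_Integration.integral_diff[OF int_mult[of z'] int_mult[of z]] by (simp add: right_diff_distrib)
      also have "cmod \<dots> \<le> (LINT y|lborel. cmod (f y * cnj (f (y + z') - f (y + z))))"
        by (rule integral_norm_bound)
      also have "\<dots> \<le> (LINT y|lborel. cmod (f y) * (e / (D + 1)))"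
      proof (rule integral_mono)
        show "integrable lborel (\<lambda>y. cmod (f y * cnj (f (y + z') - f (y + z))))"
          by (rule integrable_norm[OF int_diff])
        show "cmod (f y * cnj (f (y + z') - f (y + z))) \<le> cmod (f y) * (e / (D + 1))" for y
          unfolding norm_mult complex_mod_cnj by (intro mult_left_mono le) simp
      qed (use int in simp)
      also have "\<dots> = D * (e / (D + 1))" by (simp add: D_def)
      also have "\<dots> < e" using e D by (simp add: field_simps)
      finally show ?thesis .
    qed
    then show "\<exists>d>0. \<forall>z'\<in>UNIV. dist z' z < d \<longrightarrow> dist (autocorr f z') (autocorr f z) < e"
      using d(1) by (auto simp: dist_norm)
  qed
qed

text \<open>The normalized Gaussian is an approximate identity; the bound by \<open>M\<close>,
  uniform in the width, later serves as majorant for dominated convergence.\<close>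

lemma gauss_mollifier_tendsto:
  fixes g :: "'a::euclidean_space \<Rightarrow> complex"
  assumes g: "continuous_on UNIV g" "\<And>z. cmod (g z) \<le> M"
  shows "(\<lambda>n. LINT w|lborel. gauss w * g (z + w /\<^sub>R real (Suc n))) \<longlonglongrightarrow> g z"
    and "cmod (LINT w|lborel. gauss w * g (z + w /\<^sub>R s)) \<le> M"
proof -
  have [measurable]: "g \<in> borel_measurable borel"
    using g(1) by (rule borel_measurable_continuous_onI)
  have M0: "0 \<le> M" using g(2)[of 0] norm_ge_zero order_trans by blast
  have le: "cmod (gauss w * g v) \<le> M * gauss w" for v w
    using g(2)[of v] gauss_pos[of w] by (simp add: norm_mult mult.commute[of M] mult_left_mono)
  have int: "integrable lborel (\<lambda>w::'a. M * gauss w)" by (intro integrable_mult_right integrable_gauss)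
  have "(\<lambda>n. LINT w|lborel. gauss w * g (z + w /\<^sub>R real (Suc n))) \<longlonglongrightarrow> (LINT w|lborel. gauss (w::'a) * g z)"
  proof (rule integral_dominated_convergence[OF _ _ int])
    show "AE w in lborel. (\<lambda>n. gauss w * g (z + w /\<^sub>R real (Suc n))) \<longlonglongrightarrow> gauss w * g z"
    proof (rule AE_I2)
      fix w :: 'a
      have "(\<lambda>n. z + inverse (real (Suc n)) *\<^sub>R w) \<longlonglongrightarrow> z + 0 *\<^sub>R w"
        by (intro tendsto_intros LIMSEQ_inverse_real_of_nat)
      then have "(\<lambda>n. g (z + w /\<^sub>R real (Suc n))) \<longlonglongrightarrow> g z"
        using continuous_on_tendsto_compose[OF g(1)] by simp
      then show "(\<lambda>n. gauss w * g (z + w /\<^sub>R real (Suc n))) \<longlonglongrightarrow> gauss w * g z"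
        by (intro tendsto_intros)
    qed
  qed (use le in auto)
  then show "(\<lambda>n. LINT w|lborel. gauss w * g (z + w /\<^sub>R real (Suc n))) \<longlonglongrightarrow> g z"
    by (simp add: integral_gauss)
  have "cmod (LINT w|lborel. gauss w * g (z + w /\<^sub>R s)) \<le> (LINT w|lborel. cmod (gauss w * g (z + w /\<^sub>R s)))"
    by (rule integral_norm_bound)
  also have "\<dots> \<le> (LINT w|lborel. M * gauss (w::'a))"
    using int le by (intro integral_mono') (auto simp: M0 gauss_pos less_imp_le)
  also have "\<dots> = M" by (simp add: integral_gauss)
  finally show "cmod (LINT w|lborel. gauss w * g (z + w /\<^sub>R s)) \<le> M" .
qed

text \<open>
  A form of Plancherel's formula that needs no integrability of the transform: both sides are
  regularized by a Gaussian, and the regularization of the continuous function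
  \<open>autocorr f\<close> converges pointwise and boundedly.
\<close>

lemma gauss_form_tendsto:
  fixes a f :: "'a::euclidean_space \<Rightarrow> complex"
  assumes a: "integrable lborel a" and f: "C_c f"
  shows "(\<lambda>n. gauss_const TYPE('a) *
      (LINT \<xi>|lborel. gauss (\<xi> /\<^sub>R real (Suc n)) * (ft a \<xi> * (cmod (ft f \<xi>))\<^sup>2)))
    \<longlonglongrightarrow> (LINT z|lborel. a z * autocorr f z)"
    and "(\<lambda>n. gauss_const TYPE('a) *
      (LINT \<xi>|lborel. gauss (\<xi> /\<^sub>R real (Suc n)) * complex_of_real ((cmod (ft f \<xi>))\<^sup>2)))
    \<longlonglongrightarrow> (LINT x|lborel. (cmod (f x))\<^sup>2)"
proof -
  have f_int: "integrable lborel f" by (rule C_c_integrable[OF f])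
  have [measurable]: "a \<in> borel_measurable borel" "f \<in> borel_measurable borel"
    using borel_measurable_integrable[OF a] C_c_measurable[OF f] by auto
  have [measurable]: "ft f \<in> borel_measurable borel" "ft a \<in> borel_measurable borel"
    using continuous_on_ft[OF f_int] continuous_on_ft[OF a] by (auto intro: borel_measurable_continuous_onI)
  let ?g = "autocorr f" and ?c = "complex_of_real (gauss_const TYPE('a))"
  have g_int: "integrable lborel ?g" by (rule integrable_autocorr[OF f_int])
  have [measurable]: "?g \<in> borel_measurable borel" using borel_measurable_integrable[OF g_int] by simp
  obtain M where M: "\<And>z. cmod (?g z) \<le> M" using bounded_autocorr[OF f] by blast
  note conv_g = gauss_mollifier_tendsto[OF continuous_autocorr[OF f] M]
  have inv: "?c * (LINT \<xi>|lborel. gauss (\<xi> /\<^sub>R s) * (cis (- (\<xi> \<bullet> z)) * complex_of_real ((cmod (ft f \<xi>))\<^sup>2)))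
      = (LINT w|lborel. gauss w * ?g (z + w /\<^sub>R s))" if "s > 0" for s z
    using gauss_inversion[OF g_int that] by (simp only: ft_autocorr[OF f_int])
  show "(\<lambda>n. ?c * (LINT \<xi>|lborel. gauss (\<xi> /\<^sub>R real (Suc n)) * complex_of_real ((cmod (ft f \<xi>))\<^sup>2)))
      \<longlonglongrightarrow> (LINT x|lborel. (cmod (f x))\<^sup>2)"
  proof -
    \<comment> \<open>At the origin the autocorrelation is the squared norm, so this limit is that
      of the mollification at \<open>z = 0\<close>.\<close>
    have "?g 0 = (LINT x|lborel. (cmod (f x))\<^sup>2)"
      by (simp only: autocorr_def add_0_right complex_norm_square[symmetric] integral_complex_of_real)
    then show ?thesis
      using conv_g(1)[of 0] inv[of _ 0] by simp
  qed
  define F where "F = (LINT y|lborel. cmod (f y))"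
  \<comment> \<open>Fubini moves the Gaussian weight from the mollified autocorrelation to the
    product of the transforms.\<close>
  have form: "(LINT z|lborel. a z * (LINT w|lborel. gauss w * ?g (z + w /\<^sub>R s)))
      = ?c * (LINT \<xi>|lborel. gauss (\<xi> /\<^sub>R s) * (ft a \<xi> * (cmod (ft f \<xi>))\<^sup>2))" if s: "s > 0" for s
  proof -
    let ?h = "\<lambda>\<xi>. complex_of_real (gauss (\<xi> /\<^sub>R s)) * complex_of_real ((cmod (ft f \<xi>))\<^sup>2)"
    have pair: "integrable (lborel \<Otimes>\<^sub>M lborel) (\<lambda>(z, \<xi>). a z * ?h \<xi> * cis (- (\<xi> \<bullet> z)))"
    proof (rule integrable_lborel_pairI)
      have h_int: "integrable lborel ?h"
      proof (rule Bochner_Integration.integrable_bound)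
        show "integrable lborel (\<lambda>\<xi>::'a. gauss (\<xi> /\<^sub>R s) * F\<^sup>2)"
          by (intro integrable_mult_left integrable_gauss_scaled[OF s])
        have "norm (?h \<xi>) \<le> norm (gauss (\<xi> /\<^sub>R s) * F\<^sup>2)" for \<xi>
          using cmod_ft_le[of f \<xi>] gauss_pos[of "\<xi> /\<^sub>R s"]
          by (auto simp: norm_mult F_def norm_power intro!: mult_left_mono power_mono)
        then show "AE \<xi> in lborel. norm (?h \<xi>) \<le> norm (gauss (\<xi> /\<^sub>R s) * F\<^sup>2)" by simp
      qed measurable
      have "(\<integral>\<^sup>+z. \<integral>\<^sup>+\<xi>. ennreal (norm (case (z, \<xi>) of (z, \<xi>) \<Rightarrow> a z * ?h \<xi> * cis (- (\<xi> \<bullet> z)))) \<partial>lborel \<partial>lborel)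
          = (\<integral>\<^sup>+z. ennreal (cmod (a z)) * (\<integral>\<^sup>+\<xi>. ennreal (cmod (?h \<xi>)) \<partial>lborel) \<partial>lborel)"
      proof (rule nn_integral_cong)
        fix z
        have "(\<integral>\<^sup>+\<xi>. ennreal (norm (case (z, \<xi>) of (z, \<xi>) \<Rightarrow> a z * ?h \<xi> * cis (- (\<xi> \<bullet> z)))) \<partial>lborel)
            = (\<integral>\<^sup>+\<xi>. ennreal (cmod (a z)) * ennreal (cmod (?h \<xi>)) \<partial>lborel)"
          by (intro nn_integral_cong) (simp add: norm_mult ennreal_mult)
        then show "(\<integral>\<^sup>+\<xi>. ennreal (norm (case (z, \<xi>) of (z, \<xi>) \<Rightarrow> a z * ?h \<xi> * cis (- (\<xi> \<bullet> z)))) \<partial>lborel)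
            = ennreal (cmod (a z)) * (\<integral>\<^sup>+\<xi>. ennreal (cmod (?h \<xi>)) \<partial>lborel)"
          by (subst nn_integral_cmult[symmetric]) simp_all
      qed
      also have "\<dots> = (\<integral>\<^sup>+z. ennreal (cmod (a z)) \<partial>lborel) * (\<integral>\<^sup>+\<xi>. ennreal (cmod (?h \<xi>)) \<partial>lborel)"
        by (rule nn_integral_multc) measurable
      also have "\<dots> < \<infinity>"
        using a h_int unfolding integrable_iff_bounded by (simp only: ennreal_mult_less_top infinity_ennreal_def) simp
      finally show "(\<integral>\<^sup>+z. \<integral>\<^sup>+\<xi>. ennreal (norm (case (z, \<xi>) of (z, \<xi>) \<Rightarrow> a z * ?h \<xi> * cis (- (\<xi> \<bullet> z)))) \<partial>lborel \<partial>lborel) < \<infinity>" .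
    qed measurable
    have "(LINT z|lborel. a z * (LINT w|lborel. gauss w * ?g (z + w /\<^sub>R s)))
        = (LINT z|lborel. ?c * (LINT \<xi>|lborel. a z * ?h \<xi> * cis (- (\<xi> \<bullet> z))))"
    proof (rule Bochner_Integration.integral_cong[OF refl])
      fix z
      have "a z * ?h \<xi> * cis (- (\<xi> \<bullet> z))
          = a z * (gauss (\<xi> /\<^sub>R s) * (cis (- (\<xi> \<bullet> z)) * complex_of_real ((cmod (ft f \<xi>))\<^sup>2)))" for \<xi>
        by (simp only: mult_ac)
      then show "a z * (LINT w|lborel. gauss w * ?g (z + w /\<^sub>R s)) = ?c * (LINT \<xi>|lborel. a z * ?h \<xi> * cis (- (\<xi> \<bullet> z)))"
        by (simp only: inv[OF s, symmetric] integral_mult_right_zero mult.left_commute)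
    qed
    also have "\<dots> = ?c * (LINT z|lborel. LINT \<xi>|lborel. a z * ?h \<xi> * cis (- (\<xi> \<bullet> z)))"
      by (rule integral_mult_right_zero)
    also have "(LINT z|lborel. LINT \<xi>|lborel. a z * ?h \<xi> * cis (- (\<xi> \<bullet> z)))
        = (LINT \<xi>|lborel. LINT z|lborel. a z * ?h \<xi> * cis (- (\<xi> \<bullet> z)))"
      by (rule lborel_pair.Fubini_integral[symmetric]) (rule pair)
    also have "\<dots> = (LINT \<xi>|lborel. gauss (\<xi> /\<^sub>R s) * (ft a \<xi> * (cmod (ft f \<xi>))\<^sup>2))"
    proof (rule Bochner_Integration.integral_cong[OF refl])
      fix \<xi>
      have "a z * ?h \<xi> * cis (- (\<xi> \<bullet> z)) = ?h \<xi> * (a z * cis (- (\<xi> \<bullet> z)))" for z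
        by (simp only: mult_ac)
      then show "(LINT z|lborel. a z * ?h \<xi> * cis (- (\<xi> \<bullet> z))) = gauss (\<xi> /\<^sub>R s) * (ft a \<xi> * (cmod (ft f \<xi>))\<^sup>2)"
        by (simp only: ft_def[of a] integral_mult_right_zero) (simp add: mult_ac)
    qed
    finally show ?thesis .
  qed
  have "(\<lambda>n. LINT z|lborel. a z * (LINT w|lborel. gauss w * ?g (z + w /\<^sub>R real (Suc n))))
      \<longlonglongrightarrow> (LINT z|lborel. a z * ?g z)"
  proof (rule integral_dominated_convergence[where w = "\<lambda>z. cmod (a z) * M"])
    show "AE z in lborel. (\<lambda>n. a z * (LINT w|lborel. gauss w * ?g (z + w /\<^sub>R real (Suc n)))) \<longlonglongrightarrow> a z * ?g z"
      by (intro AE_I2 tendsto_intros conv_g(1))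
    show "AE z in lborel. norm (a z * (LINT w|lborel. gauss w * ?g (z + w /\<^sub>R real (Suc n)))) \<le> cmod (a z) * M" for n
      unfolding norm_mult by (intro AE_I2 mult_left_mono conv_g(2)) simp
  qed (use a in auto)
  then show "(\<lambda>n. ?c * (LINT \<xi>|lborel. gauss (\<xi> /\<^sub>R real (Suc n)) * (ft a \<xi> * (cmod (ft f \<xi>))\<^sup>2)))
      \<longlonglongrightarrow> (LINT z|lborel. a z * ?g z)"
    by (subst (asm) form) simp_all
qed

text \<open>The real form of the two limits, in which integrands can be compared pointwise.\<close>

lemma gauss_form_Re_tendsto:
  fixes a f :: "'a::euclidean_space \<Rightarrow> complex"
  assumes a: "integrable lborel a" and f: "C_c f"
  shows "integrable lborel (\<lambda>\<xi>. gauss (\<xi> /\<^sub>R real (Suc n)) * (Re (ft a \<xi>) * (cmod (ft f \<xi>))\<^sup>2))"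
    and "integrable lborel (\<lambda>\<xi>. gauss (\<xi> /\<^sub>R real (Suc n)) * (cmod (ft f \<xi>))\<^sup>2)"
    and "(\<lambda>n. gauss_const TYPE('a) *
      (LINT \<xi>|lborel. gauss (\<xi> /\<^sub>R real (Suc n)) * (Re (ft a \<xi>) * (cmod (ft f \<xi>))\<^sup>2)))
      \<longlonglongrightarrow> Re (LINT z|lborel. a z * autocorr f z)"
    and "(\<lambda>n. gauss_const TYPE('a) *
      (LINT \<xi>|lborel. gauss (\<xi> /\<^sub>R real (Suc n)) * (cmod (ft f \<xi>))\<^sup>2))
      \<longlonglongrightarrow> (LINT x|lborel. (cmod (f x))\<^sup>2)"
proof -
  have f_int: "integrable lborel f" by (rule C_c_integrable[OF f])
  have [measurable]: "ft f \<in> borel_measurable borel" "ft a \<in> borel_measurable borel"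
    using continuous_on_ft[OF f_int] continuous_on_ft[OF a] by (auto intro: borel_measurable_continuous_onI)
  define A where "A = (LINT y|lborel. cmod (a y))"
  define F where "F = (LINT y|lborel. cmod (f y))"
  have F: "(cmod (ft f \<xi>))\<^sup>2 \<le> F\<^sup>2" for \<xi>
    unfolding F_def by (intro power_mono cmod_ft_le) simp
  have A: "cmod (ft a \<xi>) \<le> A" for \<xi> unfolding A_def by (rule cmod_ft_le)
  have gs: "integrable lborel (\<lambda>\<xi>::'a. gauss (\<xi> /\<^sub>R real (Suc n)))" for n
    by (rule integrable_gauss_scaled) simp
  show int2: "integrable lborel (\<lambda>\<xi>. gauss (\<xi> /\<^sub>R real (Suc n)) * (cmod (ft f \<xi>))\<^sup>2)" for n
  proof (rule Bochner_Integration.integrable_bound)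
    show "integrable lborel (\<lambda>\<xi>::'a. gauss (\<xi> /\<^sub>R real (Suc n)) * F\<^sup>2)"
      by (rule integrable_mult_left[OF gs])
    show "AE \<xi> in lborel. norm (gauss (\<xi> /\<^sub>R real (Suc n)) * (cmod (ft f \<xi>))\<^sup>2) \<le> norm (gauss (\<xi> /\<^sub>R real (Suc n)) * F\<^sup>2)"
      by (intro AE_I2) (simp add: abs_mult mult_left_mono F)
  qed measurable
  have int1: "integrable lborel (\<lambda>\<xi>. complex_of_real (gauss (\<xi> /\<^sub>R real (Suc n))) * (ft a \<xi> * (cmod (ft f \<xi>))\<^sup>2))" for n
  proof (rule Bochner_Integration.integrable_bound)
    show "integrable lborel (\<lambda>\<xi>. A * (gauss (\<xi> /\<^sub>R real (Suc n)) * (cmod (ft f \<xi>))\<^sup>2))"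
      by (rule integrable_mult_right[OF int2])
    have "norm (complex_of_real (gauss (\<xi> /\<^sub>R real (Suc n))) * (ft a \<xi> * (cmod (ft f \<xi>))\<^sup>2))
        = cmod (ft a \<xi>) * (gauss (\<xi> /\<^sub>R real (Suc n)) * (cmod (ft f \<xi>))\<^sup>2)" for \<xi>
      using gauss_pos[of "\<xi> /\<^sub>R real (Suc n)"] by (simp add: norm_mult norm_power)
    also have "\<dots> \<xi> \<le> A * (gauss (\<xi> /\<^sub>R real (Suc n)) * (cmod (ft f \<xi>))\<^sup>2)" for \<xi>
      using gauss_pos[of "\<xi> /\<^sub>R real (Suc n)"] by (intro mult_right_mono A) simp
    finally show "AE \<xi> in lborel. norm (complex_of_real (gauss (\<xi> /\<^sub>R real (Suc n))) * (ft a \<xi> * (cmod (ft f \<xi>))\<^sup>2))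
        \<le> norm (A * (gauss (\<xi> /\<^sub>R real (Suc n)) * (cmod (ft f \<xi>))\<^sup>2))"
      by (intro AE_I2) (auto intro: order_trans[OF _ abs_ge_self])
  qed measurable
  have Re_eq: "Re (complex_of_real (gauss (\<xi> /\<^sub>R real (Suc n))) * (ft a \<xi> * (cmod (ft f \<xi>))\<^sup>2))
      = gauss (\<xi> /\<^sub>R real (Suc n)) * (Re (ft a \<xi>) * (cmod (ft f \<xi>))\<^sup>2)" for \<xi> n
    by (simp del: of_real_power)
  show "integrable lborel (\<lambda>\<xi>. gauss (\<xi> /\<^sub>R real (Suc n)) * (Re (ft a \<xi>) * (cmod (ft f \<xi>))\<^sup>2))"
    using integrable_Re[OF int1[of n]] by (simp only: Re_eq)
  have "Re (gauss_const TYPE('a) * (LINT \<xi>|lborel. gauss (\<xi> /\<^sub>R real (Suc n)) * (ft a \<xi> * (cmod (ft f \<xi>))\<^sup>2)))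
      = gauss_const TYPE('a) * (LINT \<xi>|lborel. gauss (\<xi> /\<^sub>R real (Suc n)) * (Re (ft a \<xi>) * (cmod (ft f \<xi>))\<^sup>2))" for n
  proof -
    have mult_Re: "Re (complex_of_real c * Z) = c * Re Z" for c Z by simp
    show ?thesis by (subst mult_Re) (simp only: integral_Re[OF int1[of n], symmetric] Re_eq)
  qed
  then show "(\<lambda>n. gauss_const TYPE('a) *
      (LINT \<xi>|lborel. gauss (\<xi> /\<^sub>R real (Suc n)) * (Re (ft a \<xi>) * (cmod (ft f \<xi>))\<^sup>2)))
      \<longlonglongrightarrow> Re (LINT z|lborel. a z * autocorr f z)"
    using tendsto_Re[OF gauss_form_tendsto(1)[OF a f]] by (simp only:)
  have "Re (gauss_const TYPE('a) * (LINT \<xi>|lborel. gauss (\<xi> /\<^sub>R real (Suc n)) * complex_of_real ((cmod (ft f \<xi>))\<^sup>2)))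
      = gauss_const TYPE('a) * (LINT \<xi>|lborel. gauss (\<xi> /\<^sub>R real (Suc n)) * (cmod (ft f \<xi>))\<^sup>2)" for n
    by (simp only: of_real_mult[symmetric] integral_complex_of_real Re_complex_of_real)
  then show "(\<lambda>n. gauss_const TYPE('a) *
      (LINT \<xi>|lborel. gauss (\<xi> /\<^sub>R real (Suc n)) * (cmod (ft f \<xi>))\<^sup>2))
      \<longlonglongrightarrow> (LINT x|lborel. (cmod (f x))\<^sup>2)"
    using tendsto_Re[OF gauss_form_tendsto(2)[OF a f]] by (simp only: Re_complex_of_real)
qed

section \<open>Bounds for the form of the convolution operator\<close>

lemma C_c_form_ge:
  fixes a f :: "'a::euclidean_space \<Rightarrow> complex"
  assumes a: "integrable lborel a" and c: "\<And>\<xi>. c \<le> Re (ft a \<xi>)" and f: "C_c f"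
  shows "c * (LINT x|lborel. (cmod (f x))\<^sup>2) \<le> Re (LINT z|lborel. a z * autocorr f z)"
proof (rule LIMSEQ_le)
  note lims = gauss_form_Re_tendsto[OF a f]
  show "(\<lambda>n. c * (gauss_const TYPE('a) * (LINT \<xi>|lborel. gauss (\<xi> /\<^sub>R real (Suc n)) * (cmod (ft f \<xi>))\<^sup>2)))
      \<longlonglongrightarrow> c * (LINT x|lborel. (cmod (f x))\<^sup>2)"
    by (intro tendsto_intros lims(4))
  show "(\<lambda>n. gauss_const TYPE('a) *
      (LINT \<xi>|lborel. gauss (\<xi> /\<^sub>R real (Suc n)) * (Re (ft a \<xi>) * (cmod (ft f \<xi>))\<^sup>2)))
      \<longlonglongrightarrow> Re (LINT z|lborel. a z * autocorr f z)"
    by (rule lims(3))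
  have "c * (LINT \<xi>|lborel. gauss (\<xi> /\<^sub>R real (Suc n)) * (cmod (ft f \<xi>))\<^sup>2)
      \<le> (LINT \<xi>|lborel. gauss (\<xi> /\<^sub>R real (Suc n)) * (Re (ft a \<xi>) * (cmod (ft f \<xi>))\<^sup>2))" for n
  proof -
    have "c * (gauss (\<xi> /\<^sub>R real (Suc n)) * (cmod (ft f \<xi>))\<^sup>2)
        \<le> gauss (\<xi> /\<^sub>R real (Suc n)) * (Re (ft a \<xi>) * (cmod (ft f \<xi>))\<^sup>2)" for \<xi>
      using c[of \<xi>] gauss_pos[of "\<xi> /\<^sub>R real (Suc n)"]
      by (subst mult.left_commute) (intro mult_left_mono mult_right_mono, auto)
    then have "(LINT \<xi>|lborel. c * (gauss (\<xi> /\<^sub>R real (Suc n)) * (cmod (ft f \<xi>))\<^sup>2))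
        \<le> (LINT \<xi>|lborel. gauss (\<xi> /\<^sub>R real (Suc n)) * (Re (ft a \<xi>) * (cmod (ft f \<xi>))\<^sup>2))"
      by (intro integral_mono integrable_mult_right lims(1,2))
    then show ?thesis by (simp only: integral_mult_right_zero)
  qed
  then show "\<exists>N. \<forall>n\<ge>N. c * (gauss_const TYPE('a) * (LINT \<xi>|lborel. gauss (\<xi> /\<^sub>R real (Suc n)) * (cmod (ft f \<xi>))\<^sup>2))
      \<le> gauss_const TYPE('a) * (LINT \<xi>|lborel. gauss (\<xi> /\<^sub>R real (Suc n)) * (Re (ft a \<xi>) * (cmod (ft f \<xi>))\<^sup>2))"
    using gauss_const_pos[where 'a = 'a] by (intro exI[of _ 0]) (simp add: mult.left_commute[of c])
qed

text \<open>Both sides are continuous in \<open>u\<close>, and the bound is known on the dense set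
  of continuous compactly supported functions. It is used with \<open>c = V_min\<close> for the
  spectral argument and with \<open>c = 0\<close> for the sign of \<open>a_min\<close>.\<close>

proposition conv_op_form_ge:
  fixes a :: "'a::euclidean_space \<Rightarrow> complex"
  assumes a: "integrable lborel a" and c: "\<And>\<xi>. c \<le> Re (ft a \<xi>)"
  shows "c * (norm u)\<^sup>2 \<le> inner (conv_op a u) u"
proof (cases u)
  case (1 f)
  have [measurable]: "f \<in> borel_measurable borel" by (rule square_integrable_measurable[OF 1(2)])
  have "\<exists>g. C_c g \<and> (LINT x|lborel. cmod (f x - g x) ^ 2) < inverse (real (Suc n))" for n
    by (rule C_c_dense[of f 2 "inverse (real (Suc n))"]) (use 1(2) in \<open>auto simp: square_integrable_def\<close>)
  then obtain g where g: "\<And>n. C_c (g n)" and close: "\<And>n. (LINT x|lborel. cmod (f x - g n x) ^ 2) < inverse (real (Suc n))"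
    by metis
  have gs: "square_integrable (g n)" for n by (rule C_c_square_integrable[OF g])
  have lim: "(\<lambda>n. abs_l2 (g n)) \<longlonglongrightarrow> u"
  proof -
    have "(norm (u - abs_l2 (g n)))\<^sup>2 \<le> inverse (real (Suc n))" for n
      using close[of n] norm_abs_l2[OF square_integrable_diff[OF 1(2) gs[of n]]]
      by (simp add: 1 abs_l2_diff gs)
    then have "(\<lambda>n. (norm (u - abs_l2 (g n)))\<^sup>2) \<longlonglongrightarrow> 0"
      by (intro tendsto_sandwich[OF _ _ tendsto_const LIMSEQ_inverse_real_of_nat]) auto
    then have "(\<lambda>n. u - abs_l2 (g n)) \<longlonglongrightarrow> 0"
      using tendsto_norm_zero_cancel by (simp add: tendsto_norm_zero_iff)
    then have "(\<lambda>n. u - (u - abs_l2 (g n))) \<longlonglongrightarrow> u - 0" by (intro tendsto_diff tendsto_const)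
    then show ?thesis by simp
  qed
  interpret bounded_linear "conv_op a" by (rule bounded_linear_conv_op[OF a])
  show ?thesis
  proof (rule LIMSEQ_le)
    show "(\<lambda>n. c * (norm (abs_l2 (g n)))\<^sup>2) \<longlonglongrightarrow> c * (norm u)\<^sup>2"
      by (intro tendsto_intros lim)
    show "(\<lambda>n. inner (conv_op a (abs_l2 (g n))) (abs_l2 (g n))) \<longlonglongrightarrow> inner (conv_op a u) u"
      by (intro tendsto_intros lim tendsto[OF lim])
    have "c * (norm (abs_l2 (g n)))\<^sup>2 \<le> inner (conv_op a (abs_l2 (g n))) (abs_l2 (g n))" for n
    proof -
      obtain M where M: "\<And>x. cmod (g n x) \<le> M" using C_c_bounded[OF g] by blast
      show ?thesis
        using C_c_form_ge[OF a c g[of n]] inner_conv_op_autocorr[OF a C_c_integrable[OF g[of n]] gs[of n] M]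
        by (simp add: norm_abs_l2 gs)
    qed
    then show "\<exists>N. \<forall>n\<ge>N. c * (norm (abs_l2 (g n)))\<^sup>2 \<le> inner (conv_op a (abs_l2 (g n))) (abs_l2 (g n))" by blast
  qed
qed

text \<open>Strictness has to survive the limit. By continuity the product of the transforms stays
  below half its value at \<zeta> on a whole ball, and there the Gaussian weights, which only grow
  with their width, stay above a fixed \<kappa>. All regularized integrals therefore lie below the
  same negative \<open>K\<close>.\<close>

lemma C_c_form_neg:
  fixes a f :: "'a::euclidean_space \<Rightarrow> complex"
  assumes a: "integrable lborel a" and nonpos: "\<And>\<xi>. Re (ft a \<xi>) \<le> 0" and f: "C_c f"
    and neg: "Re (ft a \<zeta>) < 0" "ft f \<zeta> \<noteq> 0"
  shows "Re (LINT z|lborel. a z * autocorr f z) < 0"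
proof -
  note lims = gauss_form_Re_tendsto[OF a f]
  have f_int: "integrable lborel f" by (rule C_c_integrable[OF f])
  define \<Phi> where "\<Phi> \<xi> = Re (ft a \<xi>) * (cmod (ft f \<xi>))\<^sup>2" for \<xi>
  have \<Phi>_le: "\<Phi> \<xi> \<le> 0" for \<xi> using nonpos[of \<xi>] by (simp add: \<Phi>_def mult_nonpos_nonneg)
  have "continuous_on UNIV \<Phi>"
    unfolding \<Phi>_def by (intro continuous_intros continuous_on_ft[OF a] continuous_on_ft[OF f_int])
  moreover have "\<Phi> \<zeta> < 0" using neg by (simp add: \<Phi>_def mult_neg_pos)
  ultimately have "open {\<xi>. \<Phi> \<xi> < \<Phi> \<zeta> / 2}" "\<zeta> \<in> {\<xi>. \<Phi> \<xi> < \<Phi> \<zeta> / 2}"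
    by (auto intro!: open_Collect_less continuous_intros)
  then obtain \<rho> where \<rho>: "\<rho> > 0" "ball \<zeta> \<rho> \<subseteq> {\<xi>. \<Phi> \<xi> < \<Phi> \<zeta> / 2}"
    unfolding open_contains_ball by blast
  \<comment> \<open>The value of the narrowest weight, of width 1, at norm
    \<open>norm \<zeta> + \<rho>\<close>, which no point of the ball exceeds.\<close>
  define \<kappa> where "\<kappa> = gauss_const TYPE('a) * exp (- (norm \<zeta> + \<rho>)\<^sup>2 / 2)"
  have \<kappa>: "\<kappa> > 0" using gauss_const_pos[where 'a = 'a] by (simp add: \<kappa>_def)
  define K where "K = \<kappa> * (\<Phi> \<zeta> / 2) * measure lborel (ball \<zeta> \<rho>)"
  have K: "K < 0"
  proof -
    have "measure lborel (ball \<zeta> \<rho>) > 0" using \<rho>(1) by (simp add: content_ball_pos)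
    then show ?thesis using \<kappa> \<open>\<Phi> \<zeta> < 0\<close> by (simp add: K_def mult_pos_neg mult_neg_pos)
  qed
  have gauss_ge: "\<kappa> \<le> gauss (\<xi> /\<^sub>R real (Suc n))" if "\<xi> \<in> ball \<zeta> \<rho>" for \<xi> n
  proof -
    have "norm (\<xi> /\<^sub>R real (Suc n)) \<le> norm \<xi>"
      by (simp add: divide_simps) (simp add: mult_le_cancel_left1 distrib_left distrib_right)
    also have "\<dots> \<le> norm \<zeta> + \<rho>"
      using that norm_triangle_sub[of \<xi> \<zeta>] by (simp add: dist_norm norm_minus_commute)
    finally have "(norm (\<xi> /\<^sub>R real (Suc n)))\<^sup>2 \<le> (norm \<zeta> + \<rho>)\<^sup>2" by (rule power_mono) simp
    then show ?thesis
      unfolding \<kappa>_def gauss_eq using gauss_const_pos[where 'a = 'a] by (intro mult_left_mono) auto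
  qed
  have le: "(LINT \<xi>|lborel. gauss (\<xi> /\<^sub>R real (Suc n)) * \<Phi> \<xi>) \<le> K" for n
  proof -
    have ind: "integrable lborel (\<lambda>\<xi>. \<kappa> * (\<Phi> \<zeta> / 2) * indicator (ball \<zeta> \<rho>) \<xi>)"
      by (intro integrable_mult_right integrable_real_indicator emeasure_lborel_ball_finite) simp
    have "(LINT \<xi>|lborel. gauss (\<xi> /\<^sub>R real (Suc n)) * \<Phi> \<xi>) \<le> (LINT \<xi>|lborel. \<kappa> * (\<Phi> \<zeta> / 2) * indicator (ball \<zeta> \<rho>) \<xi>)"
    proof (rule integral_mono[OF _ ind])
      show "integrable lborel (\<lambda>\<xi>. gauss (\<xi> /\<^sub>R real (Suc n)) * \<Phi> \<xi>)"
        unfolding \<Phi>_def by (rule lims(1))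
      show "gauss (\<xi> /\<^sub>R real (Suc n)) * \<Phi> \<xi> \<le> \<kappa> * (\<Phi> \<zeta> / 2) * indicator (ball \<zeta> \<rho>) \<xi>" for \<xi>
      proof (cases "\<xi> \<in> ball \<zeta> \<rho>")
        case True
        have "gauss (\<xi> /\<^sub>R real (Suc n)) * \<Phi> \<xi> \<le> \<kappa> * \<Phi> \<xi>"
          using gauss_ge[OF True] \<Phi>_le by (rule mult_right_mono_neg)
        also have "\<dots> \<le> \<kappa> * (\<Phi> \<zeta> / 2)"
          using \<rho>(2) True \<kappa> by (intro mult_left_mono) auto
        finally show ?thesis using True by simp
      next
        case False
        then show ?thesis using gauss_pos[of "\<xi> /\<^sub>R real (Suc n)"] \<Phi>_le by (simp add: mult_nonneg_nonpos)
      qed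
    qed
    then show ?thesis by (simp add: K_def)
  qed
  have "Re (LINT z|lborel. a z * autocorr f z) \<le> gauss_const TYPE('a) * K"
  proof (rule LIMSEQ_le_const2[OF lims(3)])
    show "\<exists>N. \<forall>n\<ge>N. gauss_const TYPE('a) *
        (LINT \<xi>|lborel. gauss (\<xi> /\<^sub>R real (Suc n)) * (Re (ft a \<xi>) * (cmod (ft f \<xi>))\<^sup>2)) \<le> gauss_const TYPE('a) * K"
      using le gauss_const_pos[where 'a = 'a] unfolding \<Phi>_def by (intro exI[of _ 0] allI impI mult_left_mono) auto
  qed
  also have "\<dots> < 0" using K gauss_const_pos[where 'a = 'a] by (rule mult_pos_neg[rotated])
  finally show ?thesis .
qed

section \<open>Linear independence of exponentials on balls\<close>

text \<open>
  Artin's argument for the independence of characters, with the translations restricted to small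
  vectors.
\<close>

lemma exponentials_independent:
  fixes c :: "'a::euclidean_space \<Rightarrow> complex"
  assumes "finite F" "\<rho> > 0" "\<And>x. x \<in> ball x\<^sub>0 \<rho> \<Longrightarrow> (\<Sum>\<theta>\<in>F. c \<theta> * cis (\<theta> \<bullet> x)) = 0"
  shows "\<forall>\<theta>\<in>F. c \<theta> = 0"
  using assms
proof (induction F arbitrary: c \<rho> rule: finite_induct)
  case (insert k F)
  have zero: "c \<theta> * (cis (\<theta> \<bullet> h) - cis (k \<bullet> h)) = 0" if h: "norm h < \<rho> / 2" and \<theta>: "\<theta> \<in> F" for h \<theta>
  proof -
    \<comment> \<open>Subtracting \<open>cis (k \<bullet> h)\<close> times the relation at
      \<open>x\<close> from the relation at \<open>x + h\<close> removes the frequency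
      \<open>k\<close>; halving the radius keeps \<open>x + h\<close> in the ball.\<close>
    have "\<forall>\<theta>\<in>F. c \<theta> * (cis (\<theta> \<bullet> h) - cis (k \<bullet> h)) = 0"
    proof (rule insert.IH[of "\<rho> / 2"])
      fix x assume x: "x \<in> ball x\<^sub>0 (\<rho> / 2)"
      have "dist x\<^sub>0 (x + h) \<le> dist x\<^sub>0 x + norm h"
        by (metis add_diff_cancel_left' dist_norm dist_triangle norm_minus_commute)
      then have "x + h \<in> ball x\<^sub>0 \<rho>" "x \<in> ball x\<^sub>0 \<rho>"
        using x h insert.prems(1) unfolding mem_ball by linarith+
      then have "(\<Sum>\<theta>\<in>insert k F. c \<theta> * cis (\<theta> \<bullet> (x + h))) - cis (k \<bullet> h) * (\<Sum>\<theta>\<in>insert k F. c \<theta> * cis (\<theta> \<bullet> x)) = 0"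
        using insert.prems(2) by simp
      moreover have "(\<Sum>\<theta>\<in>insert k F. c \<theta> * cis (\<theta> \<bullet> (x + h))) - cis (k \<bullet> h) * (\<Sum>\<theta>\<in>insert k F. c \<theta> * cis (\<theta> \<bullet> x))
          = (\<Sum>\<theta>\<in>insert k F. c \<theta> * (cis (\<theta> \<bullet> h) - cis (k \<bullet> h)) * cis (\<theta> \<bullet> x))"
        unfolding sum_distrib_left sum_subtractf[symmetric]
        by (intro sum.cong refl) (simp add: inner_add_right cis_mult[symmetric] algebra_simps)
      ultimately show "(\<Sum>\<theta>\<in>F. c \<theta> * (cis (\<theta> \<bullet> h) - cis (k \<bullet> h)) * cis (\<theta> \<bullet> x)) = 0"
        using insert.hyps by simp
    qed (use insert.prems in simp)
    then show ?thesis using \<theta> by blast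
  qed
  have cF: "c \<theta> = 0" if \<theta>: "\<theta> \<in> F" for \<theta>
  proof -
    define d where "d = \<theta> - k"
    have d: "norm d > 0" using \<theta> insert.hyps by (auto simp: d_def)
    \<comment> \<open>The first bound keeps the translation \<open>t *\<^sub>R d\<close> shorter
      than \<open>\<rho> / 2\<close>; the second keeps the phase difference
      \<open>t * (norm d)\<^sup>2\<close> between 0 and 1, where the sine is positive.\<close>
    define t where "t = min (\<rho> / 4 / norm d) (1 / (norm d)\<^sup>2)"
    have t: "t > 0" using d insert.prems by (simp add: t_def)
    have "t * norm d \<le> \<rho> / 4 / norm d * norm d" using d by (intro mult_right_mono) (auto simp: t_def)
    then have "norm (t *\<^sub>R d) < \<rho> / 2" using d t insert.prems by simp
    from zero[OF this \<theta>] have "c \<theta> * (cis (\<theta> \<bullet> (t *\<^sub>R d)) - cis (k \<bullet> (t *\<^sub>R d))) = 0" .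
    moreover have "cis (\<theta> \<bullet> (t *\<^sub>R d)) \<noteq> cis (k \<bullet> (t *\<^sub>R d))"
    proof
      assume "cis (\<theta> \<bullet> (t *\<^sub>R d)) = cis (k \<bullet> (t *\<^sub>R d))"
      then have "cis (\<theta> \<bullet> (t *\<^sub>R d)) / cis (k \<bullet> (t *\<^sub>R d)) = 1" by simp
      then have "cis (d \<bullet> (t *\<^sub>R d)) = 1" unfolding cis_divide d_def inner_diff_left .
      then have "sin (t * (norm d)\<^sup>2) = 0"
        by (simp add: power2_norm_eq_inner complex_eq_iff)
      moreover have "t * (norm d)\<^sup>2 \<le> 1 / (norm d)\<^sup>2 * (norm d)\<^sup>2"
        by (intro mult_right_mono) (auto simp: t_def)
      then have "t * (norm d)\<^sup>2 \<le> 1" using d by simp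
      then have "sin (t * (norm d)\<^sup>2) > 0"
        using d t pi_gt3 by (intro sin_gt_zero) auto
      ultimately show False by simp
    qed
    ultimately show ?thesis by simp
  qed
  have "c k * cis (k \<bullet> x\<^sub>0) = 0"
    using insert.prems(2)[of x\<^sub>0] insert.prems(1) insert.hyps cF by simp
  then show ?case using cF by simp
qed simp

section \<open>Test functions when the transform is non-positive\<close>

lemma C_c_sum:
  assumes "\<And>j. j \<in> J \<Longrightarrow> C_c (f j)"
  shows "C_c (\<lambda>x. \<Sum>j\<in>J. f j x)"
proof (cases "finite J")
  case True
  then show ?thesis using assms
  proof induction
    case (insert k J)
    obtain R S where "\<And>x. R \<le> norm x \<Longrightarrow> f k x = 0" "\<And>x. S \<le> norm x \<Longrightarrow> (\<Sum>j\<in>J. f j x) = 0"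
      using insert unfolding C_c_def by (metis insertI1 insertI2)
    then have "\<forall>x. max R S \<le> norm x \<longrightarrow> f k x + (\<Sum>j\<in>J. f j x) = 0" by simp
    moreover have "continuous_on UNIV (\<lambda>x. f k x + (\<Sum>j\<in>J. f j x))"
      using insert by (intro continuous_intros) (auto simp: C_c_def)
    ultimately show ?case using insert.hyps unfolding C_c_def by (auto intro!: exI[of _ "max R S"])
  qed (simp add: C_c_def)
qed (simp add: C_c_def)

lemma C_c_scaleR: "C_c f \<Longrightarrow> C_c (\<lambda>x. c *\<^sub>R f x)"
  by (auto simp: C_c_def intro: continuous_intros)

text \<open>Nonempty open sets are not null. This turns vanishing of a continuous function almost
  everywhere on an open set into vanishing there.\<close>

lemma open_AE_empty:
  fixes U :: "'a::euclidean_space set"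
  assumes "open U" "AE x in lborel. x \<notin> U"
  shows "U = {}"
proof (rule ccontr)
  assume "U \<noteq> {}"
  then have "\<not> negligible U" using assms(1) open_not_negligible by blast
  moreover have "U \<in> null_sets lborel"
    using assms by (auto simp: AE_iff_null_sets[symmetric] borel_open)
  ultimately show False
    using null_sets_completionI negligible_iff_null_sets by blast
qed

definition tent :: "real \<Rightarrow> 'a::euclidean_space \<Rightarrow> 'a \<Rightarrow> complex" where
  "tent \<sigma> p x = complex_of_real (max 0 (\<sigma> - norm (x - p)))"

lemma C_c_tent: "C_c (tent \<sigma> (p::'a::euclidean_space))"
  unfolding C_c_def
proof
  show "continuous_on UNIV (tent \<sigma> p)" unfolding tent_def by (intro continuous_intros)
  show "\<exists>R. \<forall>x. R \<le> norm x \<longrightarrow> tent \<sigma> p x = 0"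
  proof (intro exI[of _ "norm p + \<sigma>"] allI impI)
    fix x :: 'a assume "norm p + \<sigma> \<le> norm x"
    then have "\<sigma> \<le> norm (x - p)" using norm_triangle_ineq2[of x p] by simp
    then show "tent \<sigma> p x = 0" by (simp add: tent_def)
  qed
qed

lemma ft_tent_shift: "ft (tent \<sigma> p) \<xi> = ft (tent \<sigma> 0) \<xi> * cis (- (\<xi> \<bullet> p))"
proof -
  have [measurable]: "tent \<sigma> p \<in> borel_measurable borel" by (rule C_c_measurable[OF C_c_tent])
  have "ft (tent \<sigma> p) \<xi> = (LINT y|lborel. tent \<sigma> p (y + p) * cis (- (\<xi> \<bullet> (y + p))))"
    unfolding ft_def by (rule integral_translate[symmetric, of "\<lambda>y. tent \<sigma> p y * cis (- (\<xi> \<bullet> y))"]) measurable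
  also have "\<dots> = (LINT y|lborel. tent \<sigma> 0 y * cis (- (\<xi> \<bullet> y)) * cis (- (\<xi> \<bullet> p)))"
    by (intro Bochner_Integration.integral_cong refl) (simp add: tent_def inner_add_right cis_mult mult.assoc)
  finally show ?thesis by (simp add: ft_def)
qed

text \<open>On the support of the tent the phase is at most 1, hence below \<open>pi / 2\<close>, so
  the real part of the integrand is positive inside.\<close>

lemma ft_tent_nonzero:
  assumes \<sigma>: "\<sigma> > 0" and \<xi>: "norm \<xi> * \<sigma> \<le> 1"
  shows "ft (tent \<sigma> (0::'a::euclidean_space)) \<xi> \<noteq> 0"
proof
  assume zero: "ft (tent \<sigma> (0::'a)) \<xi> = 0"
  have int: "integrable lborel (\<lambda>y. tent \<sigma> (0::'a) y * cis (- (\<xi> \<bullet> y)))"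
    by (intro integrable_mult_cis C_c_integrable[OF C_c_tent]) measurable
  define v where "v y = max 0 (\<sigma> - norm y) * cos (\<xi> \<bullet> y)" for y :: 'a
  have v_eq: "Re (tent \<sigma> (0::'a) y * cis (- (\<xi> \<bullet> y))) = v y" for y
    by (simp add: tent_def v_def)
  have v_int: "integrable lborel v" using integrable_Re[OF int] by (simp only: v_eq)
  have v_pos: "v y > 0" if "norm y < \<sigma>" for y
  proof -
    have "\<bar>\<xi> \<bullet> y\<bar> \<le> norm \<xi> * norm y" by (rule Cauchy_Schwarz_ineq2)
    also have "\<dots> \<le> norm \<xi> * \<sigma>" using that by (intro mult_left_mono) auto
    finally have "\<bar>\<xi> \<bullet> y\<bar> < pi / 2" using \<xi> pi_gt3 by simp
    then have "cos (\<xi> \<bullet> y) > 0" by (intro cos_gt_zero_pi) auto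
    then show ?thesis using that by (simp add: v_def)
  qed
  have v_nonneg: "0 \<le> v y" for y
    using v_pos[of y] by (cases "norm y < \<sigma>") (auto simp: v_def)
  have "(LINT y|lborel. v y) = Re (ft (tent \<sigma> (0::'a)) \<xi>)"
    unfolding ft_def using integral_Re[OF int] by (simp only: v_eq)
  then have "(LINT y|lborel. v y) = 0" by (simp add: zero)
  then have "AE y in lborel. v y = 0"
    using integral_nonneg_eq_0_iff_AE[OF v_int] v_nonneg by simp
  then have "AE y in lborel. y \<notin> ball (0::'a) \<sigma>"
    by eventually_elim (use v_pos in force)
  then have "ball (0::'a) \<sigma> = {}" by (rule open_AE_empty[OF open_ball])
  then show False using \<sigma> by simp
qed

text \<open>The transform of a combination of translated tents is that of one tent times an
  exponential sum with the distinct frequencies \<open>- p j\<close>. The sum cannot vanish on a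
  whole ball around \<zeta>, and the tent transform has no zero there, so
  \<open>C_c_form_neg\<close> applies at some point near \<zeta>, if not at \<zeta> itself.\<close>

proposition ex_test_functions_nonpos_transform:
  fixes a :: "'a::euclidean_space \<Rightarrow> complex"
  assumes a: "integrable lborel a" and nonpos: "\<And>\<xi>. Re (ft a \<xi>) \<le> 0" and neg: "Re (ft a \<zeta>) < 0"
    and \<rho>: "\<rho> > 0"
  shows "\<exists>\<eta> :: nat \<Rightarrow> 'a \<Rightarrow> complex. (\<forall>j. C_c (\<eta> j) \<and> (\<forall>x. x \<notin> ball x\<^sub>0 \<rho> \<longrightarrow> \<eta> j x = 0)) \<and>
    (\<forall>N c. (\<exists>j\<le>N. c j \<noteq> 0) \<longrightarrow> Re (LINT z|lborel. a z * autocorr (\<lambda>x. \<Sum>j\<le>N. c j *\<^sub>R \<eta> j x) z) < 0)"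
proof -
  \<comment> \<open>The first bound keeps the tents inside the ball of radius \<rho>; the second
    keeps the tent transform free of zeros at frequencies within distance 1 of \<zeta>.\<close>
  define \<sigma> where "\<sigma> = min (\<rho> / 2) (1 / (norm \<zeta> + 1))"
  have n0: "0 < norm \<zeta> + 1" by (simp add: add_nonneg_pos)
  have \<sigma>: "\<sigma> > 0" "\<sigma> \<le> \<rho> / 2" "(norm \<zeta> + 1) * \<sigma> \<le> 1"
  proof -
    show "\<sigma> > 0" "\<sigma> \<le> \<rho> / 2" using \<rho> n0 by (auto simp: \<sigma>_def)
    have "(norm \<zeta> + 1) * \<sigma> \<le> (norm \<zeta> + 1) * (1 / (norm \<zeta> + 1))"
      using n0 by (intro mult_left_mono) (auto simp: \<sigma>_def)
    then show "(norm \<zeta> + 1) * \<sigma> \<le> 1" using n0 by simp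
  qed
  obtain b :: 'a where b: "b \<in> Basis" using nonempty_Basis by blast
  \<comment> \<open>Distinct centres on a segment, close enough to \<open>x\<^sub>0\<close> to leave
    room for tents of radius \<open>\<rho> / 2\<close>.\<close>
  define p where "p j = x\<^sub>0 + (\<rho> / 2 / real (Suc j)) *\<^sub>R b" for j :: nat
  have inj_p: "inj p"
    using \<rho> b nonzero_Basis[OF b] by (auto simp: p_def inj_def)
  have near_p: "norm (p j - x\<^sub>0) \<le> \<rho> / 2" for j
  proof -
    have "\<rho> / 2 / real (Suc j) \<le> \<rho> / 2 / 1" using \<rho> by (intro divide_left_mono) auto
    then show ?thesis using b \<rho> by (simp add: p_def)
  qed
  have supp: "tent \<sigma> (p j) x = 0" if "x \<notin> ball x\<^sub>0 \<rho>" for j x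
  proof -
    have "\<rho> \<le> norm (x - p j) + norm (p j - x\<^sub>0)"
      using that norm_triangle_ineq[of "x - p j" "p j - x\<^sub>0"] by (simp add: dist_norm norm_minus_commute)
    then show ?thesis using near_p[of j] \<sigma>(2) by (simp add: tent_def)
  qed
  have "Re (LINT z|lborel. a z * autocorr (\<lambda>x. \<Sum>j\<le>N. c j *\<^sub>R tent \<sigma> (p j) x) z) < 0"
    if c: "\<exists>j\<le>N. c j \<noteq> 0" for N c
  proof -
    define f where "f x = (\<Sum>j\<le>N. c j *\<^sub>R tent \<sigma> (p j) x)" for x
    have f: "C_c f" unfolding f_def[abs_def] by (intro C_c_sum C_c_scaleR C_c_tent)
    have ft_f: "ft f \<xi> = ft (tent \<sigma> 0) \<xi> * (\<Sum>j\<le>N. complex_of_real (c j) * cis (- (\<xi> \<bullet> p j)))" for \<xi>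
    proof -
      have "ft f \<xi> = (LINT y|lborel. (\<Sum>j\<le>N. c j *\<^sub>R (tent \<sigma> (p j) y * cis (- (\<xi> \<bullet> y)))))"
        by (simp add: ft_def f_def sum_distrib_right)
      also have "\<dots> = (\<Sum>j\<le>N. c j *\<^sub>R ft (tent \<sigma> (p j)) \<xi>)"
        unfolding ft_def
        by (subst Bochner_Integration.integral_sum)
           (auto intro!: integrable_mult_cis C_c_integrable[OF C_c_tent] integrable_scaleR_right)
      finally show ?thesis
        by (simp add: ft_tent_shift[of \<sigma> "p _"] sum_distrib_left scaleR_conv_of_real mult_ac)
    qed
    have "continuous_on UNIV (\<lambda>\<xi>. Re (ft a \<xi>))"
      by (intro continuous_intros continuous_on_ft[OF a])
    then have "open {\<xi>. Re (ft a \<xi>) < 0}" by (rule open_Collect_less[OF _ continuous_on_const])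
    then obtain \<epsilon> where \<epsilon>: "\<epsilon> > 0" "ball \<zeta> \<epsilon> \<subseteq> {\<xi>. Re (ft a \<xi>) < 0}"
      using neg unfolding open_contains_ball by blast
    \<comment> \<open>Within \<epsilon> the transform of \<open>a\<close> stays negative, within 1
      that of the tent stays nonzero.\<close>
    define \<delta> where "\<delta> = min \<epsilon> 1"
    have \<delta>: "\<delta> > 0" using \<epsilon> by (simp add: \<delta>_def)
    have "\<exists>\<xi>\<in>ball \<zeta> \<delta>. (\<Sum>j\<le>N. complex_of_real (c j) * cis (- (\<xi> \<bullet> p j))) \<noteq> 0"
    proof (rule ccontr)
      assume "\<not> ?thesis"
      then have z: "(\<Sum>j\<le>N. complex_of_real (c j) * cis (- (\<xi> \<bullet> p j))) = 0" if "\<xi> \<in> ball \<zeta> \<delta>" for \<xi>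
        using that by blast
      have inj: "inj_on (\<lambda>j. - p j) {..N}" using inj_p by (auto simp: inj_on_def inj_def)
      define d where "d \<theta> = complex_of_real (c (inv p (- \<theta>)))" for \<theta>
      have d: "d (- p j) = complex_of_real (c j)" for j using inj_p by (simp add: d_def)
      have "\<forall>\<theta>\<in>(\<lambda>j. - p j) ` {..N}. d \<theta> = 0"
      proof (rule exponentials_independent[OF _ \<delta>])
        fix x assume "x \<in> ball \<zeta> \<delta>"
        then show "(\<Sum>\<theta>\<in>(\<lambda>j. - p j) ` {..N}. d \<theta> * cis (\<theta> \<bullet> x)) = 0"
          using z[of x] by (simp add: sum.reindex[OF inj] d inner_commute)
      qed simp
      then show False using c d by auto
    qed
    then obtain \<xi> where \<xi>: "\<xi> \<in> ball \<zeta> \<delta>" "(\<Sum>j\<le>N. complex_of_real (c j) * cis (- (\<xi> \<bullet> p j))) \<noteq> 0" by blast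
    have "norm \<xi> \<le> norm \<zeta> + 1"
      using \<xi>(1) norm_triangle_sub[of \<xi> \<zeta>] by (simp add: \<delta>_def dist_norm norm_minus_commute)
    then have "norm \<xi> * \<sigma> \<le> (norm \<zeta> + 1) * \<sigma>" using \<sigma>(1) by (intro mult_right_mono) auto
    then have "norm \<xi> * \<sigma> \<le> 1" using \<sigma>(3) by linarith
    then have "ft (tent \<sigma> 0) \<xi> \<noteq> 0" by (rule ft_tent_nonzero[OF \<sigma>(1)])
    then have "ft f \<xi> \<noteq> 0" using \<xi>(2) by (simp add: ft_f)
    moreover have "Re (ft a \<xi>) < 0" using \<xi>(1) \<epsilon>(2) by (auto simp: \<delta>_def)
    ultimately have "Re (LINT z|lborel. a z * autocorr f z) < 0"
      using C_c_form_neg[OF a nonpos f] by blast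
    then show ?thesis by (simp add: f_def[abs_def])
  qed
  then show ?thesis
    by (intro exI[of _ "\<lambda>j. tent \<sigma> (p j)"]) (use supp C_c_tent in blast)
qed

section \<open>Trigonometric polynomials on a cube\<close>

text \<open>For positive \<open>r\<close> this is the lattice dual to the periods
  \<open>2 * r\<close> in the coordinate directions.\<close>

definition lattice_freqs :: "real \<Rightarrow> 'a::euclidean_space set" where
  "lattice_freqs r = {\<omega>. \<forall>b\<in>Basis. \<exists>k::int. \<omega> \<bullet> b = pi / r * of_int k}"

lemma lattice_freqs_zero: "0 \<in> lattice_freqs r"
  by (auto simp: lattice_freqs_def intro: exI[of _ 0])

lemma lattice_freqs_add: "\<omega> \<in> lattice_freqs r \<Longrightarrow> \<omega>' \<in> lattice_freqs r \<Longrightarrow> \<omega> + \<omega>' \<in> lattice_freqs r"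
  unfolding lattice_freqs_def mem_Collect_eq inner_add_left by (metis distrib_left of_int_add)

lemma lattice_freqs_uminus: "\<omega> \<in> lattice_freqs r \<Longrightarrow> - \<omega> \<in> lattice_freqs r"
  unfolding lattice_freqs_def mem_Collect_eq inner_minus_left by (metis mult_minus_right of_int_minus)

lemma lattice_freqs_diff: "\<omega> \<in> lattice_freqs r \<Longrightarrow> \<omega>' \<in> lattice_freqs r \<Longrightarrow> \<omega> - \<omega>' \<in> lattice_freqs r"
  using lattice_freqs_add[OF _ lattice_freqs_uminus] by fastforce

definition trig_poly :: "real \<Rightarrow> ('a::euclidean_space \<Rightarrow> complex) \<Rightarrow> bool" where
  "trig_poly r p \<longleftrightarrow> (\<exists>X (q :: 'a \<Rightarrow> complex). finite X \<and> X \<subseteq> lattice_freqs r \<and> p = (\<lambda>x. \<Sum>\<omega>\<in>X. q \<omega> * cis (\<omega> \<bullet> x)))"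

lemma trig_poly_monomial: "\<omega> \<in> lattice_freqs r \<Longrightarrow> trig_poly r (\<lambda>x. (c :: complex) * cis (\<omega> \<bullet> x))"
  unfolding trig_poly_def by (intro exI[of _ "{\<omega>}"] exI[of _ "\<lambda>_. c"]) auto

lemma trig_poly_const: "trig_poly r (\<lambda>_. c)"
  using trig_poly_monomial[OF lattice_freqs_zero, of r c] by simp

lemma trig_poly_add:
  assumes "trig_poly r p" "trig_poly r p'"
  shows "trig_poly r (\<lambda>x. p x + p' x)"
proof -
  obtain X q Y q' where X: "finite X" "X \<subseteq> lattice_freqs r" "p = (\<lambda>x. \<Sum>\<omega>\<in>X. q \<omega> * cis (\<omega> \<bullet> x))"
    and Y: "finite Y" "Y \<subseteq> lattice_freqs r" "p' = (\<lambda>x. \<Sum>\<omega>\<in>Y. q' \<omega> * cis (\<omega> \<bullet> x))"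
    using assms unfolding trig_poly_def by blast
  define s where "s \<omega> = (if \<omega> \<in> X then q \<omega> else 0) + (if \<omega> \<in> Y then q' \<omega> else 0)" for \<omega>
  have "p x + p' x = (\<Sum>\<omega>\<in>X \<union> Y. s \<omega> * cis (\<omega> \<bullet> x))" for x
  proof -
    have "p x = (\<Sum>\<omega>\<in>X \<union> Y. (if \<omega> \<in> X then q \<omega> else 0) * cis (\<omega> \<bullet> x))"
      unfolding X(3) using X(1) Y(1) by (intro sum.mono_neutral_cong_left) auto
    moreover have "p' x = (\<Sum>\<omega>\<in>X \<union> Y. (if \<omega> \<in> Y then q' \<omega> else 0) * cis (\<omega> \<bullet> x))"
      unfolding Y(3) using X(1) Y(1) by (intro sum.mono_neutral_cong_left) auto
    ultimately show ?thesis by (simp add: s_def distrib_right sum.distrib)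
  qed
  then show ?thesis
    unfolding trig_poly_def using X Y by (intro exI[of _ "X \<union> Y"] exI[of _ s]) auto
qed

lemma trig_poly_sum: "(\<And>i. i \<in> I \<Longrightarrow> trig_poly r (p i)) \<Longrightarrow> trig_poly r (\<lambda>x. \<Sum>i\<in>I. p i x)"
  by (induction I rule: infinite_finite_induct) (auto intro: trig_poly_const trig_poly_add)

lemma trig_poly_mult:
  assumes "trig_poly r p" "trig_poly r p'"
  shows "trig_poly r (\<lambda>x. p x * p' x)"
proof -
  obtain X q Y q' where X: "finite X" "X \<subseteq> lattice_freqs r" "p = (\<lambda>x. \<Sum>\<omega>\<in>X. q \<omega> * cis (\<omega> \<bullet> x))"
    and Y: "finite Y" "Y \<subseteq> lattice_freqs r" "p' = (\<lambda>x. \<Sum>\<omega>\<in>Y. q' \<omega> * cis (\<omega> \<bullet> x))"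
    using assms unfolding trig_poly_def by blast
  have "p x * p' x = (\<Sum>\<omega>\<in>X. \<Sum>\<omega>'\<in>Y. q \<omega> * q' \<omega>' * cis ((\<omega> + \<omega>') \<bullet> x))" for x
    unfolding X(3) Y(3) sum_product
    by (intro sum.cong refl) (simp add: inner_add_left cis_mult[symmetric] mult_ac)
  then show ?thesis
    using X(2) Y(2) by (auto intro!: trig_poly_sum trig_poly_monomial lattice_freqs_add)
qed

lemma trig_poly_bounded:
  assumes "trig_poly r p"
  obtains B where "B > 0" "\<And>x. cmod (p x) \<le> B"
proof -
  obtain X q where X: "p = (\<lambda>x. \<Sum>\<omega>\<in>X. q \<omega> * cis (\<omega> \<bullet> x))"
    using assms unfolding trig_poly_def by blast
  have "cmod (p x) \<le> (\<Sum>\<omega>\<in>X. cmod (q \<omega>)) + 1" for x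
    unfolding X using norm_sum[of "\<lambda>\<omega>. q \<omega> * cis (\<omega> \<bullet> x)" X] by (simp add: norm_mult)
  moreover have "(\<Sum>\<omega>\<in>X. cmod (q \<omega>)) + 1 > 0" by (simp add: sum_nonneg add_nonneg_pos)
  ultimately show thesis using that by blast
qed

lemma trig_poly_measurable: "trig_poly r p \<Longrightarrow> p \<in> borel_measurable borel"
  unfolding trig_poly_def by (auto intro!: borel_measurable_sum)

text \<open>The uniform closure of the trigonometric polynomials: for positive \<open>r\<close>, the
  continuous functions of period \<open>2 * r\<close> in each coordinate.\<close>

definition trig_approx :: "real \<Rightarrow> ('a::euclidean_space \<Rightarrow> complex) \<Rightarrow> bool" where
  "trig_approx r f \<longleftrightarrow> (\<forall>e>0. \<exists>p. trig_poly r p \<and> (\<forall>x. cmod (f x - p x) < e))"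

lemma trig_approx_poly: "trig_poly r p \<Longrightarrow> trig_approx r p"
  unfolding trig_approx_def by (auto intro!: exI[of _ p])

lemma trig_approx_bounded:
  assumes "trig_approx r f"
  obtains B where "B > 0" "\<And>x. cmod (f x) \<le> B"
proof -
  obtain p where p: "trig_poly r p" "\<And>x. cmod (f x - p x) < 1"
    using assms unfolding trig_approx_def by (meson zero_less_one)
  obtain B where B: "B > 0" "\<And>x. cmod (p x) \<le> B" using trig_poly_bounded[OF p(1)] by blast
  have "cmod (f x) \<le> B + 1" for x
    using norm_triangle_sub[of "f x" "p x"] p(2)[of x] B(2)[of x] by linarith
  then show thesis using that[of "B + 1"] B(1) by simp
qed

lemma trig_approx_mult:
  assumes f: "trig_approx r f" and g: "trig_approx r g"
  shows "trig_approx r (\<lambda>x. f x * g x)"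
  unfolding trig_approx_def
proof (intro allI impI)
  fix e :: real assume e: "e > 0"
  obtain B where B: "B > 0" "\<And>x. cmod (f x) \<le> B" using trig_approx_bounded[OF f] by blast
  \<comment> \<open>The factor \<open>g\<close> is approximated first, since the tolerance for
    \<open>f\<close> depends on a bound of the polynomial \<open>q\<close>.\<close>
  have "e / (2 * B) > 0" using e B by simp
  then obtain q where q: "trig_poly r q" "\<And>x. cmod (g x - q x) < e / (2 * B)"
    using g unfolding trig_approx_def by blast
  obtain C where C: "C > 0" "\<And>x. cmod (q x) \<le> C" using trig_poly_bounded[OF q(1)] by blast
  have "e / (2 * C) > 0" using e C by simp
  then obtain p where p: "trig_poly r p" "\<And>x. cmod (f x - p x) < e / (2 * C)"
    using f unfolding trig_approx_def by blast
  have "cmod (f x * g x - p x * q x) < e" for x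
  proof -
    have "f x * g x - p x * q x = f x * (g x - q x) + (f x - p x) * q x" by (simp add: algebra_simps)
    also have "cmod \<dots> \<le> cmod (f x) * cmod (g x - q x) + cmod (f x - p x) * cmod (q x)"
      by (intro order_trans[OF norm_triangle_ineq]) (simp add: norm_mult)
    also have "\<dots> \<le> B * cmod (g x - q x) + cmod (f x - p x) * C"
      using B(2) C(2) by (intro add_mono mult_right_mono mult_left_mono) auto
    also have "\<dots> < B * (e / (2 * B)) + e / (2 * C) * C"
      using q(2)[of x] p(2)[of x] B(1) C(1) by (intro add_strict_mono mult_strict_left_mono mult_strict_right_mono) auto
    also have "\<dots> = e" using B(1) C(1) by simp
    finally show ?thesis .
  qed
  then show "\<exists>s. trig_poly r s \<and> (\<forall>x. cmod (f x * g x - s x) < e)"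
    using trig_poly_mult[OF p(1) q(1)] by blast
qed

lemma trig_approx_prod:
  "(\<And>i. i \<in> I \<Longrightarrow> trig_approx r (f i)) \<Longrightarrow> trig_approx r (\<lambda>x. \<Prod>i\<in>I. f i x)"
  by (induction I rule: infinite_finite_induct)
     (auto intro: trig_approx_poly trig_poly_const trig_approx_mult)

text \<open>Trigonometric polynomials form an algebra, so in the induction over \<open>g\<close>
  only the linear case has content, and there it is Euler's formula for the cosine.\<close>

lemma trig_poly_polynomial_cos:
  assumes "real_polynomial_function g" and b: "b \<in> Basis"
  shows "trig_poly r (\<lambda>x. complex_of_real (g (cos (pi / r * (x \<bullet> b - s)))))"
  using assms(1)
proof induction
  case (linear f)
  interpret bounded_linear f by fact
  have f_eq: "f t = t * f 1" for t using scaleR[of t 1] by simp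
  let ?\<omega> = "(pi / r) *\<^sub>R b"
  have \<omega>: "?\<omega> \<in> lattice_freqs r"
    unfolding lattice_freqs_def
  proof (safe)
    fix b' :: 'a assume "b' \<in> Basis"
    then show "\<exists>k::int. ?\<omega> \<bullet> b' = pi / r * of_int k"
      using b by (intro exI[of _ "if b = b' then 1 else 0"]) (simp add: inner_Basis)
  qed
  have eq: "complex_of_real (f (cos (pi / r * (x \<bullet> b - s))))
      = f 1 / 2 * cis (- (pi / r * s)) * cis (?\<omega> \<bullet> x) + f 1 / 2 * cis (pi / r * s) * cis ((- ?\<omega>) \<bullet> x)" for x
  proof -
    let ?t = "pi / r * (x \<bullet> b - s)"
    have "cis (- (pi / r * s)) * cis (?\<omega> \<bullet> x) = cis ?t" "cis (pi / r * s) * cis ((- ?\<omega>) \<bullet> x) = cis (- ?t)"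
      by (simp_all add: cis_mult inner_commute algebra_simps)
    moreover have "complex_of_real (f (cos ?t)) = f 1 / 2 * cis ?t + f 1 / 2 * cis (- ?t)"
      by (subst f_eq) (simp add: complex_eq_iff)
    ultimately show ?thesis by (simp only: mult.assoc)
  qed
  show ?case
    unfolding eq by (intro trig_poly_add trig_poly_monomial lattice_freqs_uminus \<omega>)
qed (auto intro: trig_poly_const trig_poly_add trig_poly_mult)

text \<open>Weierstrass approximation of the positive part on [-1, 1], composed with the
  cosine.\<close>

lemma trig_approx_max_cos:
  assumes b: "b \<in> Basis"
  shows "trig_approx r (\<lambda>x. complex_of_real (max 0 (cos (pi / r * (x \<bullet> b - s)))))"
  unfolding trig_approx_def
proof (intro allI impI)
  fix e :: real assume e: "e > 0"
  have "continuous_on {-1..1::real} (\<lambda>t. max 0 t)" by (intro continuous_intros)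
  then obtain g where g: "real_polynomial_function g" "\<And>t. t \<in> {-1..1} \<Longrightarrow> \<bar>max 0 t - g t\<bar> < e"
    using Stone_Weierstrass_real_polynomial_function[OF compact_Icc _ e] by metis
  have "cmod (complex_of_real (max 0 (cos t)) - complex_of_real (g (cos t))) < e" for t
    using g(2)[of "cos t"] by (simp flip: of_real_diff)
  then show "\<exists>p. trig_poly r p \<and> (\<forall>x. cmod (complex_of_real (max 0 (cos (pi / r * (x \<bullet> b - s)))) - p x) < e)"
    using trig_poly_polynomial_cos[OF g(1) b, of r s] by blast
qed

section \<open>Parseval's formula on a period cell\<close>

locale cube_form =
  fixes r :: real and x\<^sub>0 :: "'a::euclidean_space"
  assumes r: "r > 0"
begin

text \<open>\<open>T\<close> is a period cell around \<open>x\<^sub>0\<close>;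
  \<open>supp_cube\<close>, of half its side, carries the test functions; \<open>Q\<close> consists
  of the differences of points of \<open>supp_cube\<close>.\<close>

definition T :: "'a set" where "T = {y. \<forall>b\<in>Basis. \<bar>y \<bullet> b - x\<^sub>0 \<bullet> b\<bar> \<le> r}"
definition Q :: "'a set" where "Q = {z. \<forall>b\<in>Basis. \<bar>z \<bullet> b\<bar> < r}"
definition supp_cube :: "'a set" where "supp_cube = {y. \<forall>b\<in>Basis. \<bar>y \<bullet> b - x\<^sub>0 \<bullet> b\<bar> < r / 2}"

lemma T_eq: "T = cbox (x\<^sub>0 - r *\<^sub>R One) (x\<^sub>0 + r *\<^sub>R One)"
  by (auto simp: T_def cbox_def inner_diff_left inner_add_left abs_le_iff algebra_simps)

lemma Q_eq: "Q = box (- (r *\<^sub>R One)) (r *\<^sub>R One)"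
  by (auto simp: Q_def box_def abs_less_iff algebra_simps)

lemma supp_cube_eq: "supp_cube = box (x\<^sub>0 - (r / 2) *\<^sub>R One) (x\<^sub>0 + (r / 2) *\<^sub>R One)"
proof -
  have "\<bar>u - v\<bar> < r / 2 \<longleftrightarrow> v - r / 2 < u \<and> u < v + r / 2" for u v :: real by linarith
  then show ?thesis by (simp add: supp_cube_def box_def inner_diff_left inner_add_left)
qed

lemma sets_T [measurable]: "T \<in> sets borel" and sets_Q [measurable]: "Q \<in> sets borel"
  by (simp_all add: T_eq Q_eq)

lemma integrable_indicator_T: "integrable lborel (\<lambda>y. B * indicator T y :: real)"
  by (intro integrable_mult_right integrable_real_indicator) (auto simp: T_eq emeasure_lborel_cbox_eq)

lemma integrable_on_T:
  fixes f :: "'a \<Rightarrow> complex"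
  assumes [measurable]: "f \<in> borel_measurable borel" and B: "\<And>x. cmod (f x) \<le> B"
  shows "integrable lborel (\<lambda>y. indicator T y * f y)"
proof (rule Bochner_Integration.integrable_bound[OF integrable_indicator_T[of B]])
  show "AE y in lborel. norm (indicator T y * f y) \<le> norm (B * indicator T y :: real)"
    using B by (auto simp: indicator_def intro: order_trans[OF _ abs_ge_self])
qed measurable

lemma integral_cis_interval:
  fixes k :: int and s :: real
  shows "integrable lborel (\<lambda>t. indicator {s - r..s + r} t * cis (pi / r * of_int k * t))"
    and "(LINT t|lborel. indicator {s - r..s + r} t * cis (pi / r * of_int k * t)) = (if k = 0 then 2 * r else 0)"
proof -
  show "integrable lborel (\<lambda>t. indicator {s - r..s + r} t * cis (pi / r * of_int k * t))"
  proof (rule Bochner_Integration.integrable_bound)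
    show "integrable lborel (\<lambda>t. indicator {s - r..s + r} t :: real)"
      by (intro integrable_real_indicator) (auto simp: emeasure_lborel_Icc_eq)
  qed (auto simp: norm_mult indicator_def)
  show "(LINT t|lborel. indicator {s - r..s + r} t * cis (pi / r * of_int k * t)) = (if k = 0 then 2 * r else 0)"
  proof (cases "k = 0")
    case True
    have "(LINT t|lborel. complex_of_real (indicator {s - r..s + r} t)) = 2 * r"
      using r by (subst integral_complex_of_real) simp
    moreover have "complex_of_real (indicator {s - r..s + r} t) = indicator {s - r..s + r} t" for t
      by (simp add: indicator_def)
    ultimately show ?thesis using True by simp
  next
    case False
    define m where "m = pi / r * of_int k"
    have m: "m \<noteq> 0" using False r by (simp add: m_def)
    have deriv: "((\<lambda>t. - \<i> / of_real m * cis (m * t)) has_vector_derivative cis (m * t)) (at t within A)" for t A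
      unfolding cis_conv_exp using m
      by (auto intro!: derivative_eq_intros has_vector_derivative_real_field simp: field_simps)
    have "(LINT t|lborel. indicator {s - r..s + r} t *\<^sub>R cis (m * t))
        = - \<i> / of_real m * cis (m * (s + r)) - (- \<i> / of_real m * cis (m * (s - r)))"
      using r by (intro integral_FTC_Icc deriv continuous_intros) auto
    also have "cis (m * (s + r)) = cis (m * (s - r))"
    proof -
      have "m * (s + r) = m * (s - r) + 2 * pi * of_int k" using r by (simp add: m_def field_simps)
      then show ?thesis by (simp add: cis_mult[symmetric] cis_multiple_2pi)
    qed
    finally have "(LINT t|lborel. indicator {s - r..s + r} t *\<^sub>R cis (m * t)) = 0" by simp
    moreover have "(\<lambda>t. indicator {s - r..s + r} t *\<^sub>R cis (m * t)) = (\<lambda>t. indicator {s - r..s + r} t * cis (m * t))"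
      by (auto simp: indicator_def fun_eq_iff)
    ultimately show ?thesis using False by (simp only: m_def if_False of_real_0)
  qed
qed

text \<open>Orthogonality of the exponentials: the integral factorizes over the coordinates, and a
  coordinate with nonzero \<open>k b\<close> runs through full periods.\<close>

lemma integral_T_cis:
  assumes \<omega>: "\<omega> \<in> lattice_freqs r"
  shows "(LINT y|lborel. indicator T y * cis (\<omega> \<bullet> y)) = (if \<omega> = 0 then (2 * r) ^ DIM('a) else 0)"
proof -
  obtain k where k: "\<And>b. b \<in> Basis \<Longrightarrow> \<omega> \<bullet> b = pi / r * of_int (k b :: int)"
    using \<omega> unfolding lattice_freqs_def by (auto dest!: bchoice)
  define f where "f b t = indicator {x\<^sub>0 \<bullet> b - r..x\<^sub>0 \<bullet> b + r} t * cis (pi / r * of_int (k b) * t)" for b :: 'a and t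
  have "indicator T y * cis (\<omega> \<bullet> y) = (\<Prod>b\<in>Basis. f b (y \<bullet> b))" for y
  proof -
    have "(\<Prod>b\<in>Basis. indicator {x\<^sub>0 \<bullet> b - r..x\<^sub>0 \<bullet> b + r} (y \<bullet> b) :: complex) = indicator T y"
    proof (cases "y \<in> T")
      case True
      then show ?thesis by (auto simp: T_def abs_le_iff indicator_def algebra_simps intro!: prod.neutral)
    next
      case False
      then obtain b where "b \<in> Basis" "y \<bullet> b \<notin> {x\<^sub>0 \<bullet> b - r..x\<^sub>0 \<bullet> b + r}"
        by (auto simp: T_def abs_le_iff algebra_simps)
      then show ?thesis using False by (auto intro!: prod_zero bexI[of _ b])
    qed
    moreover have "cis (\<omega> \<bullet> y) = (\<Prod>b\<in>Basis. cis (pi / r * of_int (k b) * (y \<bullet> b)))"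
    proof -
      have "\<omega> \<bullet> y = (\<Sum>b\<in>Basis. pi / r * of_int (k b) * (y \<bullet> b))"
        by (subst euclidean_inner) (simp add: k)
      then show ?thesis by (simp only: cis_conv_exp of_real_sum sum_distrib_left exp_sum finite_Basis)
    qed
    ultimately show ?thesis unfolding f_def prod.distrib by simp
  qed
  then have "(LINT y|lborel. indicator T y * cis (\<omega> \<bullet> y)) = (LINT y|lborel. (\<Prod>b\<in>Basis. f b (y \<bullet> b)))"
    by (simp only:)
  also have "\<dots> = (\<Prod>b\<in>Basis. LINT t|lborel. f b t)"
    by (rule integral_lborel_prod) (simp only: f_def integral_cis_interval(1))
  also have "\<dots> = (\<Prod>b\<in>Basis. if k b = 0 then 2 * r else 0)"
    by (simp only: f_def integral_cis_interval(2) of_real_prod)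
  also have "\<dots> = (if \<omega> = 0 then (2 * r) ^ DIM('a) else 0)"
  proof (cases "\<omega> = 0")
    case True
    then have "k b = 0" if "b \<in> Basis" for b using k[OF that] r by simp
    then show ?thesis using True by simp
  next
    case False
    then obtain b where "b \<in> Basis" "\<omega> \<bullet> b \<noteq> 0" by (auto simp: euclidean_eq_iff[of \<omega> 0])
    then have "k b \<noteq> 0" using k by auto
    then show ?thesis using False \<open>b \<in> Basis\<close> by (auto intro!: prod_zero bexI[of _ b])
  qed
  finally show ?thesis .
qed

text \<open>Only \<open>y\<close> is confined to the cell, while \<open>y + z\<close> may leave it.
  For a periodic function this is the autocorrelation on the torus.\<close>

definition per_autocorr :: "('a \<Rightarrow> complex) \<Rightarrow> 'a \<Rightarrow> complex" where
  "per_autocorr F z = (LINT y|lborel. indicator T y * (F y * cnj (F (y + z))))"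

definition fourier_coeff :: "('a \<Rightarrow> complex) \<Rightarrow> 'a \<Rightarrow> complex" where
  "fourier_coeff F \<omega> = (LINT y|lborel. indicator T y * (F y * cis (- (\<omega> \<bullet> y))))"

text \<open>Orthogonality leaves only the diagonal of the double sum; the first formula is
  Parseval's, with a translation by \<open>z\<close>.\<close>

lemma trig_sum_integrals:
  fixes q :: "'a \<Rightarrow> complex"
  assumes X: "finite X" "X \<subseteq> lattice_freqs r" and p: "p = (\<lambda>x. \<Sum>\<omega>\<in>X. q \<omega> * cis (\<omega> \<bullet> x))"
  shows "per_autocorr p z = (2 * r) ^ DIM('a) * (\<Sum>\<omega>\<in>X. complex_of_real ((cmod (q \<omega>))\<^sup>2) * cis (- (\<omega> \<bullet> z)))"
    and "\<omega> \<in> lattice_freqs r \<Longrightarrow> fourier_coeff p \<omega> = (2 * r) ^ DIM('a) * (if \<omega> \<in> X then q \<omega> else 0)"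
proof -
  have int: "integrable lborel (\<lambda>y. indicator T y * cis (\<omega> \<bullet> y))" for \<omega>
    by (rule integrable_on_T[of _ 1]) auto
  have "indicator T y * (p y * cnj (p (y + z)))
      = (\<Sum>\<omega>\<in>X. \<Sum>\<omega>'\<in>X. q \<omega> * cnj (q \<omega>') * cis (- (\<omega>' \<bullet> z)) * (indicator T y * cis ((\<omega> - \<omega>') \<bullet> y)))" for y
  proof -
    have "p y * cnj (p (y + z)) = (\<Sum>\<omega>\<in>X. \<Sum>\<omega>'\<in>X. (q \<omega> * cis (\<omega> \<bullet> y)) * cnj (q \<omega>' * cis (\<omega>' \<bullet> (y + z))))"
      by (simp only: p cnj_sum sum_product)
    moreover have "cis (- (\<omega>' \<bullet> z)) * cis ((\<omega> - \<omega>') \<bullet> y) = cis (\<omega> \<bullet> y) * cnj (cis (\<omega>' \<bullet> (y + z)))" for \<omega> \<omega>'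
      by (simp add: cis_cnj cis_mult inner_add_right inner_diff_left algebra_simps)
    ultimately show ?thesis
      by (simp only: sum_distrib_left) (intro sum.cong refl, simp add: mult_ac)
  qed
  then have "per_autocorr p z = (LINT y|lborel. (\<Sum>\<omega>\<in>X. \<Sum>\<omega>'\<in>X. q \<omega> * cnj (q \<omega>') * cis (- (\<omega>' \<bullet> z)) * (indicator T y * cis ((\<omega> - \<omega>') \<bullet> y))))"
    by (simp only: per_autocorr_def)
  also have "\<dots> = (\<Sum>\<omega>\<in>X. \<Sum>\<omega>'\<in>X. q \<omega> * cnj (q \<omega>') * cis (- (\<omega>' \<bullet> z)) * (LINT y|lborel. indicator T y * cis ((\<omega> - \<omega>') \<bullet> y)))"
    using int by (simp add: Bochner_Integration.integral_sum Bochner_Integration.integrable_sum)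
  also have "\<dots> = (\<Sum>\<omega>\<in>X. \<Sum>\<omega>'\<in>X. if \<omega>' = \<omega> then (2 * r) ^ DIM('a) * (q \<omega> * cnj (q \<omega>) * cis (- (\<omega> \<bullet> z))) else 0)"
    using X(2) by (intro sum.cong refl) (auto simp: integral_T_cis lattice_freqs_diff subset_iff)
  also have "\<dots> = (2 * r) ^ DIM('a) * (\<Sum>\<omega>\<in>X. complex_of_real ((cmod (q \<omega>))\<^sup>2) * cis (- (\<omega> \<bullet> z)))"
    using X(1) by (simp add: sum_distrib_left complex_norm_square del: of_real_power)
  finally show "per_autocorr p z = (2 * r) ^ DIM('a) * (\<Sum>\<omega>\<in>X. complex_of_real ((cmod (q \<omega>))\<^sup>2) * cis (- (\<omega> \<bullet> z)))" .
  assume \<omega>: "\<omega> \<in> lattice_freqs r"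
  have "indicator T y * (p y * cis (- (\<omega> \<bullet> y))) = (\<Sum>\<omega>'\<in>X. q \<omega>' * (indicator T y * cis ((\<omega>' - \<omega>) \<bullet> y)))" for y
    unfolding p sum_distrib_left sum_distrib_right
    by (intro sum.cong refl) (simp add: inner_diff_left cis_mult mult_ac)
  then have "fourier_coeff p \<omega> = (\<Sum>\<omega>'\<in>X. q \<omega>' * (LINT y|lborel. indicator T y * cis ((\<omega>' - \<omega>) \<bullet> y)))"
    using int by (simp add: fourier_coeff_def Bochner_Integration.integral_sum)
  also have "\<dots> = (\<Sum>\<omega>'\<in>X. if \<omega>' = \<omega> then (2 * r) ^ DIM('a) * q \<omega> else 0)"
    using X(2) \<omega> by (intro sum.cong refl) (auto simp: integral_T_cis lattice_freqs_diff subset_iff)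
  also have "\<dots> = (2 * r) ^ DIM('a) * (if \<omega> \<in> X then q \<omega> else 0)"
    using X(1) by simp
  finally show "fourier_coeff p \<omega> = (2 * r) ^ DIM('a) * (if \<omega> \<in> X then q \<omega> else 0)" .
qed

text \<open>Parseval's formula writes the form as a sum of nonpositive terms over the frequencies.
  Dropping all but one leaves a bound by a single Fourier coefficient, which passes to uniform
  limits, whereas a strict inequality would not.\<close>

lemma trig_poly_form_le:
  assumes a: "integrable lborel a" and nonpos: "\<And>\<omega>. \<omega> \<in> lattice_freqs r \<Longrightarrow> Re (ft a \<omega>) \<le> 0"
    and p: "trig_poly r p" and m: "m \<in> lattice_freqs r"
  shows "Re (LINT z|lborel. a z * per_autocorr p z) \<le> (cmod (fourier_coeff p m))\<^sup>2 / (2 * r) ^ DIM('a) * Re (ft a m)"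
proof -
  obtain X q where X: "finite X" "X \<subseteq> lattice_freqs r" "p = (\<lambda>x. \<Sum>\<omega>\<in>X. q \<omega> * cis (\<omega> \<bullet> x))"
    using p unfolding trig_poly_def by blast
  define D where "D = (2 * r) ^ DIM('a)"
  have D: "D > 0" using r by (simp add: D_def)
  have auto: "per_autocorr p z = D * (\<Sum>\<omega>\<in>X. complex_of_real ((cmod (q \<omega>))\<^sup>2) * cis (- (\<omega> \<bullet> z)))" for z
    using trig_sum_integrals(1)[OF X, of z] by (simp add: D_def)
  have coeff: "fourier_coeff p m = D * (if m \<in> X then q m else 0)"
    using trig_sum_integrals(2)[OF X m] by (simp add: D_def)
  have int: "integrable lborel (\<lambda>z. a z * cis (- (\<omega> \<bullet> z)))" for \<omega>
    by (rule integrable_mult_cis[OF a]) measurable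
  have "(LINT z|lborel. a z * per_autocorr p z)
      = (LINT z|lborel. (\<Sum>\<omega>\<in>X. complex_of_real (D * (cmod (q \<omega>))\<^sup>2) * (a z * cis (- (\<omega> \<bullet> z)))))"
    unfolding auto sum_distrib_left
    by (intro Bochner_Integration.integral_cong sum.cong refl) (simp add: mult_ac)
  also have "\<dots> = (\<Sum>\<omega>\<in>X. complex_of_real (D * (cmod (q \<omega>))\<^sup>2) * ft a \<omega>)"
    unfolding ft_def
    by (subst Bochner_Integration.integral_sum) (auto simp only: integral_mult_right_zero intro!: integrable_mult_right int)
  finally have "Re (LINT z|lborel. a z * per_autocorr p z) = (\<Sum>\<omega>\<in>X. D * (cmod (q \<omega>))\<^sup>2 * Re (ft a \<omega>))"
    by (simp del: of_real_mult)
  also have "\<dots> \<le> (\<Sum>\<omega>\<in>X. if \<omega> = m then D * (cmod (q m))\<^sup>2 * Re (ft a m) else 0)"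
  proof (rule sum_mono)
    fix \<omega> assume "\<omega> \<in> X"
    then have "Re (ft a \<omega>) \<le> 0" using nonpos X(2) by blast
    then show "D * (cmod (q \<omega>))\<^sup>2 * Re (ft a \<omega>) \<le> (if \<omega> = m then D * (cmod (q m))\<^sup>2 * Re (ft a m) else 0)"
      using D by (auto intro!: mult_nonneg_nonpos)
  qed
  \<comment> \<open>\<open>fourier_coeff\<close> carries the volume \<open>D\<close> of the cell, so
    its squared modulus over \<open>D\<close> is \<open>D * (cmod (q m))\<^sup>2\<close>.\<close>
  also have "\<dots> = (cmod (fourier_coeff p m))\<^sup>2 / D * Re (ft a m)"
    using X(1) D by (auto simp: coeff norm_mult power_mult_distrib power2_eq_square)
  finally show ?thesis by (simp add: D_def)
qed

text \<open>Both sides of the bound for the approximating polynomials converge by dominated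
  convergence, since the polynomials are bounded by \<open>B + 1\<close> throughout.\<close>

lemma trig_approx_form_le:
  assumes a: "integrable lborel a" and nonpos: "\<And>\<omega>. \<omega> \<in> lattice_freqs r \<Longrightarrow> Re (ft a \<omega>) \<le> 0"
    and F: "trig_approx r F" "F \<in> borel_measurable borel" and m: "m \<in> lattice_freqs r"
  shows "Re (LINT z|lborel. a z * per_autocorr F z) \<le> (cmod (fourier_coeff F m))\<^sup>2 / (2 * r) ^ DIM('a) * Re (ft a m)"
proof -
  have [measurable]: "a \<in> borel_measurable borel" using borel_measurable_integrable[OF a] by simp
  have [measurable]: "F \<in> borel_measurable borel" by (rule F(2))
  obtain B where B: "B > 0" "\<And>x. cmod (F x) \<le> B" using trig_approx_bounded[OF F(1)] by blast
  have "\<exists>p. trig_poly r p \<and> (\<forall>x. cmod (F x - p x) < inverse (real (Suc n)))" for n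
    using F(1) unfolding trig_approx_def by simp
  then obtain p where p: "\<And>n. trig_poly r (p n)" "\<And>n x. cmod (F x - p n x) < inverse (real (Suc n))" by metis
  have [measurable]: "p n \<in> borel_measurable borel" for n by (rule trig_poly_measurable[OF p(1)])
  have p_lim: "(\<lambda>n. p n x) \<longlonglongrightarrow> F x" for x
  proof -
    have "(\<lambda>n. cmod (F x - p n x)) \<longlonglongrightarrow> 0"
      using p(2) by (intro tendsto_sandwich[OF _ _ tendsto_const LIMSEQ_inverse_real_of_nat]) (auto intro!: always_eventually less_imp_le)
    then have "(\<lambda>n. F x - (F x - p n x)) \<longlonglongrightarrow> F x - 0"
      by (intro tendsto_diff tendsto_const) (simp add: tendsto_norm_zero_iff)
    then show ?thesis by simp
  qed
  have p_bound: "cmod (p n x) \<le> B + 1" for n x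
  proof -
    have "inverse (real (Suc n)) \<le> 1" by (simp add: inverse_le_1_iff)
    then show ?thesis
      using norm_triangle_sub[of "p n x" "F x"] p(2)[of x n] B(2)[of x] by (simp add: norm_minus_commute)
  qed
  define C where "C = (LINT y|lborel. (B + 1)\<^sup>2 * indicator T (y::'a))"
  have pp_bound: "cmod (indicator T y * (p n y * cnj (p n (y + z)))) \<le> (B + 1)\<^sup>2 * indicator T y" for n y z
    using mult_mono[OF p_bound[of n y] p_bound[of n "y + z"]] B(1)
    by (auto simp: indicator_def norm_mult power2_eq_square)
  have auto_lim: "(\<lambda>n. per_autocorr (p n) z) \<longlonglongrightarrow> per_autocorr F z" for z
    unfolding per_autocorr_def
  proof (rule integral_dominated_convergence[OF _ _ integrable_indicator_T[of "(B + 1)\<^sup>2"]])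
    show "AE y in lborel. (\<lambda>n. indicator T y * (p n y * cnj (p n (y + z)))) \<longlonglongrightarrow> indicator T y * (F y * cnj (F (y + z)))"
      by (intro AE_I2 tendsto_intros p_lim)
    show "AE y in lborel. norm (indicator T y * (p n y * cnj (p n (y + z)))) \<le> (B + 1)\<^sup>2 * indicator T y" for n
      by (intro AE_I2 pp_bound)
  qed measurable
  have auto_bound: "cmod (per_autocorr (p n) z) \<le> C" for n z
  proof -
    have "cmod (per_autocorr (p n) z) \<le> (LINT y|lborel. cmod (indicator T y * (p n y * cnj (p n (y + z)))))"
      unfolding per_autocorr_def by (rule integral_norm_bound)
    also have "\<dots> \<le> C"
      unfolding C_def using pp_bound by (intro integral_mono'[OF integrable_indicator_T]) auto
    finally show ?thesis .
  qed
  have coeff_lim: "(\<lambda>n. fourier_coeff (p n) m) \<longlonglongrightarrow> fourier_coeff F m"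
    unfolding fourier_coeff_def
  proof (rule integral_dominated_convergence[OF _ _ integrable_indicator_T[of "B + 1"]])
    show "AE y in lborel. (\<lambda>n. indicator T y * (p n y * cis (- (m \<bullet> y)))) \<longlonglongrightarrow> indicator T y * (F y * cis (- (m \<bullet> y)))"
      by (intro AE_I2 tendsto_intros p_lim)
    show "AE y in lborel. norm (indicator T y * (p n y * cis (- (m \<bullet> y)))) \<le> (B + 1) * indicator T y" for n
      using p_bound by (auto simp: indicator_def norm_mult)
  qed measurable
  have [measurable]: "(\<lambda>z. per_autocorr G z) \<in> borel_measurable borel" if [measurable]: "G \<in> borel_measurable borel" for G
    unfolding per_autocorr_def by measurable
  have form_lim: "(\<lambda>n. LINT z|lborel. a z * per_autocorr (p n) z) \<longlonglongrightarrow> (LINT z|lborel. a z * per_autocorr F z)"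
  proof (rule integral_dominated_convergence[where w = "\<lambda>z. cmod (a z) * C"])
    show "AE z in lborel. (\<lambda>n. a z * per_autocorr (p n) z) \<longlonglongrightarrow> a z * per_autocorr F z"
      by (intro AE_I2 tendsto_intros auto_lim)
    show "AE z in lborel. norm (a z * per_autocorr (p n) z) \<le> cmod (a z) * C" for n
      unfolding norm_mult by (intro AE_I2 mult_left_mono auto_bound) simp
  qed (use a in auto)
  show ?thesis
  proof (rule LIMSEQ_le)
    show "(\<lambda>n. Re (LINT z|lborel. a z * per_autocorr (p n) z)) \<longlonglongrightarrow> Re (LINT z|lborel. a z * per_autocorr F z)"
      by (intro tendsto_Re form_lim)
    show "(\<lambda>n. (cmod (fourier_coeff (p n) m))\<^sup>2 / (2 * r) ^ DIM('a) * Re (ft a m))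
        \<longlonglongrightarrow> (cmod (fourier_coeff F m))\<^sup>2 / (2 * r) ^ DIM('a) * Re (ft a m)"
      using r by (intro tendsto_intros coeff_lim) simp
  qed (use trig_poly_form_le[OF a nonpos p(1) m] in blast)
qed

end

section \<open>Test functions when the Fourier coefficients are non-positive\<close>

context cube_form
begin

text \<open>In each coordinate the cosine has period \<open>2 * r\<close> and is positive on half of
  it. Positive parts are taken factor by factor, since a product of two negative cosines would be
  positive again.\<close>

definition bump :: "'a \<Rightarrow> real" where
  "bump y = (\<Prod>b\<in>Basis. max 0 (cos (pi / r * (y \<bullet> b - x\<^sub>0 \<bullet> b))))"

lemma cos_scaled_pos: "\<bar>t\<bar> < r / 2 \<Longrightarrow> cos (pi / r * t) > 0"
proof -
  assume t: "\<bar>t\<bar> < r / 2"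
  have "\<bar>pi / r * t\<bar> = pi / r * \<bar>t\<bar>" using r by (simp add: abs_mult)
  also have "\<dots> < pi / r * (r / 2)" using t r by (intro mult_strict_left_mono) auto
  also have "\<dots> = pi / 2" using r by simp
  finally have "\<bar>pi / r * t\<bar> < pi / 2" .
  then show ?thesis by (intro cos_gt_zero_pi; linarith)
qed

lemma cos_scaled_nonpos: "r / 2 \<le> \<bar>t\<bar> \<Longrightarrow> \<bar>t\<bar> \<le> 3 / 2 * r \<Longrightarrow> cos (pi / r * t) \<le> 0"
proof -
  assume t: "r / 2 \<le> \<bar>t\<bar>" "\<bar>t\<bar> \<le> 3 / 2 * r"
  define s where "s = pi / r * \<bar>t\<bar>"
  have "pi / r * (r / 2) \<le> s" "s \<le> pi / r * (3 / 2 * r)"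
    unfolding s_def using t r by (intro mult_left_mono; simp)+
  then have s: "pi / 2 \<le> s" "s \<le> 3 / 2 * pi" using r by simp_all
  have "\<bar>pi / r * t\<bar> = s" using r by (simp add: s_def abs_mult)
  then have "cos (pi / r * t) = cos s" by (metis cos_abs_real)
  also have "\<dots> = - cos (s - pi)" by simp
  also have "\<dots> \<le> 0" using s cos_ge_zero[of "s - pi"] by simp
  finally show ?thesis .
qed

lemma bump_nonneg: "0 \<le> bump y"
  unfolding bump_def by (intro prod_nonneg) simp

lemma bump_le_1: "bump y \<le> 1"
  unfolding bump_def by (intro prod_le_1) auto

lemma bump_pos: "y \<in> supp_cube \<Longrightarrow> bump y > 0"
proof -
  assume y: "y \<in> supp_cube"
  have "0 < max 0 (cos (pi / r * (y \<bullet> b - x\<^sub>0 \<bullet> b)))" if "b \<in> Basis" for b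
    using y that unfolding supp_cube_def less_max_iff_disj by (intro disjI2 cos_scaled_pos) blast
  then show ?thesis unfolding bump_def by (intro prod_pos) blast
qed

text \<open>The range \<open>3 / 2 * r\<close> adds the half side \<open>r / 2\<close> of
  \<open>supp_cube\<close> to the half side \<open>r\<close> of \<open>Q\<close>. It covers every
  point reached from \<open>supp_cube\<close> by a vector of \<open>Q\<close>, and the next periodic
  copy of the support begins only beyond it.\<close>

lemma bump_eq_0:
  assumes "y \<notin> supp_cube" "\<And>b. b \<in> Basis \<Longrightarrow> \<bar>y \<bullet> b - x\<^sub>0 \<bullet> b\<bar> \<le> 3 / 2 * r"
  shows "bump y = 0"
proof -
  obtain b where b: "b \<in> Basis" "r / 2 \<le> \<bar>y \<bullet> b - x\<^sub>0 \<bullet> b\<bar>"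
    using assms(1) by (auto simp: supp_cube_def not_less)
  then have "cos (pi / r * (y \<bullet> b - x\<^sub>0 \<bullet> b)) \<le> 0" using assms(2) by (intro cos_scaled_nonpos) auto
  then show ?thesis unfolding bump_def using b(1) by (auto intro!: prod_zero bexI[of _ b])
qed

lemma supp_cube_subset_T: "supp_cube \<subseteq> T"
  using r by (fastforce simp: supp_cube_def T_def)

lemma open_supp_cube: "open supp_cube"
  unfolding supp_cube_eq by (rule open_box)

lemma ball_subset_supp_cube: "ball x\<^sub>0 (r / 2) \<subseteq> supp_cube"
proof
  fix y assume y: "y \<in> ball x\<^sub>0 (r / 2)"
  have "\<bar>y \<bullet> b - x\<^sub>0 \<bullet> b\<bar> < r / 2" if "b \<in> Basis" for b
    using Basis_le_norm[OF that, of "y - x\<^sub>0"] y by (simp add: inner_diff_left dist_norm norm_minus_commute)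
  then show "y \<in> supp_cube" by (simp add: supp_cube_def)
qed

lemma borel_measurable_bump [measurable]: "bump \<in> borel_measurable borel"
  unfolding bump_def[abs_def] by measurable

text \<open>There is no wrap-around: for \<open>y\<close> in the small cube and \<open>z\<close> in
  \<open>Q\<close>, the point \<open>y + z\<close> stays short of the next periodic copy of the
  support, so truncation to \<open>T\<close> does not affect the product. For \<open>z\<close>
  outside \<open>Q\<close> the supports of \<open>f\<close> and of its translate are disjoint. This
  reduces the kernel to its restriction to \<open>Q\<close>.\<close>

lemma autocorr_eq_per_autocorr:
  fixes h :: "'a \<Rightarrow> complex"
  defines "F \<equiv> \<lambda>x. complex_of_real (bump x) * h x"
  defines "f \<equiv> \<lambda>x. indicator T x * F x"
  shows "autocorr f z = indicator Q z * per_autocorr F z"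
proof (cases "z \<in> Q")
  case True
  have "f y * cnj (f (y + z)) = indicator T y * (F y * cnj (F (y + z)))" for y
  proof (cases "y \<in> supp_cube")
    case y: True
    have "F (y + z) = 0" if "y + z \<notin> T"
    proof -
      have "bump (y + z) = 0"
      proof (rule bump_eq_0)
        show "y + z \<notin> supp_cube" using that supp_cube_subset_T by blast
        fix b :: 'a assume b: "b \<in> Basis"
        then have "\<bar>y \<bullet> b - x\<^sub>0 \<bullet> b\<bar> < r / 2" "\<bar>z \<bullet> b\<bar> < r" using y True by (auto simp: supp_cube_def Q_def)
        then show "\<bar>(y + z) \<bullet> b - x\<^sub>0 \<bullet> b\<bar> \<le> 3 / 2 * r" unfolding inner_add_left by linarith
      qed
      then show ?thesis by (simp add: F_def)
    qed
    then show ?thesis by (auto simp: f_def indicator_def)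
  next
    case False
    then have "F y = 0" if "y \<in> T"
      using bump_eq_0[of y] that r by (force simp: F_def T_def)
    then show ?thesis by (auto simp: f_def indicator_def)
  qed
  then show ?thesis using True by (simp add: autocorr_def per_autocorr_def)
next
  case False
  then obtain b where b: "b \<in> Basis" "r \<le> \<bar>z \<bullet> b\<bar>" by (auto simp: Q_def not_less)
  have f0: "f y = 0" if "y \<notin> supp_cube" for y
    using bump_eq_0[OF that] r by (force simp: f_def F_def T_def indicator_def)
  have "f y * cnj (f (y + z)) = 0" for y
  proof (cases "y \<in> supp_cube \<and> y + z \<in> supp_cube")
    case True
    then have "\<bar>y \<bullet> b - x\<^sub>0 \<bullet> b\<bar> < r / 2" "\<bar>y \<bullet> b + z \<bullet> b - x\<^sub>0 \<bullet> b\<bar> < r / 2"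
      using b(1) by (auto simp: supp_cube_def inner_add_left)
    then show ?thesis using b(2) by linarith
  qed (use f0 in auto)
  then have "(\<lambda>y. f y * cnj (f (y + z))) = (\<lambda>_. 0)" by blast
  then show ?thesis using False by (simp add: autocorr_def)
qed

text \<open>The common interface of the two constructions of test functions.\<close>

definition bounded_on_cube :: "('a \<Rightarrow> complex) \<Rightarrow> bool" where
  "bounded_on_cube f \<longleftrightarrow> f \<in> borel_measurable borel \<and> (\<exists>B. \<forall>x. cmod (f x) \<le> B) \<and> (\<forall>x. x \<notin> supp_cube \<longrightarrow> f x = 0)"

lemma bounded_on_cube_integrable:
  assumes "bounded_on_cube f"
  shows "integrable lborel f" "square_integrable f"
proof -
  obtain B where f: "f \<in> borel_measurable borel" and B: "\<And>x. cmod (f x) \<le> B"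
    and supp: "\<And>x. x \<notin> supp_cube \<Longrightarrow> f x = 0"
    using assms by (auto simp: bounded_on_cube_def)
  have "(\<lambda>x. indicator T x * f x) = f"
    using supp supp_cube_subset_T by (auto simp: indicator_def fun_eq_iff)
  then show "integrable lborel f" using integrable_on_T[OF f B] by simp
  show "square_integrable f"
  proof (rule square_integrable_bound[OF f integrable_indicator_T[of "B\<^sup>2"]])
    show "(cmod (f x))\<^sup>2 \<le> B\<^sup>2 * indicator T x" for x
      using supp[of x] supp_cube_subset_T power_mono[OF B[of x], of 2] by (auto simp: indicator_def)
  qed
qed

lemma bounded_on_cube_combination:
  assumes "\<And>j. bounded_on_cube (\<eta> j)"
  shows "bounded_on_cube (\<lambda>x. \<Sum>j\<le>N. (c j :: real) *\<^sub>R \<eta> j x)"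
proof -
  have "\<exists>B. \<forall>x. cmod (\<eta> j x) \<le> B" for j using assms by (auto simp: bounded_on_cube_def)
  then obtain B where B: "\<And>j x. cmod (\<eta> j x) \<le> B j" by metis
  have "cmod (\<Sum>j\<le>N. c j *\<^sub>R \<eta> j x) \<le> (\<Sum>j\<le>N. \<bar>c j\<bar> * B j)" for x
    using B by (intro order_trans[OF norm_sum] sum_mono) (auto intro!: mult_left_mono)
  moreover have "(\<lambda>x. \<Sum>j\<le>N. c j *\<^sub>R \<eta> j x) \<in> borel_measurable borel"
    using assms by (intro borel_measurable_sum borel_measurable_scaleR) (auto simp: bounded_on_cube_def)
  ultimately show ?thesis
    using assms unfolding bounded_on_cube_def by (auto intro!: sum.neutral)
qed

text \<open>The test functions are exponentials at frequencies with strictly negative coefficients,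
  multiplied by the bump. Suppose that the Fourier coefficients of a combination
  \<open>F = bump * h\<close> vanished at all frequencies occurring in \<open>h\<close>. Pairing
  with \<open>h\<close> would make the integral of \<open>bump * |h|^2\<close> over the cell zero,
  so \<open>h\<close> would vanish on the cube, against the independence of exponentials. One
  nonvanishing coefficient makes the bound of \<open>trig_approx_form_le\<close> negative.\<close>

proposition ex_test_functions_nonpos_coeffs:
  assumes a: "integrable lborel a"
    and nonpos: "\<And>\<omega>. \<omega> \<in> lattice_freqs r \<Longrightarrow> Re (ft (\<lambda>z. indicator Q z * a z) \<omega>) \<le> 0"
    and inf: "infinite {\<omega> \<in> lattice_freqs r. Re (ft (\<lambda>z. indicator Q z * a z) \<omega>) < 0}"
  shows "\<exists>\<eta> :: nat \<Rightarrow> 'a \<Rightarrow> complex. (\<forall>j. bounded_on_cube (\<eta> j)) \<and>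
    (\<forall>N c. (\<exists>j\<le>N. c j \<noteq> 0) \<longrightarrow> Re (LINT z|lborel. a z * autocorr (\<lambda>x. \<Sum>j\<le>N. c j *\<^sub>R \<eta> j x) z) < 0)"
proof -
  have [measurable]: "a \<in> borel_measurable borel" using borel_measurable_integrable[OF a] by simp
  define a1 where "a1 z = indicator Q z * a z" for z
  have a1: "integrable lborel a1"
    unfolding a1_def by (rule Bochner_Integration.integrable_bound[OF a]) (auto simp: indicator_def)
  obtain \<omega> :: "nat \<Rightarrow> 'a" where \<omega>: "inj \<omega>" "\<And>j. \<omega> j \<in> lattice_freqs r" "\<And>j. Re (ft a1 (\<omega> j)) < 0"
    using infinite_countable_subset[OF inf] unfolding a1_def by blast
  define \<eta> where "\<eta> j x = indicator T x * (complex_of_real (bump x) * cis (\<omega> j \<bullet> x))" for j x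
  have \<eta>: "bounded_on_cube (\<eta> j)" for j
    unfolding bounded_on_cube_def
  proof (intro conjI exI[of _ 1] allI impI)
    show "\<eta> j \<in> borel_measurable borel" unfolding \<eta>_def[abs_def] by measurable
    show "cmod (\<eta> j x) \<le> 1" for x
      using bump_nonneg[of x] bump_le_1[of x] by (simp add: \<eta>_def norm_mult indicator_def)
    show "\<eta> j x = 0" if "x \<notin> supp_cube" for x
      using bump_eq_0[OF that] r by (force simp: \<eta>_def T_def indicator_def)
  qed
  have "Re (LINT z|lborel. a z * autocorr (\<lambda>x. \<Sum>j\<le>N. c j *\<^sub>R \<eta> j x) z) < 0"
    if c: "\<exists>j\<le>N. c j \<noteq> 0" for N and c :: "nat \<Rightarrow> real"
  proof -
    define h where "h x = (\<Sum>j\<le>N. complex_of_real (c j) * cis (\<omega> j \<bullet> x))" for x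
    define F where "F x = complex_of_real (bump x) * h x" for x
    have h_trig: "trig_poly r h"
      unfolding h_def by (intro trig_poly_sum trig_poly_monomial \<omega>(2))
    have [measurable]: "h \<in> borel_measurable borel" by (rule trig_poly_measurable[OF h_trig])
    have F_meas: "F \<in> borel_measurable borel" unfolding F_def[abs_def] by measurable
    have F_approx: "trig_approx r F"
      unfolding F_def bump_def of_real_prod
      by (intro trig_approx_mult trig_approx_prod trig_approx_max_cos trig_approx_poly h_trig)
    obtain B where B: "\<And>x. cmod (F x) \<le> B" using trig_approx_bounded[OF F_approx] by blast
    have "(\<lambda>x. \<Sum>j\<le>N. c j *\<^sub>R \<eta> j x) = (\<lambda>x. indicator T x * F x)"
      by (simp add: fun_eq_iff \<eta>_def F_def h_def sum_distrib_left scaleR_conv_of_real mult_ac)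
    moreover have "autocorr (\<lambda>x. indicator T x * F x) z = indicator Q z * per_autocorr F z" for z
      unfolding F_def[abs_def] by (rule autocorr_eq_per_autocorr)
    ultimately have form: "(LINT z|lborel. a z * autocorr (\<lambda>x. \<Sum>j\<le>N. c j *\<^sub>R \<eta> j x) z) = (LINT z|lborel. a1 z * per_autocorr F z)"
      by (simp only: a1_def mult_ac)
    have le: "Re (LINT z|lborel. a1 z * per_autocorr F z)
        \<le> (cmod (fourier_coeff F (\<omega> j)))\<^sup>2 / (2 * r) ^ DIM('a) * Re (ft a1 (\<omega> j))" for j
      by (rule trig_approx_form_le[OF a1 _ F_approx F_meas \<omega>(2)]) (use nonpos in \<open>simp add: a1_def[abs_def]\<close>)
    have "\<exists>j\<le>N. fourier_coeff F (\<omega> j) \<noteq> 0"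
    proof (rule ccontr)
      assume "\<not> ?thesis"
      then have zero: "fourier_coeff F (\<omega> j) = 0" if "j \<le> N" for j using that by blast
      have int: "integrable lborel (\<lambda>y. indicator T y * (F y * cis (- (\<omega> j \<bullet> y))))" for j
        using B F_meas by (intro integrable_on_T[of _ B]) (auto simp: norm_mult)
      have F_h: "complex_of_real (indicator T y * (bump y * (cmod (h y))\<^sup>2))
          = (\<Sum>j\<le>N. complex_of_real (c j) * (indicator T y * (F y * cis (- (\<omega> j \<bullet> y)))))" for y
      proof -
        have "complex_of_real (indicator T y * (bump y * (cmod (h y))\<^sup>2)) = indicator T y * (F y * cnj (h y))"
          unfolding of_real_mult complex_norm_square F_def by (simp add: indicator_def)
        also have "cnj (h y) = (\<Sum>j\<le>N. complex_of_real (c j) * cis (- (\<omega> j \<bullet> y)))"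
          by (simp add: h_def cis_cnj)
        finally show ?thesis by (simp add: sum_distrib_left mult_ac)
      qed
      have ind_int: "integrable lborel (\<lambda>y. complex_of_real (indicator T y * (bump y * (cmod (h y))\<^sup>2)))"
        unfolding F_h by (intro Bochner_Integration.integrable_sum integrable_mult_right int)
      have "(LINT y|lborel. complex_of_real (indicator T y * (bump y * (cmod (h y))\<^sup>2)))
          = (\<Sum>j\<le>N. complex_of_real (c j) * fourier_coeff F (\<omega> j))"
        unfolding F_h fourier_coeff_def
        by (subst Bochner_Integration.integral_sum) (intro integrable_mult_right int, simp only: integral_mult_right_zero)
      also have "\<dots> = 0" using zero by simp
      finally have "(LINT y|lborel. indicator T y * (bump y * (cmod (h y))\<^sup>2)) = 0"
        by (simp only: integral_complex_of_real of_real_eq_0_iff)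
      moreover have "integrable lborel (\<lambda>y. indicator T y * (bump y * (cmod (h y))\<^sup>2))"
        using ind_int by (simp only: complex_of_real_integrable_eq)
      ultimately have AE: "AE y in lborel. indicator T y * (bump y * (cmod (h y))\<^sup>2) = 0"
        using integral_nonneg_eq_0_iff_AE[of lborel "\<lambda>y. indicator T y * (bump y * (cmod (h y))\<^sup>2)"] bump_nonneg
        by simp
      have "AE y in lborel. y \<notin> supp_cube \<inter> {y. h y \<noteq> 0}"
        using AE
      proof eventually_elim
        case (elim y)
        then show ?case using bump_pos[of y] supp_cube_subset_T by (auto simp: indicator_def split: if_splits)
      qed
      moreover have "open (supp_cube \<inter> {y. h y \<noteq> 0})"
        unfolding h_def by (intro open_Int open_supp_cube open_Collect_neq continuous_intros)
      ultimately have "supp_cube \<inter> {y. h y \<noteq> 0} = {}" by (intro open_AE_empty)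
      then have h0: "h y = 0" if "y \<in> ball x\<^sub>0 (r / 2)" for y
        using that ball_subset_supp_cube by blast
      have inj: "inj_on \<omega> {..N}" using \<omega>(1) by (rule inj_on_subset) simp
      have "\<forall>\<theta>\<in>\<omega> ` {..N}. complex_of_real (c (inv \<omega> \<theta>)) = 0"
      proof (rule exponentials_independent)
        show "(\<Sum>\<theta>\<in>\<omega> ` {..N}. complex_of_real (c (inv \<omega> \<theta>)) * cis (\<theta> \<bullet> x)) = 0" if "x \<in> ball x\<^sub>0 (r / 2)" for x
          using h0[OF that] by (simp add: sum.reindex[OF inj] \<omega>(1) h_def)
      qed (use r in auto)
      then show False using c \<omega>(1) by auto
    qed
    then obtain j where "fourier_coeff F (\<omega> j) \<noteq> 0" by blast
    then have "(cmod (fourier_coeff F (\<omega> j)))\<^sup>2 / (2 * r) ^ DIM('a) * Re (ft a1 (\<omega> j)) < 0"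
      using \<omega>(3)[of j] r by (intro mult_pos_neg divide_pos_pos) auto
    then show ?thesis unfolding form using le[of j] by linarith
  qed
  then show ?thesis using \<eta> by blast
qed

end

section \<open>Reduction to Borel representatives\<close>

lemma ex_borel_representative:
  fixes u :: "'a::euclidean_space \<Rightarrow> complex"
  assumes u: "u \<in> borel_measurable lebesgue"
  obtains v where "v \<in> borel_measurable borel" "AE x in lborel. u x = v x"
proof -
  have Re: "(\<lambda>x. Re (u x)) \<in> borel_measurable lebesgue" and Im: "(\<lambda>x. Im (u x)) \<in> borel_measurable lebesgue"
    using u by measurable
  obtain p where [measurable]: "p \<in> borel_measurable lborel" and p: "AE x in lborel. Re (u x) = p x"
    using completion_ex_borel_measurable_real[OF Re] by blast
  obtain q where [measurable]: "q \<in> borel_measurable lborel" and q: "AE x in lborel. Im (u x) = q x"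
    using completion_ex_borel_measurable_real[OF Im] by blast
  show thesis
  proof
    show "(\<lambda>x. complex_of_real (p x) + \<i> * complex_of_real (q x)) \<in> borel_measurable borel" by measurable
    show "AE x in lborel. u x = complex_of_real (p x) + \<i> * complex_of_real (q x)"
      using p q by eventually_elim (simp add: complex_eq_iff)
  qed
qed

lemma borel_measurable_lebesgueI: "f \<in> borel_measurable borel \<Longrightarrow> f \<in> borel_measurable lebesgue"
  by (rule measurable_completion) simp

lemma integral_lebesgue_cong_borel:
  fixes f g :: "'a::euclidean_space \<Rightarrow> complex"
  assumes g: "g \<in> borel_measurable borel" and eq: "AE x in lborel. f x = g x"
  shows "(LINT x|lebesgue. f x) = (LINT x|lborel. g x)"
    and "integrable lebesgue f \<longleftrightarrow> integrable lborel g"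
    and "f \<in> borel_measurable lebesgue"
proof -
  have g': "g \<in> borel_measurable lebesgue" by (rule borel_measurable_lebesgueI[OF g])
  have eq': "AE x in lebesgue. f x = g x" by (rule AE_completion[OF eq])
  then have "AE x in lebesgue. g x = f x" by (auto elim: eventually_mono)
  with g' show f: "f \<in> borel_measurable lebesgue" by (rule borel_measurable_AE)
  have g'': "g \<in> borel_measurable lborel" using g by simp
  show "(LINT x|lebesgue. f x) = (LINT x|lborel. g x)"
    using integral_cong_AE[OF f g' eq'] integral_completion[OF g''] by simp
  show "integrable lebesgue f \<longleftrightarrow> integrable lborel g"
    using integrable_cong_AE[OF f g' eq'] integrable_completion[OF g''] by simp
qed

lemma exp_minus_ii: "exp (- \<i> * complex_of_real t) = cis (- t)"
  by (simp add: cis_conv_exp)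

lemma fourier_eq_ft:
  assumes v [measurable]: "v \<in> borel_measurable borel" and eq: "AE x in lborel. u x = v x"
  shows "fourier u = ft v"
proof
  fix x
  have "(LINT \<xi>|lebesgue. u \<xi> * exp (- \<i> * complex_of_real (x \<bullet> \<xi>))) = (LINT \<xi>|lborel. v \<xi> * cis (- (x \<bullet> \<xi>)))"
  proof (rule integral_lebesgue_cong_borel(1))
    show "AE \<xi> in lborel. u \<xi> * exp (- \<i> * complex_of_real (x \<bullet> \<xi>)) = v \<xi> * cis (- (x \<bullet> \<xi>))"
      using eq by eventually_elim (simp only: exp_minus_ii)
  qed measurable
  then show "fourier u x = ft v x" by (simp only: fourier_def ft_def)
qed

text \<open>Changing \<open>a\<close> and \<open>u\<close> on null sets leaves the convolution
  unchanged at every point and the eigenvalue equation unchanged up to null sets. So the equation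
  for Lebesgue measurable functions is equivalent to the one for the operators on classes.\<close>

lemma L2_eigenvalue_iff:
  fixes a V :: "real ^ 'd \<Rightarrow> complex"
  assumes v: "integrable lborel v" and eq: "AE x in lborel. a x = v x"
    and V: "V \<in> borel_measurable borel" "\<And>x. cmod (V x) \<le> B"
  shows "L2_eigenvalue (conv_potential_op a V) (complex_of_real \<kappa>)
    \<longleftrightarrow> (\<exists>u. u \<noteq> 0 \<and> conv_op v u + mult_op V u = \<kappa> *\<^sub>R u)"
proof -
  have v_meas [measurable]: "v \<in> borel_measurable borel" using borel_measurable_integrable[OF v] by simp
  have [measurable]: "V \<in> borel_measurable borel" by (rule V(1))
  \<comment> \<open>This holds at every \<open>x\<close>, because reflection about \<open>x\<close>
    preserves null sets and thus \<open>a (x - y) = v (x - y)\<close> for almost every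
    \<open>y\<close>.\<close>
  have op: "conv_potential_op a V u x = conv v w x + V x * u x"
    if w [measurable]: "w \<in> borel_measurable borel" and uw: "AE x in lborel. u x = w x" for u w x
  proof -
    have "AE y in lborel. a (x - y) = v (x - y)" by (rule AE_lborel_reflect[OF eq])
    then have "AE y in lborel. a (x - y) * u y = v (x - y) * w y" using uw by eventually_elim simp
    then have "(LINT y|lebesgue. a (x - y) * u y) = (LINT y|lborel. v (x - y) * w y)"
      by (intro integral_lebesgue_cong_borel(1)) measurable
    then show ?thesis by (simp add: conv_potential_op_def conv_def)
  qed
  have abs_eq: "conv_op v (abs_l2 w) + mult_op V (abs_l2 w) = \<kappa> *\<^sub>R abs_l2 w
      \<longleftrightarrow> (AE x in lborel. conv v w x + V x * w x = complex_of_real \<kappa> * w x)" if w: "square_integrable w" for w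
    using w by (simp add: conv_op_abs_l2[OF v] mult_op_abs_l2[OF V] abs_l2_add abs_l2_scaleR abs_l2_eq_iff
        square_integrable_conv[OF v] square_integrable_mult_bounded[OF _ V] square_integrable_add
        square_integrable_cmult scaleR_conv_of_real)
  show ?thesis
  proof
    assume "L2_eigenvalue (conv_potential_op a V) (complex_of_real \<kappa>)"
    then obtain u where u: "u \<in> borel_measurable lebesgue" "integrable lebesgue (\<lambda>x. (cmod (u x))\<^sup>2)"
      "\<not> (AE x in lebesgue. u x = 0)"
      "AE x in lebesgue. conv_potential_op a V u x = complex_of_real \<kappa> * u x"
      unfolding L2_eigenvalue_def L2_def by blast
    obtain w where w [measurable]: "w \<in> borel_measurable borel" and uw: "AE x in lborel. u x = w x"
      using ex_borel_representative[OF u(1)] by blast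
    have sq: "square_integrable w"
    proof -
      have "AE x in lebesgue. (cmod (u x))\<^sup>2 = (cmod (w x))\<^sup>2"
        using AE_completion[OF uw] by eventually_elim simp
      then have "integrable lebesgue (\<lambda>x. (cmod (w x))\<^sup>2)"
        using u(1,2) borel_measurable_lebesgueI[OF w]
        by (subst integrable_cong_AE[symmetric, where f = "\<lambda>x. (cmod (u x))\<^sup>2"]) auto
      then show ?thesis
        unfolding square_integrable_def using w by (subst (asm) integrable_completion) auto
    qed
    have "abs_l2 w \<noteq> 0"
    proof
      assume "abs_l2 w = 0"
      then have "AE x in lborel. w x = 0"
        using sq by (simp add: abs_l2_zero[symmetric] abs_l2_eq_iff)
      then have "AE x in lborel. u x = 0" using uw by eventually_elim simp
      then show False using u(3) AE_completion by blast
    qed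
    moreover have "AE x in lborel. conv v w x + V x * w x = complex_of_real \<kappa> * w x"
      using u(4)[unfolded AE_completion_iff] uw by eventually_elim (simp add: op[OF w uw])
    ultimately show "\<exists>u. u \<noteq> 0 \<and> conv_op v u + mult_op V u = \<kappa> *\<^sub>R u"
      using abs_eq[OF sq] by blast
  next
    assume "\<exists>u. u \<noteq> 0 \<and> conv_op v u + mult_op V u = \<kappa> *\<^sub>R u"
    then obtain w where sq: "square_integrable w" and w0: "abs_l2 w \<noteq> 0"
      and ev: "conv_op v (abs_l2 w) + mult_op V (abs_l2 w) = \<kappa> *\<^sub>R abs_l2 w"
      by (metis l2_cases)
    have w [measurable]: "w \<in> borel_measurable borel" by (rule square_integrable_measurable[OF sq])
    have "w \<in> L2"
      unfolding L2_def using sq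
      by (auto simp: square_integrable_def borel_measurable_lebesgueI integrable_completion)
    moreover have "\<not> (AE x in lebesgue. w x = 0)"
      using w0 sq by (auto simp: AE_completion_iff abs_l2_zero[symmetric] abs_l2_eq_iff)
    moreover have "AE x in lebesgue. conv_potential_op a V w x = complex_of_real \<kappa> * w x"
    proof (rule AE_completion)
      show "AE x in lborel. conv_potential_op a V w x = complex_of_real \<kappa> * w x"
        using ev[unfolded abs_eq[OF sq]] by eventually_elim (simp add: op[OF w])
    qed
    ultimately show "L2_eigenvalue (conv_potential_op a V) (complex_of_real \<kappa>)"
      unfolding L2_eigenvalue_def by blast
  qed
qed

section \<open>Cubes and lattice frequencies in coordinates\<close>

lemma ball_Basis_vec: "(\<forall>b\<in>(Basis :: (real ^ 'd) set). P b) \<longleftrightarrow> (\<forall>i. P (axis i 1))"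
  by (auto simp: Basis_vec_def)

lemma cube_eq_supp_cube:
  fixes x\<^sub>0 :: "real ^ 'd"
  assumes "r > 0"
  shows "cube r x\<^sub>0 = cube_form.supp_cube r x\<^sub>0"
proof -
  interpret cube_form r x\<^sub>0 by unfold_locales fact
  show ?thesis by (simp add: cube_def supp_cube_def ball_Basis_vec inner_axis)
qed

lemma cube_eq_Q:
  assumes "r > 0"
  shows "cube (2 * r) (0 :: real ^ 'd) = cube_form.Q r"
proof -
  interpret cube_form r "0 :: real ^ 'd" by unfold_locales fact
  show ?thesis by (simp add: cube_def Q_def ball_Basis_vec inner_axis)
qed

definition lattice_freq :: "real \<Rightarrow> int ^ 'd \<Rightarrow> real ^ 'd" where
  "lattice_freq r n = (\<chi> i. pi / r * of_int (n $ i))"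

lemma lattice_freqs_eq_range: "lattice_freqs r = range (lattice_freq r)"
proof safe
  fix \<omega> :: "real ^ 'd" assume "\<omega> \<in> lattice_freqs r"
  then have "\<exists>k::int. \<omega> $ i = pi / r * of_int k" for i
    by (simp add: lattice_freqs_def ball_Basis_vec inner_axis)
  then obtain k where "\<And>i. \<omega> $ i = pi / r * of_int (k i :: int)" by metis
  then have "\<omega> = lattice_freq r (\<chi> i. k i)" by (simp add: lattice_freq_def vec_eq_iff)
  then show "\<omega> \<in> range (lattice_freq r)" by blast
qed (auto simp: lattice_freqs_def ball_Basis_vec inner_axis lattice_freq_def)

lemma inj_lattice_freq: "r > 0 \<Longrightarrow> inj (lattice_freq r)"
  by (auto simp: inj_def lattice_freq_def vec_eq_iff)

lemma cube_coeff_eq_ft: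
  fixes a :: "real ^ 'd \<Rightarrow> complex"
  assumes r: "r > 0" and v [measurable]: "v \<in> borel_measurable borel" and eq: "AE x in lborel. a x = v x"
  shows "cube_coeff a r n = complex_of_real (1 / (2 * r) ^ CARD('d)) *
    ft (\<lambda>z. indicator (cube_form.Q r) z * v z) (lattice_freq r n)"
proof -
  interpret cube_form r "0 :: real ^ 'd" by unfold_locales fact
  have ex: "exp (- (of_real pi * \<i> / of_real r) * of_real (\<Sum>i\<in>UNIV. of_int (n $ i) * x $ i)) = cis (- (lattice_freq r n \<bullet> x))" for x
  proof -
    have "lattice_freq r n \<bullet> x = pi / r * (\<Sum>i\<in>UNIV. of_int (n $ i) * x $ i)"
      by (simp add: lattice_freq_def inner_vec_def sum_distrib_left mult.assoc)
    then show ?thesis by (simp add: cis_conv_exp mult_ac)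
  qed
  have "(LINT x:cube (2 * r) 0|lebesgue. a x * exp (- (of_real pi * \<i> / of_real r) * of_real (\<Sum>i\<in>UNIV. of_int (n $ i) * x $ i)))
      = (LINT z|lborel. indicator Q z * v z * cis (- (lattice_freq r n \<bullet> z)))"
    unfolding set_lebesgue_integral_def ex cube_eq_Q[OF r]
  proof (rule integral_lebesgue_cong_borel(1))
    show "AE x in lborel. indicator Q x *\<^sub>R (a x * cis (- (lattice_freq r n \<bullet> x)))
        = indicator Q x * v x * cis (- (lattice_freq r n \<bullet> x))"
      using eq by eventually_elim (simp add: indicator_def)
  qed measurable
  then show ?thesis by (simp add: cube_coeff_def ft_def)
qed

text \<open>Only finitely many members lie below each level \<open>b < \<mu>\<close>, so the set is
  countable, and any enumeration without repetitions, in whatever order, is eventually above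
  \<open>b\<close>.\<close>

lemma ex_enumeration_tendsto:
  fixes E :: "real set"
  assumes inf: "infinite E" and less: "\<And>\<kappa>. \<kappa> \<in> E \<Longrightarrow> \<kappa> < \<mu>"
    and fin: "\<And>b. b < \<mu> \<Longrightarrow> finite {\<kappa> \<in> E. \<kappa> \<le> b}"
  shows "\<exists>ev :: nat \<Rightarrow> real. bij_betw ev UNIV E \<and> ev \<longlonglongrightarrow> \<mu>"
proof -
  have "E \<subseteq> (\<Union>n. {\<kappa> \<in> E. \<kappa> \<le> \<mu> - inverse (real (Suc n))})"
  proof
    fix \<kappa> assume \<kappa>: "\<kappa> \<in> E"
    then have "0 < \<mu> - \<kappa>" using less by simp
    then obtain n where "inverse (real (Suc n)) < \<mu> - \<kappa>" using reals_Archimedean by blast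
    then show "\<kappa> \<in> (\<Union>n. {\<kappa> \<in> E. \<kappa> \<le> \<mu> - inverse (real (Suc n))})" using \<kappa> by (auto intro!: exI[of _ n])
  qed
  moreover have "countable (\<Union>n. {\<kappa> \<in> E. \<kappa> \<le> \<mu> - inverse (real (Suc n))})"
    by (intro countable_UN[OF countableI_type] countable_finite fin) simp
  ultimately have "countable E" by (rule countable_subset)
  then have bij: "bij_betw (from_nat_into E) UNIV E" using inf by (rule bij_betw_from_nat_into)
  have "from_nat_into E \<longlonglongrightarrow> \<mu>"
  proof (rule order_tendstoI)
    fix b assume b: "b < \<mu>"
    have "finite (from_nat_into E -` {\<kappa> \<in> E. \<kappa> \<le> b})"
      using fin[OF b] bij by (intro finite_vimageI) (auto simp: bij_betw_def)
    moreover have "from_nat_into E n \<in> E" for n using bij by (auto simp: bij_betw_def)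
    ultimately have "finite {n. \<not> b < from_nat_into E n}"
      by (simp add: vimage_def not_less)
    then show "\<forall>\<^sub>F n in sequentially. b < from_nat_into E n"
      unfolding cofinite_eq_sequentially[symmetric] eventually_cofinite .
  next
    fix b assume "\<mu> < b"
    moreover have "from_nat_into E n < \<mu>" for n using bij less by (auto simp: bij_betw_def)
    ultimately show "\<forall>\<^sub>F n in sequentially. from_nat_into E n < b"
      by (intro always_eventually allI) (meson order_less_trans)
  qed
  with bij show ?thesis by blast
qed

section \<open>Application to the convolution operator with potential\<close>

theorem theorem2p7:
  fixes a Vhat V :: "real ^ 'd \<Rightarrow> complex"
    and a_min a_max V_min \<mu>\<^sub>0 r :: real
    and x\<^sub>0 :: "real ^ 'd"
    and E :: "real set"
  assumes a: "a \<in> L1" "hermitian_fun a"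
    and Vhat: "Vhat \<in> L1" "hermitian_fun Vhat"
    and V: "V = fourier Vhat"
    and a_min: "a_min = inf_Re (fourier a)"
    and a_max: "a_max = sup_Re (fourier a)"
    and V_min: "V_min = inf_Re V"
    and \<mu>\<^sub>0: "\<mu>\<^sub>0 = min a_min V_min"
    and le: "V_min \<le> a_min"
    and r: "r > 0"
    and flat: "\<forall>x \<in> cube r x\<^sub>0. V x = complex_of_real V_min"
    and alternatives:
      "(a_min < 0 \<and> a_max = 0) \<or>
       ((\<forall>n. Re (cube_coeff a r n) \<le> 0) \<and> infinite {n. Re (cube_coeff a r n) < 0})"
    and E: "E = {\<kappa>. L2_eigenvalue (conv_potential_op a V) (complex_of_real \<kappa>)} \<inter> {a_min + V_min..<\<mu>\<^sub>0}"
  shows "\<exists>ev :: nat \<Rightarrow> real. bij_betw ev UNIV E \<and> ev \<longlonglongrightarrow> \<mu>\<^sub>0"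
proof -
  obtain v where v_meas: "v \<in> borel_measurable borel" and av: "AE x in lborel. a x = v x"
    using a(1) ex_borel_representative[of a] by (auto simp: L1_def dest: borel_measurable_integrable)
  obtain W where W_meas: "W \<in> borel_measurable borel" and VW: "AE x in lborel. Vhat x = W x"
    using Vhat(1) ex_borel_representative[of Vhat] by (auto simp: L1_def dest: borel_measurable_integrable)
  have v: "integrable lborel v"
    using a(1) integral_lebesgue_cong_borel(2)[OF v_meas av] by (simp add: L1_def)
  have W: "integrable lborel W"
    using Vhat(1) integral_lebesgue_cong_borel(2)[OF W_meas VW] by (simp add: L1_def)
  have fa: "fourier a = ft v" by (rule fourier_eq_ft[OF v_meas av])
  have V_ft: "V = ft W" unfolding V by (rule fourier_eq_ft[OF W_meas VW])
  have V_meas: "V \<in> borel_measurable borel"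
    unfolding V_ft by (rule borel_measurable_continuous_onI[OF continuous_on_ft[OF W]])
  define B where "B = (LINT y|lborel. cmod (W y))"
  have V_B: "cmod (V x) \<le> B" for x unfolding V_ft B_def by (rule cmod_ft_le)
  have V_real: "V x \<in> \<real>" for x unfolding V by (rule fourier_real[OF Vhat])
  have bdd: "bdd_below (range (\<lambda>x. Re (ft u x)))" "bdd_above (range (\<lambda>x. Re (ft u x)))" for u :: "real ^ 'd \<Rightarrow> complex"
  proof -
    have "\<bar>Re (ft u x)\<bar> \<le> (LINT y|lborel. cmod (u y))" for x
      using abs_Re_le_cmod[of "ft u x"] cmod_ft_le[of u x] by linarith
    then have "- (LINT y|lborel. cmod (u y)) \<le> Re (ft u x)" "Re (ft u x) \<le> (LINT y|lborel. cmod (u y))" for x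
      by (simp_all add: abs_le_iff minus_le_iff)
    then show "bdd_below (range (\<lambda>x. Re (ft u x)))" "bdd_above (range (\<lambda>x. Re (ft u x)))"
      by (auto simp: bdd_below_def bdd_above_def)
  qed
  have a_ge: "a_min \<le> Re (ft v \<xi>)" for \<xi>
    unfolding a_min inf_Re_def fa by (rule cINF_lower[OF bdd(1)]) simp
  have a_le: "Re (ft v \<xi>) \<le> a_max" for \<xi>
    unfolding a_max sup_Re_def fa by (rule cSUP_upper[OF _ bdd(2)]) simp
  have V_ge: "V_min \<le> Re (V x)" for x
    unfolding V_min inf_Re_def V_ft by (rule cINF_lower[OF bdd(1)]) simp
  have herm: "AE x in lborel. v (- x) = cnj (v x)"
  proof -
    have "AE x in lborel. a (- x) = cnj (a x)" using a(2) by (simp add: hermitian_fun_def AE_completion_iff)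
    moreover have "AE x in lborel. a (- x) = v (- x)" using AE_lborel_reflect[OF av, of 0] by simp
    ultimately show ?thesis using av by eventually_elim simp
  qed
  interpret cf: cube_form r x\<^sub>0 by unfold_locales (rule r)
  have flat': "V x = complex_of_real V_min" if "x \<in> cf.supp_cube" for x
    using flat that by (simp add: cube_eq_supp_cube[OF r])
  have "\<exists>\<eta> :: nat \<Rightarrow> real ^ 'd \<Rightarrow> complex. (\<forall>j. cf.bounded_on_cube (\<eta> j)) \<and>
    (\<forall>N c. (\<exists>j\<le>N. c j \<noteq> 0) \<longrightarrow> Re (LINT z|lborel. v z * autocorr (\<lambda>x. \<Sum>j\<le>N. c j *\<^sub>R \<eta> j x) z) < 0)"
    using alternatives
  proof
    assume cond: "a_min < 0 \<and> a_max = 0"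
    have "\<exists>\<zeta>. Re (ft v \<zeta>) < 0"
    proof (rule ccontr)
      assume "\<not> ?thesis"
      then have "0 \<le> a_min"
        unfolding a_min inf_Re_def fa by (intro cINF_greatest) (auto simp: not_less)
      then show False using cond by simp
    qed
    then obtain \<zeta> where \<zeta>: "Re (ft v \<zeta>) < 0" by blast
    have nonpos: "Re (ft v \<xi>) \<le> 0" for \<xi> using a_le[of \<xi>] cond by simp
    \<comment> \<open>The ball of radius \<open>r / 2\<close> about \<open>x\<^sub>0\<close> fits
      into the cube of side \<open>r\<close>.\<close>
    have r2: "r / 2 > 0" using r by simp
    obtain \<eta> :: "nat \<Rightarrow> real ^ 'd \<Rightarrow> complex" where \<eta>: "\<And>j. C_c (\<eta> j)" "\<And>j x. x \<notin> ball x\<^sub>0 (r / 2) \<Longrightarrow> \<eta> j x = 0"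
      and neg: "\<forall>N c. (\<exists>j\<le>N. c j \<noteq> 0) \<longrightarrow> Re (LINT z|lborel. v z * autocorr (\<lambda>x. \<Sum>j\<le>N. c j *\<^sub>R \<eta> j x) z) < 0"
      using ex_test_functions_nonpos_transform[OF v nonpos \<zeta> r2, of x\<^sub>0] by blast
    have "cf.bounded_on_cube (\<eta> j)" for j
    proof -
      obtain M where "\<And>x. cmod (\<eta> j x) \<le> M" using C_c_bounded[OF \<eta>(1)] by blast
      then show ?thesis
        using C_c_measurable[OF \<eta>(1)] \<eta>(2) cf.ball_subset_supp_cube unfolding cf.bounded_on_cube_def by blast
    qed
    then show ?thesis using neg by blast
  next
    assume cond: "(\<forall>n. Re (cube_coeff a r n) \<le> 0) \<and> infinite {n. Re (cube_coeff a r n) < 0}"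
    let ?v1 = "\<lambda>z. indicator cf.Q z * v z"
    have coeff: "Re (cube_coeff a r n) = 1 / (2 * r) ^ CARD('d) * Re (ft ?v1 (lattice_freq r n))" for n
      by (simp add: cube_coeff_eq_ft[OF r v_meas av])
    have pos: "1 / (2 * r) ^ CARD('d) > 0" using r by simp
    show ?thesis
    proof (rule cf.ex_test_functions_nonpos_coeffs[OF v])
      fix \<omega> :: "real ^ 'd" assume "\<omega> \<in> lattice_freqs r"
      then obtain n where n: "\<omega> = lattice_freq r n" unfolding lattice_freqs_eq_range by blast
      have "1 / (2 * r) ^ CARD('d) * Re (ft ?v1 (lattice_freq r n)) \<le> 0" using cond coeff by metis
      then show "Re (ft ?v1 \<omega>) \<le> 0" using pos unfolding n by (simp only: mult_le_0_iff) linarith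
    next
      have "lattice_freq r ` {n. Re (cube_coeff a r n) < 0} \<subseteq> {\<omega> \<in> lattice_freqs r. Re (ft ?v1 \<omega>) < 0}"
        using pos unfolding coeff lattice_freqs_eq_range by (auto simp only: mult_less_0_iff)
      moreover have "infinite (lattice_freq r ` {n. Re (cube_coeff a r n) < 0})"
        using cond finite_imageD[OF _ inj_on_subset[OF inj_lattice_freq[OF r] subset_UNIV]] by blast
      ultimately show "infinite {\<omega> \<in> lattice_freqs r. Re (ft ?v1 \<omega>) < 0}" by (rule infinite_super)
    qed
  qed
  then obtain \<eta> :: "nat \<Rightarrow> real ^ 'd \<Rightarrow> complex" where \<eta>: "\<And>j. cf.bounded_on_cube (\<eta> j)"
    and neg: "\<And>N c. \<exists>j\<le>N. c j \<noteq> 0 \<Longrightarrow> Re (LINT z|lborel. v z * autocorr (\<lambda>x. \<Sum>j\<le>N. c j *\<^sub>R \<eta> j x) z) < 0"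
    by blast
  define h where "h j = abs_l2 (\<eta> j)" for j
  have comb: "(\<Sum>j\<le>N. c j *\<^sub>R h j) = abs_l2 (\<lambda>x. \<Sum>j\<le>N. c j *\<^sub>R \<eta> j x)" for N and c :: "nat \<Rightarrow> real"
    using cf.bounded_on_cube_integrable(2)[OF \<eta>]
    by (simp add: h_def abs_l2_scaleR abs_l2_sum square_integrable_scaleR)
  have form_neg: "inner (conv_op v (\<Sum>j\<le>N. c j *\<^sub>R h j)) (\<Sum>j\<le>N. c j *\<^sub>R h j) < 0"
    if "\<exists>j\<le>N. c j \<noteq> 0" for N and c :: "nat \<Rightarrow> real"
  proof -
    have b: "cf.bounded_on_cube (\<lambda>x. \<Sum>j\<le>N. c j *\<^sub>R \<eta> j x)" by (rule cf.bounded_on_cube_combination[OF \<eta>])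
    then obtain M where M: "\<And>x. cmod (\<Sum>j\<le>N. c j *\<^sub>R \<eta> j x) \<le> M" unfolding cf.bounded_on_cube_def by blast
    show ?thesis
      unfolding comb inner_conv_op_autocorr[OF v cf.bounded_on_cube_integrable[OF b] M] by (rule neg[OF that])
  qed
  \<comment> \<open>The potential is constant where the test functions live, so it acts on their
    span as the scalar \<open>V_min\<close>, and the form of \<open>L - V_min\<close> reduces to
    that of the convolution.\<close>
  have mult_flat: "mult_op V (\<Sum>j\<le>N. c j *\<^sub>R h j) = V_min *\<^sub>R (\<Sum>j\<le>N. c j *\<^sub>R h j)" for N and c :: "nat \<Rightarrow> real"
  proof -
    have b: "cf.bounded_on_cube (\<lambda>x. \<Sum>j\<le>N. c j *\<^sub>R \<eta> j x)" by (rule cf.bounded_on_cube_combination[OF \<eta>])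
    have "V x * (\<Sum>j\<le>N. c j *\<^sub>R \<eta> j x) = V_min *\<^sub>R (\<Sum>j\<le>N. c j *\<^sub>R \<eta> j x)" for x
    proof (cases "x \<in> cf.supp_cube")
      case True
      then show ?thesis by (simp only: flat' scaleR_conv_of_real)
    next
      case False
      then have "(\<Sum>j\<le>N. c j *\<^sub>R \<eta> j x) = 0" using b by (simp add: cf.bounded_on_cube_def)
      then show ?thesis by (simp only: mult_zero_right scaleR_zero_right)
    qed
    then show ?thesis
      unfolding comb mult_op_abs_l2[OF V_meas V_B cf.bounded_on_cube_integrable(2)[OF b]]
        abs_l2_scaleR[OF cf.bounded_on_cube_integrable(2)[OF b]] by (simp only:)
  qed
  \<comment> \<open>The second condition does not state the sign of \<open>a_min\<close>. It follows
    from the negative form value at the single vector \<open>h 0\<close>, since a nonnegative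
    transform would make the form nonnegative.\<close>
  have a_min_neg: "a_min < 0"
  proof (rule ccontr)
    assume "\<not> a_min < 0"
    then have "0 \<le> Re (ft v \<xi>)" for \<xi> using a_ge[of \<xi>] by linarith
    from conv_op_form_ge[OF v this, of "\<Sum>j\<le>0. 1 *\<^sub>R h j"] show False
      using form_neg[of 0 "\<lambda>_. 1"] by simp
  qed
  have \<mu>: "\<mu>\<^sub>0 = V_min" using le \<mu>\<^sub>0 by simp
  interpret semicompact_sum "conv_op v" "mult_op V" V_min
  proof (rule semicompact_sum.intro)
    show "bounded_linear (conv_op v)" by (rule bounded_linear_conv_op[OF v])
    show "bounded_linear (mult_op V)" by (rule bounded_linear_mult_op[OF V_meas V_B])
    show "inner (conv_op v u) w = inner u (conv_op v w)" for u w by (rule inner_conv_op[OF v herm])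
    show "inner (mult_op V u) w = inner u (mult_op V w)" for u w by (rule inner_mult_op[OF V_meas V_B V_real])
    show "V_min * (norm u)\<^sup>2 \<le> inner (conv_op v u) u" for u
      by (rule conv_op_form_ge[OF v]) (use a_ge le order_trans in blast)
    show "V_min * (norm u)\<^sup>2 \<le> inner (mult_op V u) u" for u by (rule inner_mult_op_ge[OF V_meas V_B V_ge])
    have "seq_compact_op (\<lambda>u. conv_op v (mult_op V u))"
    proof (rule seq_compact_op_conv_mult[OF v V_meas V_B])
      fix e :: real assume "e > 0"
      then show "\<exists>R. \<forall>x. R \<le> norm x \<longrightarrow> cmod (V x) < e"
        unfolding V_ft using riemann_lebesgue[OF W] by metis
    qed
    then show "\<exists>r. strict_mono r \<and> convergent (\<lambda>k. conv_op v (mult_op V (u (r k))))"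
      if "bounded (range u)" for u :: "nat \<Rightarrow> (real ^ 'd) l2"
      using that unfolding seq_compact_op_def by blast
  qed
  have ev_iff: "L2_eigenvalue (conv_potential_op a V) (complex_of_real \<kappa>) \<and> \<kappa> < V_min \<longleftrightarrow> eigenvalue_below \<kappa>" for \<kappa>
    unfolding eigenvalue_below_def L_def L2_eigenvalue_iff[OF v av V_meas V_B] by blast
  have E_eq: "E = {\<kappa>. eigenvalue_below \<kappa>} - {\<kappa>. eigenvalue_below \<kappa> \<and> \<kappa> < a_min + V_min}"
    unfolding E \<mu> by (auto simp: ev_iff[symmetric])
  \<comment> \<open>Negativity of \<open>a_min\<close> puts the left endpoint strictly below
    \<open>V_min\<close>, where the eigenvalues cannot accumulate; discarding finitely many of them
    leaves infinitely many.\<close>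
  have fin: "finite {\<kappa>. eigenvalue_below \<kappa> \<and> \<kappa> < a_min + V_min}"
    by (rule finite_subset[OF _ finite_eigenvalues_below[of "a_min + V_min"]]) (use a_min_neg in auto)
  show ?thesis
    unfolding \<mu>
  proof (rule ex_enumeration_tendsto)
    have "infinite {\<kappa>. eigenvalue_below \<kappa>}"
    proof (rule infinite_eigenvalues_below)
      fix N and c :: "nat \<Rightarrow> real" assume "\<exists>j\<le>N. c j \<noteq> 0"
      from form_neg[OF this]
      show "inner (L (\<Sum>j\<le>N. c j *\<^sub>R h j)) (\<Sum>j\<le>N. c j *\<^sub>R h j) < V_min * (norm (\<Sum>j\<le>N. c j *\<^sub>R h j))\<^sup>2"
        by (simp add: L_def inner_add_left mult_flat dot_square_norm)
    qed
    then show "infinite E" unfolding E_eq by (rule Diff_infinite_finite[OF fin])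
    show "\<kappa> < V_min" if "\<kappa> \<in> E" for \<kappa> using that by (simp add: E \<mu>)
    show "finite {\<kappa> \<in> E. \<kappa> \<le> b}" if "b < V_min" for b
      by (rule finite_subset[OF _ finite_eigenvalues_below[OF that]]) (auto simp: E_eq)
  qed
qed

end
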